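(* Let $\{\mathcal{P}_i\}_{i=0}^{\ell}$ be a sequence of (slowly varying) reversible ergodic Markov chains on a finite state space $\Omega$, with stationary distributions $\{\pi_i\}_{i=0}^{\ell}$, spectral gaps $\{\delta(\mathcal{P}_i)\}_{i=0}^{\ell}$, and overlap lower bounds $|\langle \pi_i|\pi_{i+1}\rangle|^2\ge p_i>0$ for all $i\in\{0,\ldots,\ell-1\}$. Put $p_{\min}:=\min_{0\le i\le \ell-1}p_i$ and $\Delta_{\min}:=\min_{0\le i\le\ell}\Delta_{\mathcal{W}_i}$, where $\Delta_{\mathcal W_i}$ is the phase gap of the qubitized Szegedy walk $\mathcal W_i$ of $\mathcal P_i$. Assume that $|\pi_0\rangle$ can be prepared exactly and that one has access to the oracles $O_{\mathcal{P}_i}$. Then, for any $\varepsilon\in(0,1)$, the QSample preparation algorithm (described in the context, with a suitable choice of its per-stage accuracies subject to the stated constraint) outputs a state $|\widetilde{\Psi}_\ell\rangle$ satisfying $$D_{\mathrm{tr}}\bigl(|\widetilde{\Psi}_\ell\rangle,\ \mathcal J|\pi_\ell\rangle\bigr)\le\varepsilon$$ using $$\mathcal{O}\!\left(\frac{\ell}{\sqrt{p_{\min}}\,\Delta_{\min}}\,\log\frac{\ell}{\varepsilon}\,\log\!\left(\frac{\ell}{\varepsilon\sqrt{p_{\min}}}\log\frac{\ell}{\varepsilon}\right)\right)$$ queries to $\{O_{\mathcal{P}_i},O_{\mathcal{P}_i}^\dagger\}_{i=0}^{\ell}$, and one additional qubit in the working register (i.e. one qubit besides the two registers $A$ and $B$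 that encode $\Omega$).
   Context: Single-chain notation. For a reversible ergodic Markov chain $\mathcal P$ on a finite set $\Omega$ with transition matrix $P$ and stationary distribution $\pi$, the spectral gap is $\delta(\mathcal P):=1-\lambda_2(P)$, with $\lambda_2(P)$ the second-largest eigenvalue, and $|\pi\rangle:=\sum_{x\in\Omega}\sqrt{\pi(x)}\,|x\rangle$, $\Pi_\pi:=|\pi\rangle\langle\pi|$. Registers $A,B$ (each $n_\Omega=\lceil\log_2|\Omega|\rceil$ qubits) have state spaces $\mathcal H_A,\mathcal H_B$ with basis indexed by $\Omega$, $|0\rangle_B$ is the all-zeros reference basis state of $B$, and $\mathcal H_s\cong\mathbb C^2$ is a signal qubit. The step isometry is $\mathcal T|x\rangle:=|x\rangle\sum_{y}\sqrt{P(x,y)}|y\rangle$ from $\mathcal H_A$ to $\mathcal H_A\otimes\mathcal H_B$; $S|x\rangle|y\rangle:=|y\rangle|x\rangle$; the qubitized Szegedy walk is $\mathcal W:=(2\mathcal T\mathcal T^\dagger-\mathbb I)S$. The oracle $O_{\mathcal P}$ is a unitary on $\mathcal H_A\otimes\mathcal H_B$ with $O_{\mathcal P}|x\rangle|0\rangle=\sum_y\sqrt{P(x,y)}|x\rangle|y\rangle$ for all $x$; a query is a use of $O_{\mathcal P}$ or $O_{\mathcal P}^\dagger$. One application of (controlled-)$\mathcal W=\bigl[O_{\mathcal P}(\mathbb I\otimes(2|0\rangle\langle0|-\mathbb I))O_{\mathcal P}^\dagger\bigr]S$ uses two queries. The phase gap is $\Delta_{\mathcal W}:=\min\{|\theta|:\theta\ne0,\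 e^{i\theta}\in\mathrm{spec}(\mathcal W),\ \theta\in(-\pi,\pi]\}$. The embedding $\mathcal J:\mathcal H_A\to\mathcal H_s\otimes\mathcal H_A\otimes\mathcal H_B$ is $\mathcal J|v\rangle:=|0\rangle_s|v\rangle_A|0\rangle_B$. For normalized pure states $D_{\mathrm{tr}}(|\alpha\rangle,|\beta\rangle):=\sqrt{1-|\langle\alpha|\beta\rangle|^2}$ (trace distance). Projector circuit. Let $\Pi_0$ be the orthogonal projector onto $\ker(\mathcal W-\mathbb I)$. For $\eta\in(0,1)$, $\mathcal C_{\Delta_{\mathcal W},\eta}(\mathcal W)$ is the generalized-quantum-signal-processing unitary on $\mathcal H_s\otimes\mathcal H_A\otimes\mathcal H_B$, built from $d=\mathcal O(\Delta_{\mathcal W}^{-1}\log(1/\eta))$ controlled-$\mathcal W$ operators (controlled on the signal qubit) interleaved with single-qubit gates on the signal qubit, with $$\mathcal C_{\Delta_{\mathcal W},\eta}(\mathcal W)(|0\rangle_s\otimes\mathbb I_{AB})=|0\rangle_s\otimes\Upsilon(\mathcal W)+|1\rangle_s\otimes\Phi(\mathcal W),$$ where $\Upsilon,\Phi\in\mathbb C[x]$ are degree-$d$ polynomials, $\Upsilon(1)=1$, $|\Upsilon(e^{i\theta})|\le\eta$ for every eigenvalue $e^{i\theta}\ne1$ of $\mathcal W$ (so $\|\Upsilon(\mathcal W)-\Pi_0\|\le\eta$), and $\Upsilon(\mathcal W)^\dagger\Upsilon(\mathcal W)+\Phi(\mathcal W)^\dagger\Phi(\mathcal W)=\mathbb I$.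 Selective phases. The ideal selective phase is $\mathcal S_\phi(\Pi):=\mathbb I+(e^{i\phi}-1)\Pi$. With $P_\phi:=e^{i\phi}|0\rangle\langle0|+|1\rangle\langle1|$ on the signal qubit, the compiled selective phase with accuracy $\eta$ is $$\widetilde{\mathcal S}_\phi(\Pi_0):=(\mathbb I_s\otimes O_{\mathcal P}^\dagger)\,\mathcal C_{\Delta_{\mathcal W},\eta}(\mathcal W)^\dagger(P_\phi\otimes\mathbb I_{AB})\,\mathcal C_{\Delta_{\mathcal W},\eta}(\mathcal W)\,(\mathbb I_s\otimes O_{\mathcal P}).$$ A subscript $k$, as in $\widetilde{\mathcal S}_{k,\phi}$, means this construction for the chain $\mathcal P_k$. Fixed-point amplitude amplification (FPAA; Yoder, Low and Chuang). If $|\langle\pi_i|\pi_{i+1}\rangle|^2\ge p_i>0$ and $\varepsilon_i^{\mathrm{FP}}\in(0,1)$, there are an odd integer $L_i=\mathcal O(p_i^{-1/2}\log(1/\varepsilon_i^{\mathrm{FP}}))$ and angles $\{\alpha_j,\beta_j\}_{j=1}^{(L_i-1)/2}$ such that $U_i^{\mathrm{FP}}:=\prod_{j=1}^{(L_i-1)/2}\mathcal S_{\beta_j}(\Pi_{\pi_{i+1}})\mathcal S_{\alpha_j}(\Pi_{\pi_i})$ satisfies $D_{\mathrm{tr}}(U_i^{\mathrm{FP}}|\pi_i\rangle,|\pi_{i+1}\rangle)\le\varepsilon_i^{\mathrm{FP}}$. QSample preparation algorithm. Input: $\{\mathcal P_i,\pi_i,\mathcal W_i,\Delta_{\mathcal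 W_i}\}_{i=0}^\ell$, the bounds $p_i$, the state $|\pi_0\rangle$, and $\varepsilon$. Choose per-stage accuracies with $\varepsilon_i^{\mathrm{FP}}+2(L_i-1)\varepsilon_i^{\mathcal W}\le\varepsilon/\ell$, and set $|\widetilde\Psi_0\rangle:=\mathcal J|\pi_0\rangle$. For $i=0,\dots,\ell-1$ set $|\widetilde\Psi_{i+1}\rangle:=\widetilde U_i^{\mathrm{FP}}|\widetilde\Psi_i\rangle$, where $\widetilde U_i^{\mathrm{FP}}:=\prod_{j=1}^{(L_i-1)/2}\widetilde{\mathcal S}_{i+1,\beta_j}(\Pi_0)\,\widetilde{\mathcal S}_{i,\alpha_j}(\Pi_0)$ uses the FPAA angles of stage $i$ (factors in the same order as in $U_i^{\mathrm{FP}}$) and every compiled selective phase has accuracy $\eta=\varepsilon_i^{\mathcal W}$. Return $|\widetilde\Psi_\ell\rangle$. $\mathcal O(\cdot)$ has its usual asymptotic meaning: an upper bound up to an absolute constant for all sufficiently small accuracy parameters. *)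

theory Defs
  imports Complex_Main "Jordan_Normal_Form.Spectral_Radius"
begin

text \<open>The state space \<open>\<Omega>\<close> is \<open>{0..<N}\<close>. Keeping the size \<open>N\<close> a term (rather than a type) lets the
  constants hidden in \<open>O(.)\<close> be chosen before \<open>N\<close>.\<close>


section \<open>Reversible ergodic Markov chains\<close>

definition stochastic :: "nat \<Rightarrow> real mat \<Rightarrow> bool" where
  "stochastic N P \<longleftrightarrow> P \<in> carrier_mat N N \<and> (\<forall>x<N. \<forall>y<N. 0 \<le> P $$ (x, y))
     \<and> (\<forall>x<N. (\<Sum>y<N. P $$ (x, y)) = 1)"

definition irreducible_chain :: "nat \<Rightarrow> real mat \<Rightarrow> bool" where
  "irreducible_chain N P \<longleftrightarrow> (\<forall>x<N. \<forall>y<N. \<exists>k. 0 < (P ^\<^sub>m k) $$ (x, y))"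

definition aperiodic_chain :: "nat \<Rightarrow> real mat \<Rightarrow> bool" where
  "aperiodic_chain N P \<longleftrightarrow> (\<forall>x<N. Gcd {k. 0 < k \<and> 0 < (P ^\<^sub>m k) $$ (x, x)} = 1)"

definition stationary :: "nat \<Rightarrow> real mat \<Rightarrow> real vec \<Rightarrow> bool" where
  "stationary N P \<mu> \<longleftrightarrow> \<mu> \<in> carrier_vec N \<and> (\<forall>x<N. 0 \<le> \<mu> $ x) \<and> (\<Sum>x<N. \<mu> $ x) = 1
     \<and> transpose_mat P *\<^sub>v \<mu> = \<mu>"

definition reversible_ergodic_chain :: "nat \<Rightarrow> real mat \<Rightarrow> real vec \<Rightarrow> bool" where
  "reversible_ergodic_chain N P \<mu> \<longleftrightarrow> stochastic N P \<and> irreducible_chain N P \<and> aperiodic_chain N P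
     \<and> stationary N P \<mu> \<and> (\<forall>x<N. \<forall>y<N. \<mu> $ x * P $$ (x, y) = \<mu> $ y * P $$ (y, x))"


section \<open>States and operators\<close>

definition kron :: "complex mat \<Rightarrow> complex mat \<Rightarrow> complex mat" (infixr \<open>\<otimes>\<^sub>m\<close> 75) where
  "A \<otimes>\<^sub>m B = mat (dim_row A * dim_row B) (dim_col A * dim_col B)
     (\<lambda>(i, j). A $$ (i div dim_row B, j div dim_col B) * B $$ (i mod dim_row B, j mod dim_col B))"

text \<open>Basis vectors are column matrices, so that they can be factors of \<open>\<otimes>\<^sub>m\<close>.\<close>

definition ket :: "nat \<Rightarrow> nat \<Rightarrow> complex mat" where
  "ket n i = mat n 1 (\<lambda>(r, c). if r = i then 1 else 0)"

definition ketbra :: "nat \<Rightarrow> nat \<Rightarrow> complex mat" where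
  "ketbra n i = ket n i * mat_adjoint (ket n i)"

definition vproj :: "complex vec \<Rightarrow> complex mat" where
  "vproj v = mat (dim_vec v) (dim_vec v) (\<lambda>(i, j). v $ i * cnj (v $ j))"

definition unitary_op :: "nat \<Rightarrow> complex mat \<Rightarrow> bool" where
  "unitary_op n U \<longleftrightarrow> U \<in> carrier_mat n n \<and> mat_adjoint U * U = 1\<^sub>m n \<and> U * mat_adjoint U = 1\<^sub>m n"

definition mat_poly :: "complex poly \<Rightarrow> complex mat \<Rightarrow> complex mat" where
  "mat_poly p A = mat (dim_row A) (dim_col A)
     (\<lambda>(i, j). \<Sum>k\<le>degree p. coeff p k * (A ^\<^sub>m k) $$ (i, j))"

definition trace_dist :: "complex vec \<Rightarrow> complex vec \<Rightarrow> real" where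
  "trace_dist a b = sqrt (1 - (cmod (a \<bullet>c b))\<^sup>2)"

definition qsample :: "nat \<Rightarrow> real vec \<Rightarrow> complex vec" where
  "qsample N \<mu> = vec N (\<lambda>x. complex_of_real (sqrt (\<mu> $ x)))"

definition selective_phase :: "real \<Rightarrow> complex mat \<Rightarrow> complex mat" where
  "selective_phase \<phi> Q = 1\<^sub>m (dim_row Q) + (cis \<phi> - 1) \<cdot>\<^sub>m Q"


section \<open>The qubitized Szegedy walk\<close>

text \<open>The basis state \<open>|x\<rangle>|y\<rangle>\<close> of the registers \<open>A, B\<close> has index \<open>x * N + y\<close>; the all-zeros reference
  state of \<open>B\<close> has index 0.\<close>

definition step_isometry :: "nat \<Rightarrow> real mat \<Rightarrow> complex mat" where
  "step_isometry N P = mat (N * N) N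
     (\<lambda>(i, x). if i div N = x then complex_of_real (sqrt (P $$ (x, i mod N))) else 0)"

definition swap_op :: "nat \<Rightarrow> complex mat" where
  "swap_op N = mat (N * N) (N * N)
     (\<lambda>(i, j). if i div N = j mod N \<and> i mod N = j div N then 1 else 0)"

definition walk :: "nat \<Rightarrow> real mat \<Rightarrow> complex mat" where
  "walk N P = (2 \<cdot>\<^sub>m (step_isometry N P * mat_adjoint (step_isometry N P)) - 1\<^sub>m (N * N)) * swap_op N"

definition phase_gap :: "nat \<Rightarrow> real mat \<Rightarrow> real" where
  "phase_gap N P = Min {\<bar>\<theta>\<bar> |\<theta>. \<theta> \<noteq> 0 \<and> cis \<theta> \<in> spectrum (walk N P) \<and> - pi < \<theta> \<and> \<theta> \<le> pi}"

definition is_oracle :: "nat \<Rightarrow> real mat \<Rightarrow> complex mat \<Rightarrow> bool" where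
  "is_oracle N P U \<longleftrightarrow> unitary_op (N * N) U \<and> U * (1\<^sub>m N \<otimes>\<^sub>m ket N 0) = step_isometry N P"

text \<open>\<open>|v\<rangle> \<mapsto> |0\<rangle>|v\<rangle>|0\<rangle>\<close>, with the registers in the order signal qubit, \<open>A\<close>, \<open>B\<close>\<close>

definition init_embed :: "nat \<Rightarrow> complex mat" where
  "init_embed N = ket 2 0 \<otimes>\<^sub>m 1\<^sub>m N \<otimes>\<^sub>m ket N 0"


section \<open>Circuits on signal qubit, A and B\<close>

text \<open>\<open>CSwap\<close> and \<open>CRefl\<close> are the swap of \<open>A\<close> and \<open>B\<close> and the reflection \<open>2|0\<rangle>\<langle>0| - I\<close> on \<open>B\<close>, both
  controlled on the signal qubit being \<open>|0\<rangle>\<close>. A circuit is listed in order of application. \<open>Oracle k\<close>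
  and \<open>OracleAdj k\<close> are the only gates that depend on the Markov chains.\<close>

datatype gate = Signal "complex mat" | Oracle nat | OracleAdj nat | CRefl | CSwap

type_synonym circuit = "gate list"

fun gate_op :: "nat \<Rightarrow> (nat \<Rightarrow> complex mat) \<Rightarrow> gate \<Rightarrow> complex mat" where
  "gate_op N Or (Signal V) = V \<otimes>\<^sub>m 1\<^sub>m (N * N)"
| "gate_op N Or (Oracle k) = 1\<^sub>m 2 \<otimes>\<^sub>m Or k"
| "gate_op N Or (OracleAdj k) = 1\<^sub>m 2 \<otimes>\<^sub>m mat_adjoint (Or k)"
| "gate_op N Or CRefl =
     ketbra 2 0 \<otimes>\<^sub>m 1\<^sub>m N \<otimes>\<^sub>m (2 \<cdot>\<^sub>m ketbra N 0 - 1\<^sub>m N) + ketbra 2 1 \<otimes>\<^sub>m 1\<^sub>m (N * N)"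
| "gate_op N Or CSwap = ketbra 2 0 \<otimes>\<^sub>m swap_op N + ketbra 2 1 \<otimes>\<^sub>m 1\<^sub>m (N * N)"

definition circuit_op :: "nat \<Rightarrow> (nat \<Rightarrow> complex mat) \<Rightarrow> circuit \<Rightarrow> complex mat" where
  "circuit_op N Or c = foldl (\<lambda>M g. gate_op N Or g * M) (1\<^sub>m (2 * (N * N))) c"

fun gate_adj :: "gate \<Rightarrow> gate" where
  "gate_adj (Signal V) = Signal (mat_adjoint V)"
| "gate_adj (Oracle k) = OracleAdj k"
| "gate_adj (OracleAdj k) = Oracle k"
| "gate_adj CRefl = CRefl"
| "gate_adj CSwap = CSwap"

definition circuit_adj :: "circuit \<Rightarrow> circuit" where
  "circuit_adj c = rev (map gate_adj c)"

fun is_query :: "gate \<Rightarrow> bool" where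
  "is_query (Oracle k) = True"
| "is_query (OracleAdj k) = True"
| "is_query _ = False"

definition queries :: "circuit \<Rightarrow> nat" where
  "queries c = length (filter is_query c)"

datatype register = SigReg | RegA | RegB

fun gate_registers :: "gate \<Rightarrow> register set" where
  "gate_registers (Signal V) = {SigReg}"
| "gate_registers (Oracle k) = {RegA, RegB}"
| "gate_registers (OracleAdj k) = {RegA, RegB}"
| "gate_registers CRefl = {SigReg, RegB}"
| "gate_registers CSwap = {SigReg, RegA, RegB}"

definition state_qubits :: "nat \<Rightarrow> nat" where
  "state_qubits N = nat \<lceil>log 2 (real N)\<rceil>"

fun register_qubits :: "nat \<Rightarrow> register \<Rightarrow> nat" where
  "register_qubits N SigReg = 1"
| "register_qubits N RegA = state_qubits N"
| "register_qubits N RegB = state_qubits N"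

definition circuit_qubits :: "nat \<Rightarrow> circuit \<Rightarrow> nat" where
  "circuit_qubits N c = (\<Sum>r\<in>\<Union>(gate_registers ` set c). register_qubits N r)"


section \<open>Projector circuit\<close>

text \<open>The walk of chain \<open>k\<close> controlled on signal \<open>|0\<rangle>\<close>. The two oracle gates need no control: when the
  controlled gates do not fire they cancel.\<close>

definition controlled_walk :: "nat \<Rightarrow> circuit" where
  "controlled_walk k = [CSwap, OracleAdj k, CRefl, Oracle k]"

text \<open>Signal gates \<open>V\<^sub>0, \<dots>, V\<^sub>d\<close> interleaved with \<open>d\<close> controlled walks. Controlling on \<open>|0\<rangle>\<close> rather
  than \<open>|1\<rangle>\<close> is no restriction, as bit flips can be absorbed into the signal gates.\<close>

fun gqsp_circuit :: "nat \<Rightarrow> complex mat list \<Rightarrow> circuit" where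
  "gqsp_circuit k [] = []"
| "gqsp_circuit k (V # Vs) = Signal V # concat (map (\<lambda>V'. controlled_walk k @ [Signal V']) Vs)"

definition gqsp_degree :: "complex mat list \<Rightarrow> nat" where
  "gqsp_degree Vs = length Vs - 1"

definition projector_circuit ::
  "nat \<Rightarrow> (nat \<Rightarrow> real mat) \<Rightarrow> (nat \<Rightarrow> complex mat) \<Rightarrow> nat \<Rightarrow> real \<Rightarrow> complex mat list \<Rightarrow> bool" where
  "projector_circuit N P Or k \<eta> Vs \<longleftrightarrow> Vs \<noteq> [] \<and> (\<forall>V\<in>set Vs. unitary_op 2 V)
     \<and> (\<exists>Y F. degree Y \<le> gqsp_degree Vs \<and> degree F \<le> gqsp_degree Vs
         \<and> circuit_op N Or (gqsp_circuit k Vs) * (ket 2 0 \<otimes>\<^sub>m 1\<^sub>m (N * N))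
             = ket 2 0 \<otimes>\<^sub>m mat_poly Y (walk N (P k)) + ket 2 1 \<otimes>\<^sub>m mat_poly F (walk N (P k))
         \<and> poly Y 1 = 1
         \<and> (\<forall>z \<in> spectrum (walk N (P k)). z \<noteq> 1 \<longrightarrow> cmod (poly Y z) \<le> \<eta>)
         \<and> mat_adjoint (mat_poly Y (walk N (P k))) * mat_poly Y (walk N (P k))
             + mat_adjoint (mat_poly F (walk N (P k))) * mat_poly F (walk N (P k)) = 1\<^sub>m (N * N))"

text \<open>A choice of projector circuit for every chain and accuracy, with \<open>d = O(1/\<Delta> log(1/\<eta>))\<close>
  witnessed by the constant \<open>K\<close> and the threshold \<open>e\<^sub>0\<close>. (Such a bound cannot hold for all \<open>\<eta> < 1\<close>,
  since \<open>d \<ge> 1\<close> while the logarithm tends to 0.)\<close>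

definition projector_family :: "real \<Rightarrow> real \<Rightarrow> nat \<Rightarrow> nat \<Rightarrow> (nat \<Rightarrow> real mat) \<Rightarrow> (nat \<Rightarrow> complex mat)
    \<Rightarrow> (nat \<Rightarrow> real \<Rightarrow> complex mat list) \<Rightarrow> bool" where
  "projector_family K e\<^sub>0 N l P Or G \<longleftrightarrow> (\<forall>k\<le>l. \<forall>\<eta>. 0 < \<eta> \<and> \<eta> < 1 \<longrightarrow>
     projector_circuit N P Or k \<eta> (G k \<eta>)
     \<and> (\<eta> \<le> e\<^sub>0 \<longrightarrow> real (gqsp_degree (G k \<eta>)) \<le> K / phase_gap N (P k) * ln (1 / \<eta>)))"

definition compiled_phase :: "nat \<Rightarrow> complex mat list \<Rightarrow> real \<Rightarrow> circuit" where
  "compiled_phase k Vs \<phi> =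
     Oracle k # gqsp_circuit k Vs @ [Signal (cis \<phi> \<cdot>\<^sub>m ketbra 2 0 + ketbra 2 1)]
       @ circuit_adj (gqsp_circuit k Vs) @ [OracleAdj k]"


section \<open>Fixed-point amplitude amplification\<close>

text \<open>A schedule is the list \<open>(\<alpha>\<^sub>1, \<beta>\<^sub>1), \<dots>, (\<alpha>\<^sub>m, \<beta>\<^sub>m)\<close> with \<open>L = 2 m + 1\<close>. The product over \<open>j\<close> is read
  as an operator product from left to right, so the factor \<open>j = 1\<close> is applied last.\<close>

type_synonym schedule = "(real \<times> real) list"

definition schedule_len :: "schedule \<Rightarrow> nat" where
  "schedule_len s = 2 * length s + 1"

definition fpaa_op :: "complex vec \<Rightarrow> complex vec \<Rightarrow> schedule \<Rightarrow> complex mat" where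
  "fpaa_op u v s = foldr
     (\<lambda>(\<alpha>, \<beta>) M. selective_phase \<beta> (vproj v) * selective_phase \<alpha> (vproj u) * M) s (1\<^sub>m (dim_vec u))"

text \<open>A choice of schedule for every stage and accuracy, with \<open>L = O(1/sqrt p log(1/e))\<close> witnessed by
  \<open>K\<close> and \<open>e\<^sub>0\<close>\<close>

definition fpaa_family :: "real \<Rightarrow> real \<Rightarrow> nat \<Rightarrow> nat \<Rightarrow> (nat \<Rightarrow> real vec) \<Rightarrow> (nat \<Rightarrow> real)
    \<Rightarrow> (nat \<Rightarrow> real \<Rightarrow> schedule) \<Rightarrow> bool" where
  "fpaa_family K e\<^sub>0 N l \<mu> p fp \<longleftrightarrow> (\<forall>i<l. \<forall>e. 0 < e \<and> e < 1 \<longrightarrow>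
     trace_dist (fpaa_op (qsample N (\<mu> i)) (qsample N (\<mu> (Suc i))) (fp i e) *\<^sub>v qsample N (\<mu> i))
       (qsample N (\<mu> (Suc i))) \<le> e
     \<and> (e \<le> e\<^sub>0 \<longrightarrow> real (schedule_len (fp i e)) \<le> K / sqrt (p i) * ln (1 / e)))"


section \<open>QSample preparation algorithm\<close>

definition stage_circuit :: "nat \<Rightarrow> complex mat list \<Rightarrow> complex mat list \<Rightarrow> schedule \<Rightarrow> circuit" where
  "stage_circuit i Vs Vs' s =
     concat (rev (map (\<lambda>(\<alpha>, \<beta>). compiled_phase i Vs \<alpha> @ compiled_phase (Suc i) Vs' \<beta>) s))"

definition qsample_circuit :: "nat \<Rightarrow> (nat \<Rightarrow> real \<Rightarrow> complex mat list) \<Rightarrow> (nat \<Rightarrow> real \<Rightarrow> schedule)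
    \<Rightarrow> (nat \<Rightarrow> real) \<Rightarrow> (nat \<Rightarrow> real) \<Rightarrow> circuit" where
  "qsample_circuit l G fp \<epsilon>F \<epsilon>W =
     concat (map (\<lambda>i. stage_circuit i (G i (\<epsilon>W i)) (G (Suc i) (\<epsilon>W i)) (fp i (\<epsilon>F i))) [0..<l])"

definition qsample_output :: "nat \<Rightarrow> (nat \<Rightarrow> complex mat) \<Rightarrow> (nat \<Rightarrow> real vec) \<Rightarrow> circuit \<Rightarrow> complex vec" where
  "qsample_output N Or \<mu> c = circuit_op N Or c *\<^sub>v (init_embed N *\<^sub>v qsample N (\<mu> 0))"

definition admissible_accuracies ::
  "nat \<Rightarrow> (nat \<Rightarrow> real \<Rightarrow> schedule) \<Rightarrow> real \<Rightarrow> (nat \<Rightarrow> real) \<Rightarrow> (nat \<Rightarrow> real) \<Rightarrow> bool" where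
  "admissible_accuracies l fp \<epsilon> \<epsilon>F \<epsilon>W \<longleftrightarrow> (\<forall>i<l. 0 < \<epsilon>F i \<and> \<epsilon>F i < 1 \<and> 0 < \<epsilon>W i \<and> \<epsilon>W i < 1
     \<and> \<epsilon>F i + 2 * (real (schedule_len (fp i (\<epsilon>F i))) - 1) * \<epsilon>W i \<le> \<epsilon> / real l)"

end

theory Submission
  imports Defs "HOL-Analysis.L2_Norm"
begin

text \<open>Let \<open>T\<close> be the step isometry. Every vector fixed by the walk \<open>W\<close> has \<open>T\<^sup>\<dagger>\<close>-image
  proportional to the qsample \<open>q\<close> of the stationary distribution, and \<open>W T q = T q\<close>; so the projector circuit, conjugated with
  the oracle, acts on embedded states as the projector on \<open>q\<close>, up to the size \<open>\<eta>\<close> of the polynomial on the rest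
  of the spectrum. Each compiled selective phase is therefore \<open>2 \<eta>\<close>-close to the ideal one on embedded states,
  and the errors add up over the phases and the stages because all circuits are unitary and the trace
  distance satisfies the triangle inequality. With \<open>\<epsilon>\<^sup>F = \<epsilon> / (2 l)\<close> and \<open>\<epsilon>\<^sup>W = \<epsilon> / (4 l L)\<close> the total is at
  most \<open>\<epsilon>\<close>, and \<open>ln (1 / \<epsilon>\<^sup>W)\<close> is the second logarithm in the query bound.\<close>


subsection \<open>Hermitian inner product and trace distance\<close>

text \<open>The eigenvalue 1 of the walk need not be simple: a vector \<open>w\<close> with
  \<open>S w = - w\<close> and \<open>T\<^sup>\<dagger> w = 0\<close> is fixed too. So the projector
  on the fixed space is never computed. It matters only on vectors \<open>T v\<close>, and these see
  a fixed vector \<open>g\<close> only through \<open>T\<^sup>\<dagger> g\<close>. Passing from a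
  bound on eigenvalues to a bound on vectors needs orthogonal eigencomponents, so the walk is
  diagonalized by way of its Schur form. The 2 in \<open>2 \<eta>\<close> bounds the modulus of
  \<open>cis \<phi> - 1\<close>. A schedule of length \<open>m\<close> contains \<open>2 m\<close>
  phases and \<open>L = 2 m + 1\<close>, so a stage costs
  \<open>4 \<eta> m = 2 (L - 1) \<eta>\<close>, which is the term in the accuracy constraint. The
  phase gap is a minimum over a set of angles, but its positivity is deduced from the degree bound
  of the projector family: degree 0 is impossible, so the right-hand side of that bound is positive.
  The same lower bound on degrees absorbs the oracle calls that lie outside the walks.\<close>

lemma dim_mat_adjoint [simp]:
  "dim_row (mat_adjoint A) = dim_col A" "dim_col (mat_adjoint A) = dim_row A"
  by (simp_all add: mat_adjoint_def)

lemma mat_adjoint_carrier [simp]: "A \<in> carrier_mat n m \<Longrightarrow> mat_adjoint A \<in> carrier_mat m n"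
  by (rule carrier_matI) auto

lemma mat_adjoint_index [simp]:
  fixes A :: "complex mat"
  assumes "i < dim_col A" "j < dim_row A"
  shows "mat_adjoint A $$ (i, j) = cnj (A $$ (j, i))"
  using assms by (simp add: mat_adjoint_def mat_of_rows_def)

lemma mat_adjoint_adjoint [simp]: "mat_adjoint (mat_adjoint A) = (A :: complex mat)"
  by (rule eq_matI) auto

lemma mat_adjoint_one [simp]: "mat_adjoint (1\<^sub>m n) = (1\<^sub>m n :: complex mat)"
  by (rule eq_matI) auto

lemma index_mult_sum:
  assumes "i < dim_row A" "j < dim_col B" "dim_col A = dim_row B"
  shows "(A * B) $$ (i, j) = (\<Sum>k<dim_row B. A $$ (i, k) * B $$ (k, j))"
  using assms
  by (auto simp: scalar_prod_def atLeast0LessThan intro!: sum.cong)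

lemma mat_adjoint_mult:
  fixes A :: "complex mat"
  assumes "A \<in> carrier_mat n m" "B \<in> carrier_mat m k"
  shows "mat_adjoint (A * B) = mat_adjoint B * mat_adjoint A"
  by (rule eq_matI, use assms in \<open>auto simp: index_mult_sum mult.commute simp del: index_mult_mat(1)\<close>)

lemma mat_adjoint_add:
  fixes A :: "complex mat"
  assumes "A \<in> carrier_mat n m" "B \<in> carrier_mat n m"
  shows "mat_adjoint (A + B) = mat_adjoint A + mat_adjoint B"
  by (rule eq_matI) (use assms in auto)

lemma index_mult_mat_vec_sum:
  assumes "i < dim_row A" "dim_col A = dim_vec v"
  shows "(A *\<^sub>v v) $ i = (\<Sum>j<dim_vec v. A $$ (i, j) * v $ j)"
  using assms by (auto simp: scalar_prod_def atLeast0LessThan intro!: sum.cong)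

lemma cscalar_prod_sum: "a \<bullet>c b = (\<Sum>i<dim_vec b. a $ i * cnj (b $ i))"
  by (auto simp: scalar_prod_def atLeast0LessThan intro!: sum.cong)

lemma cscalar_prod_adjoint:
  fixes A :: "complex mat"
  assumes A: "A \<in> carrier_mat n m" and v: "v \<in> carrier_vec m" and w: "w \<in> carrier_vec n"
  shows "(A *\<^sub>v v) \<bullet>c w = v \<bullet>c (mat_adjoint A *\<^sub>v w)"
proof -
  have "(A *\<^sub>v v) \<bullet>c w = (\<Sum>i<n. (\<Sum>j<m. A $$ (i, j) * v $ j) * cnj (w $ i))"
    unfolding cscalar_prod_sum using assms by (auto simp: index_mult_mat_vec_sum simp del: index_mult_mat_vec)
  also have "\<dots> = (\<Sum>j<m. \<Sum>i<n. A $$ (i, j) * v $ j * cnj (w $ i))"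
    unfolding sum_distrib_right by (rule sum.swap)
  also have "\<dots> = (\<Sum>j<m. v $ j * cnj (\<Sum>i<n. cnj (A $$ (i, j)) * w $ i))"
    by (simp add: cnj_sum sum_distrib_left mult_ac)
  also have "\<dots> = v \<bullet>c (mat_adjoint A *\<^sub>v w)"
    unfolding cscalar_prod_sum using assms by (auto simp: index_mult_mat_vec_sum simp del: index_mult_mat_vec)
  finally show ?thesis .
qed

lemma cscalar_prod_cnj: "dim_vec a = dim_vec b \<Longrightarrow> cnj (a \<bullet>c b) = b \<bullet>c a"
  unfolding cscalar_prod_sum by (simp add: cnj_sum mult.commute)

text \<open>The dimension is a term and not a type, so the Euclidean norm is taken as
  \<open>L2_set\<close> over the index set; Minkowski and Cauchy-Schwarz carry over from
  there.\<close>

definition vnorm :: "complex vec \<Rightarrow> real" where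
  "vnorm v = L2_set (\<lambda>i. cmod (v $ i)) {..<dim_vec v}"

lemma vnorm_nonneg [simp]: "0 \<le> vnorm v"
  by (simp add: vnorm_def L2_set_nonneg)

lemma cscalar_prod_self: "v \<bullet>c v = complex_of_real ((vnorm v)\<^sup>2)"
  unfolding cscalar_prod_sum vnorm_def L2_set_def
  by (simp add: sum_nonneg complex_norm_square del: of_real_power)

lemma vnorm_zero_iff: "v \<in> carrier_vec n \<Longrightarrow> vnorm v = 0 \<longleftrightarrow> v = 0\<^sub>v n"
  unfolding vnorm_def by (auto simp: L2_set_eq_0_iff)

lemma vnorm_smult: "vnorm (c \<cdot>\<^sub>v v) = cmod c * vnorm v"
  unfolding vnorm_def by (auto simp: norm_mult L2_set_right_distrib intro!: L2_set_cong)

lemma vnorm_triangle: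
  assumes "dim_vec a = dim_vec b"
  shows "vnorm (a + b) \<le> vnorm a + vnorm b"
proof -
  have "vnorm (a + b) \<le> L2_set (\<lambda>i. cmod (a $ i) + cmod (b $ i)) {..<dim_vec b}"
    unfolding vnorm_def by (auto intro!: L2_set_mono norm_triangle_ineq)
  also have "\<dots> \<le> vnorm a + vnorm b"
    unfolding vnorm_def assms by (rule L2_set_triangle_ineq)
  finally show ?thesis .
qed

lemma cmod_cscalar_prod_le:
  assumes "dim_vec a = dim_vec b"
  shows "cmod (a \<bullet>c b) \<le> vnorm a * vnorm b"
proof -
  have "cmod (a \<bullet>c b) \<le> (\<Sum>i<dim_vec b. \<bar>cmod (a $ i)\<bar> * \<bar>cmod (b $ i)\<bar>)"
    unfolding cscalar_prod_sum by (rule order.trans[OF norm_sum]) (simp add: norm_mult)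
  also have "\<dots> \<le> vnorm a * vnorm b"
    unfolding vnorm_def assms by (rule L2_set_mult_ineq)
  finally show ?thesis .
qed

lemma vnorm_diff_triangle:
  assumes "a \<in> carrier_vec n" "b \<in> carrier_vec n" "c \<in> carrier_vec n"
  shows "vnorm (a - c) \<le> vnorm (a - b) + vnorm (b - c)"
proof -
  have "a - c = (a - b) + (b - c)" using assms by auto
  then show ?thesis using vnorm_triangle[of "a - b" "b - c"] assms by simp
qed

lemma isometry_adjoint_mult_vec:
  assumes A: "A \<in> carrier_mat n m" and 1: "mat_adjoint A * A = 1\<^sub>m m" and v: "v \<in> carrier_vec m"
  shows "mat_adjoint A *\<^sub>v (A *\<^sub>v v) = v"
  using assoc_mult_mat_vec[OF mat_adjoint_carrier[OF A] A v] v unfolding 1 by simp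

lemma cscalar_prod_isometry:
  fixes A :: "complex mat"
  assumes A: "A \<in> carrier_mat n m" and 1: "mat_adjoint A * A = 1\<^sub>m m"
    and v: "v \<in> carrier_vec m" and w: "w \<in> carrier_vec m"
  shows "(A *\<^sub>v v) \<bullet>c (A *\<^sub>v w) = v \<bullet>c w"
  using cscalar_prod_adjoint[OF A v, of "A *\<^sub>v w"] isometry_adjoint_mult_vec[OF A 1 w] A w by simp

lemma vnorm_isometry:
  assumes "A \<in> carrier_mat n m" "mat_adjoint A * A = 1\<^sub>m m" "v \<in> carrier_vec m"
  shows "vnorm (A *\<^sub>v v) = vnorm v"
proof -
  have "complex_of_real ((vnorm (A *\<^sub>v v))\<^sup>2) = complex_of_real ((vnorm v)\<^sup>2)"
    unfolding cscalar_prod_self[symmetric] by (rule cscalar_prod_isometry[OF assms assms(3)])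
  then show ?thesis unfolding of_real_eq_iff by simp
qed

lemma cscalar_prod_diff_left:
  fixes a :: "complex vec"
  assumes "dim_vec a = dim_vec c" "dim_vec b = dim_vec c"
  shows "(a - b) \<bullet>c c = a \<bullet>c c - b \<bullet>c c"
  using assms unfolding cscalar_prod_sum by (simp add: sum_subtractf algebra_simps)

lemma cscalar_prod_diff_right:
  fixes a :: "complex vec"
  assumes "dim_vec a = dim_vec c" "dim_vec b = dim_vec c"
  shows "c \<bullet>c (a - b) = c \<bullet>c a - c \<bullet>c b"
  using assms unfolding cscalar_prod_sum by (simp add: sum_subtractf algebra_simps)

lemma cscalar_prod_smult_left:
  fixes a :: "complex vec"
  assumes "dim_vec a = dim_vec c"
  shows "(k \<cdot>\<^sub>v a) \<bullet>c c = k * (a \<bullet>c c)"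
  using assms unfolding cscalar_prod_sum by (simp add: sum_distrib_left mult_ac)

lemma cscalar_prod_smult_right: "(c :: complex vec) \<bullet>c (k \<cdot>\<^sub>v a) = cnj k * (c \<bullet>c a)"
  unfolding cscalar_prod_sum by (simp add: sum_distrib_left mult_ac)

text \<open>Pythagoras for the orthogonal splitting of \<open>a - x b\<close> into
  \<open>a - <a, b> b\<close> and \<open>(<a, b> - x) b\<close>. It serves both the trace distance
  and the norm preservation of selective phases.\<close>

lemma vnorm_diff_smult_sq:
  assumes d: "dim_vec a = dim_vec b" and b: "vnorm b = 1"
  shows "(vnorm (a - x \<cdot>\<^sub>v b))\<^sup>2 = (vnorm a)\<^sup>2 - (cmod (a \<bullet>c b))\<^sup>2 + (cmod (a \<bullet>c b - x))\<^sup>2"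
proof -
  have bb: "b \<bullet>c b = 1" using b by (simp add: cscalar_prod_self)
  have "complex_of_real ((vnorm (a - x \<cdot>\<^sub>v b))\<^sup>2) = (a - x \<cdot>\<^sub>v b) \<bullet>c (a - x \<cdot>\<^sub>v b)"
    by (rule cscalar_prod_self[symmetric])
  also have "\<dots> = a \<bullet>c a - cnj x * (a \<bullet>c b) - x * cnj (a \<bullet>c b) + x * cnj x"
    using d bb by (simp add: cscalar_prod_diff_left cscalar_prod_diff_right cscalar_prod_smult_left
        cscalar_prod_smult_right cscalar_prod_cnj algebra_simps)
  also have "\<dots> = complex_of_real ((vnorm a)\<^sup>2) - (a \<bullet>c b) * cnj (a \<bullet>c b) + (a \<bullet>c b - x) * cnj (a \<bullet>c b - x)"
    unfolding cscalar_prod_self[of a] by (simp add: algebra_simps)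
  also have "\<dots> = complex_of_real ((vnorm a)\<^sup>2 - (cmod (a \<bullet>c b))\<^sup>2 + (cmod (a \<bullet>c b - x))\<^sup>2)"
    unfolding complex_norm_square[symmetric] by simp
  finally show ?thesis unfolding of_real_eq_iff .
qed

text \<open>For unit vectors the trace distance is the distance from \<open>a\<close> to the line spanned by \<open>b\<close>;
  this is the source of its triangle inequality.\<close>

lemma trace_dist_eq_dist_line:
  assumes "dim_vec a = dim_vec b" "vnorm a = 1" "vnorm b = 1"
  shows "trace_dist a b = vnorm (a - (a \<bullet>c b) \<cdot>\<^sub>v b)"
proof -
  have "(vnorm (a - (a \<bullet>c b) \<cdot>\<^sub>v b))\<^sup>2 = 1 - (cmod (a \<bullet>c b))\<^sup>2"
    using vnorm_diff_smult_sq[of a b "a \<bullet>c b"] assms by simp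
  then show ?thesis unfolding trace_dist_def by (metis real_sqrt_unique vnorm_nonneg)
qed

text \<open>Among all multiples of \<open>b\<close> the orthogonal projection is nearest to
  \<open>a\<close>, so any other coefficient \<open>x\<close> gives an upper bound.\<close>

lemma trace_dist_le_dist_line:
  assumes "dim_vec a = dim_vec b" "vnorm a = 1" "vnorm b = 1"
  shows "trace_dist a b \<le> vnorm (a - x \<cdot>\<^sub>v b)"
  unfolding trace_dist_def
  by (rule real_le_lsqrt) (use vnorm_diff_smult_sq[of a b x] assms in auto)

lemma trace_dist_le_vnorm_diff:
  assumes "dim_vec a = dim_vec b" "vnorm a = 1" "vnorm b = 1"
  shows "trace_dist a b \<le> vnorm (a - b)"
  using trace_dist_le_dist_line[OF assms, of 1] by simp

lemma trace_dist_triangle: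
  assumes a: "a \<in> carrier_vec n" "vnorm a = 1" and b: "b \<in> carrier_vec n" "vnorm b = 1"
    and c: "c \<in> carrier_vec n" "vnorm c = 1"
  shows "trace_dist a c \<le> trace_dist a b + trace_dist b c"
proof -
  define s where "s = a \<bullet>c b"
  define t where "t = b \<bullet>c c"
  have s: "cmod s \<le> 1" unfolding s_def using cmod_cscalar_prod_le[of a b] a b by simp
  \<comment> \<open>The coefficient \<open>s * t\<close> arises from projecting \<open>a\<close>
    onto the line of \<open>b\<close>, giving \<open>s b\<close>, and then \<open>b\<close> onto the
    line of \<open>c\<close>, giving \<open>t c\<close>.\<close>
  have "trace_dist a c \<le> vnorm (a - (s * t) \<cdot>\<^sub>v c)"
    by (rule trace_dist_le_dist_line) (use a c in auto)
  also have "a - (s * t) \<cdot>\<^sub>v c = (a - s \<cdot>\<^sub>v b) + s \<cdot>\<^sub>v (b - t \<cdot>\<^sub>v c)"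
    using a b c by (auto simp: algebra_simps)
  also have "vnorm \<dots> \<le> vnorm (a - s \<cdot>\<^sub>v b) + cmod s * vnorm (b - t \<cdot>\<^sub>v c)"
    using vnorm_triangle[of "a - s \<cdot>\<^sub>v b" "s \<cdot>\<^sub>v (b - t \<cdot>\<^sub>v c)"] a b c by (simp add: vnorm_smult)
  also have "\<dots> \<le> vnorm (a - s \<cdot>\<^sub>v b) + vnorm (b - t \<cdot>\<^sub>v c)"
    using mult_right_mono[OF s, of "vnorm (b - t \<cdot>\<^sub>v c)"] by simp
  also have "\<dots> = trace_dist a b + trace_dist b c"
    unfolding s_def t_def using a b c by (simp add: trace_dist_eq_dist_line)
  finally show ?thesis .
qed

lemma trace_dist_isometry:
  assumes "A \<in> carrier_mat n m" "mat_adjoint A * A = 1\<^sub>m m" "a \<in> carrier_vec m" "b \<in> carrier_vec m"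
  shows "trace_dist (A *\<^sub>v a) (A *\<^sub>v b) = trace_dist a b"
  unfolding trace_dist_def using cscalar_prod_isometry[OF assms] by simp


section \<open>Unitary matrices\<close>

lemma unitary_opD:
  assumes "unitary_op n U"
  shows "U \<in> carrier_mat n n" "mat_adjoint U * U = 1\<^sub>m n" "U * mat_adjoint U = 1\<^sub>m n"
  using assms unfolding unitary_op_def by auto

lemma unitary_op_adjoint: "unitary_op n U \<Longrightarrow> unitary_op n (mat_adjoint U)"
  unfolding unitary_op_def by simp

lemma unitary_op_mult:
  assumes "unitary_op n U" "unitary_op n V"
  shows "unitary_op n (U * V)"
proof -
  note U = unitary_opD[OF assms(1)] and V = unitary_opD[OF assms(2)]
  let ?U = "mat_adjoint U" and ?V = "mat_adjoint V"
  have a: "mat_adjoint (U * V) = ?V * ?U" by (rule mat_adjoint_mult[OF U(1) V(1)])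
  have "?V * ?U * (U * V) = ?V * (?U * U) * V"
    using U(1) V(1)
    by (simp add: assoc_mult_mat[of _ n n _ n _ n] mult_carrier_mat[of _ n n _ n])
  then have 1: "?V * ?U * (U * V) = 1\<^sub>m n" using U V by simp
  have "U * V * (?V * ?U) = U * (V * ?V) * ?U"
    using U(1) V(1)
    by (simp add: assoc_mult_mat[of _ n n _ n _ n] mult_carrier_mat[of _ n n _ n])
  then have "U * V * (?V * ?U) = 1\<^sub>m n" using U V by simp
  with 1 show ?thesis unfolding unitary_op_def a using U(1) V(1) by simp
qed

lemma unitary_op_one: "unitary_op n (1\<^sub>m n)"
  unfolding unitary_op_def by simp

lemma vnorm_unitary: "unitary_op n U \<Longrightarrow> v \<in> carrier_vec n \<Longrightarrow> vnorm (U *\<^sub>v v) = vnorm v"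
  by (rule vnorm_isometry) (auto dest: unitary_opD)


subsection \<open>Spectral decomposition of a unitary\<close>

text \<open>Vectors of different lengths share one type and have no common zero, so the sum carries
  its dimension; the empty sum is then \<open>0\<^sub>v n\<close>.\<close>

definition vsum :: "nat \<Rightarrow> ('i \<Rightarrow> complex vec) \<Rightarrow> 'i set \<Rightarrow> complex vec" where
  "vsum n f S = vec n (\<lambda>i. \<Sum>k\<in>S. f k $ i)"

lemma vsum_carrier [simp]: "vsum n f S \<in> carrier_vec n"
  by (simp add: vsum_def)

lemma dim_vsum [simp]: "dim_vec (vsum n f S) = n"
  by (simp add: vsum_def)

lemma vsum_index [simp]: "i < n \<Longrightarrow> vsum n f S $ i = (\<Sum>k\<in>S. f k $ i)"
  by (simp add: vsum_def)

lemma vsum_cong: "(\<And>k. k \<in> S \<Longrightarrow> f k = g k) \<Longrightarrow> vsum n f S = vsum n g S"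
  unfolding vsum_def by (metis (mono_tags, lifting) sum.cong)

lemma mult_mat_vsum:
  assumes A: "A \<in> carrier_mat n m" and f: "\<And>k. k \<in> S \<Longrightarrow> f k \<in> carrier_vec m"
  shows "A *\<^sub>v vsum m f S = vsum n (\<lambda>k. A *\<^sub>v f k) S"
proof (rule eq_vecI)
  fix i assume "i < dim_vec (vsum n (\<lambda>k. A *\<^sub>v f k) S)"
  then have i: "i < n" by simp
  have "(A *\<^sub>v vsum m f S) $ i = (\<Sum>j<m. \<Sum>k\<in>S. A $$ (i, j) * f k $ j)"
    using A i by (simp add: index_mult_mat_vec_sum sum_distrib_left del: index_mult_mat_vec)
  also have "\<dots> = (\<Sum>k\<in>S. \<Sum>j<m. A $$ (i, j) * f k $ j)" by (rule sum.swap)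
  also have "\<dots> = (\<Sum>k\<in>S. (A *\<^sub>v f k) $ i)"
    using A i carrier_vecD[OF f]
    by (intro sum.cong) (simp_all add: index_mult_mat_vec_sum del: index_mult_mat_vec)
  finally show "(A *\<^sub>v vsum m f S) $ i = vsum n (\<lambda>k. A *\<^sub>v f k) S $ i" using i by simp
qed (use A in simp)

lemma cscalar_prod_vsum_left:
  assumes "b \<in> carrier_vec n"
  shows "vsum n f S \<bullet>c b = (\<Sum>k\<in>S. f k \<bullet>c b)"
  using assms unfolding cscalar_prod_sum by (simp add: sum_distrib_right) (rule sum.swap)

lemma cscalar_prod_vsum_right:
  assumes "\<And>k. k \<in> S \<Longrightarrow> f k \<in> carrier_vec n"
  shows "b \<bullet>c vsum n f S = (\<Sum>k\<in>S. b \<bullet>c f k)"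
proof -
  have "b \<bullet>c vsum n f S = (\<Sum>k\<in>S. \<Sum>i<n. b $ i * cnj (f k $ i))"
    unfolding cscalar_prod_sum by (simp add: sum_distrib_left cnj_sum) (rule sum.swap)
  then show ?thesis
    unfolding cscalar_prod_sum using carrier_vecD[OF assms] by simp
qed

lemma mult_mat_vec_cols:
  assumes A: "A \<in> carrier_mat n m" and x: "x \<in> carrier_vec m"
  shows "A *\<^sub>v x = vsum n (\<lambda>k. x $ k \<cdot>\<^sub>v col A k) {..<m}"
  by (rule eq_vecI)
    (use A x in \<open>auto simp: index_mult_mat_vec_sum mult.commute simp del: index_mult_mat_vec\<close>)

section \<open>Eigenvectors of a unitary matrix\<close>

lemma unitary_eigen_norm:
  assumes U: "unitary_op n U" and v: "v \<in> carrier_vec n" "U *\<^sub>v v = \<mu> \<cdot>\<^sub>v v" "v \<noteq> 0\<^sub>v n"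
  shows "cmod \<mu> = 1"
proof -
  have "cmod \<mu> * vnorm v = vnorm v"
    using vnorm_unitary[OF U v(1)] v(2) by (simp add: vnorm_smult)
  then show ?thesis using vnorm_zero_iff[OF v(1)] v(3) by simp
qed

lemma unitary_eigen_adjoint:
  assumes U: "unitary_op n U" and v: "v \<in> carrier_vec n" "U *\<^sub>v v = \<mu> \<cdot>\<^sub>v v"
  shows "mat_adjoint U *\<^sub>v v = cnj \<mu> \<cdot>\<^sub>v v"
proof (cases "v = 0\<^sub>v n")
  case True
  then show ?thesis using unitary_opD(1)[OF U] by (auto intro!: eq_vecI)
next
  case False
  note C = unitary_opD[OF U]
  have n: "cnj \<mu> * \<mu> = 1"
    using unitary_eigen_norm[OF U v False] complex_norm_square[of \<mu>] by (simp add: mult.commute)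
  have "v = mat_adjoint U *\<^sub>v (\<mu> \<cdot>\<^sub>v v)"
    using isometry_adjoint_mult_vec[OF C(1,2) v(1)] v(2) by simp
  also have "\<dots> = \<mu> \<cdot>\<^sub>v (mat_adjoint U *\<^sub>v v)"
    by (rule mult_mat_vec[OF mat_adjoint_carrier[OF C(1)] v(1)])
  finally have "cnj \<mu> \<cdot>\<^sub>v v = (cnj \<mu> * \<mu>) \<cdot>\<^sub>v (mat_adjoint U *\<^sub>v v)"
    by (metis smult_smult_assoc)
  then show ?thesis by (simp add: n)
qed

lemma unitary_eigen_orthogonal:
  assumes U: "unitary_op n U" and v: "v \<in> carrier_vec n" "U *\<^sub>v v = \<mu> \<cdot>\<^sub>v v"
    and w: "w \<in> carrier_vec n" "U *\<^sub>v w = \<nu> \<cdot>\<^sub>v w" and ne: "\<mu> \<noteq> \<nu>"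
  shows "v \<bullet>c w = 0"
proof -
  have "\<mu> * (v \<bullet>c w) = (U *\<^sub>v v) \<bullet>c w"
    unfolding v(2) using v w by (simp add: cscalar_prod_smult_left)
  also have "\<dots> = v \<bullet>c (mat_adjoint U *\<^sub>v w)"
    by (rule cscalar_prod_adjoint[OF unitary_opD(1)[OF U] v(1) w(1)])
  also have "\<dots> = \<nu> * (v \<bullet>c w)"
    unfolding unitary_eigen_adjoint[OF U w] by (simp add: cscalar_prod_smult_right)
  finally show ?thesis using ne by simp
qed

text \<open>A unitary has no Jordan chain of length two: pairing \<open>U w = \<mu> w + v\<close>
  with \<open>v\<close> and moving \<open>U\<close> to the other side leaves
  \<open><v, v> = 0\<close>.\<close>

lemma unitary_generalized_eigen:
  assumes U: "unitary_op n U" and v: "v \<in> carrier_vec n" "U *\<^sub>v v = \<mu> \<cdot>\<^sub>v v"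
    and w: "w \<in> carrier_vec n" "U *\<^sub>v w = \<mu> \<cdot>\<^sub>v w + v"
  shows "v = 0\<^sub>v n"
proof -
  have "\<mu> * (w \<bullet>c v) = w \<bullet>c (mat_adjoint U *\<^sub>v v)"
    unfolding unitary_eigen_adjoint[OF U v] by (simp add: cscalar_prod_smult_right)
  also have "\<dots> = (U *\<^sub>v w) \<bullet>c v"
    by (rule cscalar_prod_adjoint[OF unitary_opD(1)[OF U] w(1) v(1), symmetric])
  also have "\<dots> = \<mu> * (w \<bullet>c v) + v \<bullet>c v"
    unfolding w(2) using v(1) w(1) by (simp add: add_scalar_prod_distrib[of _ n] cscalar_prod_smult_left)
  finally have "vnorm v = 0" by (simp add: cscalar_prod_self)
  then show ?thesis using vnorm_zero_iff[OF v(1)] by simp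
qed

text \<open>The summands are indexed by the eigenvalue itself. There is thus at most one per
  eigenvalue, distinct summands are orthogonal, and two such sums can be added eigenvalue by
  eigenvalue. For a number that is not an eigenvalue the summand is forced to be zero.\<close>

definition eigensum :: "nat \<Rightarrow> complex mat \<Rightarrow> complex vec \<Rightarrow> bool" where
  "eigensum n U w \<longleftrightarrow> (\<exists>S f. finite S
     \<and> (\<forall>\<mu>. f \<mu> \<in> carrier_vec n \<and> U *\<^sub>v f \<mu> = \<mu> \<cdot>\<^sub>v f \<mu>) \<and> w = vsum n f S)"

text \<open>Resetting \<open>f\<close> to zero off \<open>S\<close> is harmless and permits
  enlarging \<open>S\<close>, or evaluating \<open>f\<close> at a value that may lie outside
  it.\<close>

lemma eigensumE:
  assumes "eigensum n U w" "U \<in> carrier_mat n n"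
  obtains S f where "finite S" "\<And>\<mu>. f \<mu> \<in> carrier_vec n" "\<And>\<mu>. U *\<^sub>v f \<mu> = \<mu> \<cdot>\<^sub>v f \<mu>"
    "w = vsum n f S" "\<And>\<mu>. \<mu> \<notin> S \<Longrightarrow> f \<mu> = 0\<^sub>v n"
proof -
  from assms(1) obtain S f where *: "finite S"
     "\<forall>\<mu>. f \<mu> \<in> carrier_vec n \<and> U *\<^sub>v f \<mu> = \<mu> \<cdot>\<^sub>v f \<mu>" "w = vsum n f S"
    unfolding eigensum_def by blast
  have z: "U *\<^sub>v 0\<^sub>v n = \<mu> \<cdot>\<^sub>v 0\<^sub>v n" for \<mu> using assms(2) by (auto intro!: eq_vecI)
  show ?thesis
    by (rule that[of S "\<lambda>\<mu>. if \<mu> \<in> S then f \<mu> else 0\<^sub>v n"])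
      (use * z in \<open>auto intro!: vsum_cong\<close>)
qed

lemma eigensum_add:
  assumes U: "U \<in> carrier_mat n n" and "eigensum n U v" "eigensum n U w"
  shows "eigensum n U (v + w)"
proof -
  obtain S f where f: "finite S" "\<And>\<mu>. f \<mu> \<in> carrier_vec n" "\<And>\<mu>. U *\<^sub>v f \<mu> = \<mu> \<cdot>\<^sub>v f \<mu>"
    "v = vsum n f S" "\<And>\<mu>. \<mu> \<notin> S \<Longrightarrow> f \<mu> = 0\<^sub>v n" using eigensumE[OF assms(2) U] by metis
  obtain T g where g: "finite T" "\<And>\<mu>. g \<mu> \<in> carrier_vec n" "\<And>\<mu>. U *\<^sub>v g \<mu> = \<mu> \<cdot>\<^sub>v g \<mu>"
    "w = vsum n g T" "\<And>\<mu>. \<mu> \<notin> T \<Longrightarrow> g \<mu> = 0\<^sub>v n" using eigensumE[OF assms(3) U] by metis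
  have h: "U *\<^sub>v (f \<mu> + g \<mu>) = \<mu> \<cdot>\<^sub>v (f \<mu> + g \<mu>)" for \<mu>
    using mult_add_distrib_mat_vec[OF U f(2) g(2)] f g smult_add_distrib_vec[OF f(2) g(2)] by simp
  have "v = vsum n f (S \<union> T)" "w = vsum n g (S \<union> T)"
    unfolding f(4) g(4) using f g
    by (auto intro!: eq_vecI sum.mono_neutral_left)
  then have "v + w = vsum n (\<lambda>\<mu>. f \<mu> + g \<mu>) (S \<union> T)"
    using carrier_vecD[OF g(2)] by (auto intro!: eq_vecI simp: sum.distrib)
  with f g h show ?thesis unfolding eigensum_def
    by (intro exI[of _ "S \<union> T"] exI[of _ "\<lambda>\<mu>. f \<mu> + g \<mu>"]) auto
qed

lemma eigensum_smult:
  assumes U: "U \<in> carrier_mat n n" and "eigensum n U v"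
  shows "eigensum n U (c \<cdot>\<^sub>v v)"
proof -
  obtain S f where f: "finite S" "\<And>\<mu>. f \<mu> \<in> carrier_vec n" "\<And>\<mu>. U *\<^sub>v f \<mu> = \<mu> \<cdot>\<^sub>v f \<mu>"
    "v = vsum n f S" using eigensumE[OF assms(2) U] by metis
  have "U *\<^sub>v (c \<cdot>\<^sub>v f \<mu>) = \<mu> \<cdot>\<^sub>v (c \<cdot>\<^sub>v f \<mu>)" for \<mu>
    using mult_mat_vec[OF U f(2)] f(3) by (simp add: smult_smult_assoc mult.commute)
  moreover have "c \<cdot>\<^sub>v v = vsum n (\<lambda>\<mu>. c \<cdot>\<^sub>v f \<mu>) S"
    unfolding f(4) using carrier_vecD[OF f(2)] by (auto intro!: eq_vecI simp: sum_distrib_left)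
  ultimately show ?thesis using f unfolding eigensum_def
    by (intro exI[of _ S] exI[of _ "\<lambda>\<mu>. c \<cdot>\<^sub>v f \<mu>"]) auto
qed

lemma eigensum_zero: "U \<in> carrier_mat n n \<Longrightarrow> eigensum n U (0\<^sub>v n)"
  unfolding eigensum_def
  by (intro exI[of _ "{}"] exI[of _ "\<lambda>_. 0\<^sub>v n"]) (auto intro!: eq_vecI)

lemma eigensum_vsum:
  assumes U: "U \<in> carrier_mat n n" and "finite K"
    and "\<And>k. k \<in> K \<Longrightarrow> eigensum n U (g k)" "\<And>k. k \<in> K \<Longrightarrow> g k \<in> carrier_vec n"
  shows "eigensum n U (vsum n (\<lambda>k. c k \<cdot>\<^sub>v g k) K)"
  using assms(2-4)
proof (induction K rule: finite_induct)
  case empty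
  have "vsum n (\<lambda>k. c k \<cdot>\<^sub>v g k) {} = 0\<^sub>v n" by (auto intro!: eq_vecI)
  then show ?case using eigensum_zero[OF U] by simp
next
  case (insert x K)
  have "vsum n (\<lambda>k. c k \<cdot>\<^sub>v g k) (insert x K) = c x \<cdot>\<^sub>v g x + vsum n (\<lambda>k. c k \<cdot>\<^sub>v g k) K"
    using insert.hyps carrier_vecD[OF insert.prems(2)] by (auto intro!: eq_vecI)
  then show ?case using insert eigensum_add[OF U] eigensum_smult[OF U] by simp
qed

text \<open>Solve \<open>(U - l) g = u\<close> in all components of \<open>u\<close> except the
  resonant one at \<open>l\<close>. Then \<open>x = w - g\<close> satisfies
  \<open>U x = l x + f l\<close>, and the absence of Jordan chains forces \<open>f l = 0\<close>; so
  \<open>x\<close> is an eigenvector or zero, and \<open>w = x + g\<close>.\<close>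

lemma eigensum_step:
  assumes U: "unitary_op n U" and w: "w \<in> carrier_vec n"
    and u: "eigensum n U u" and eq: "U *\<^sub>v w = l \<cdot>\<^sub>v w + u"
  shows "eigensum n U w"
proof -
  note C = unitary_opD(1)[OF U]
  obtain S f where f: "finite S" "\<And>\<mu>. f \<mu> \<in> carrier_vec n" "\<And>\<mu>. U *\<^sub>v f \<mu> = \<mu> \<cdot>\<^sub>v f \<mu>"
    "u = vsum n f S" "\<And>\<mu>. \<mu> \<notin> S \<Longrightarrow> f \<mu> = 0\<^sub>v n" using eigensumE[OF u C] by metis
  note fd [simp] = carrier_vecD[OF f(2)]
  \<comment> \<open>On the eigenspace of \<open>\<mu>\<close> the operator \<open>U - l\<close> is
    multiplication by \<open>\<mu> - l\<close>, which \<open>c\<close> inverts; the resonant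
    component is left out.\<close>
  define c where "c \<mu> = (if \<mu> = l then 0 else 1 / (\<mu> - l))" for \<mu>
  define g where "g = vsum n (\<lambda>\<mu>. c \<mu> \<cdot>\<^sub>v f \<mu>) S"
  have es: "eigensum n U (f \<mu>)" for \<mu>
    unfolding eigensum_def
  proof (intro exI[of _ "{\<mu>}"] exI[of _ f] conjI allI)
    show "f \<mu> = vsum n f {\<mu>}" by (auto intro!: eq_vecI)
  qed (use f in auto)
  have g: "eigensum n U g"
    unfolding g_def by (rule eigensum_vsum[OF C f(1)]) (use f es in auto)
  have gc: "g \<in> carrier_vec n" by (simp add: g_def)
  have Ug: "U *\<^sub>v g = vsum n (\<lambda>\<mu>. c \<mu> \<cdot>\<^sub>v (\<mu> \<cdot>\<^sub>v f \<mu>)) S"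
    unfolding g_def using f(2,3) C
    by (subst mult_mat_vsum[OF C]) (auto intro!: vsum_cong simp: mult_mat_vec[OF C])
  define x where "x = w - g"
  have xc: "x \<in> carrier_vec n" using w gc by (simp add: x_def)
  have Ux: "U *\<^sub>v x = l \<cdot>\<^sub>v x + f l"
  proof (rule eq_vecI)
    fix i assume "i < dim_vec (l \<cdot>\<^sub>v x + f l)"
    then have i: "i < n" by simp
    have "(U *\<^sub>v x) $ i = l * w $ i + (\<Sum>\<mu>\<in>S. f \<mu> $ i) - (\<Sum>\<mu>\<in>S. c \<mu> * (\<mu> * f \<mu> $ i))"
      unfolding x_def mult_minus_distrib_mat_vec[OF C w gc] eq Ug using i w gc by (simp add: f(4))
    also have "\<dots> = l * w $ i + (\<Sum>\<mu>\<in>S. f \<mu> $ i - c \<mu> * (\<mu> * f \<mu> $ i))"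
      by (simp add: sum_subtractf)
    also have "(\<Sum>\<mu>\<in>S. f \<mu> $ i - c \<mu> * (\<mu> * f \<mu> $ i))
        = (\<Sum>\<mu>\<in>S. (if \<mu> = l then f l $ i else 0) - l * (c \<mu> * f \<mu> $ i))"
      by (rule sum.cong) (auto simp: c_def field_simps)
    \<comment> \<open>When \<open>l\<close> lies outside \<open>S\<close> the conditional sum is 0,
      which still equals \<open>f l\<close> by the normalization off \<open>S\<close>.\<close>
    also have "\<dots> = f l $ i - l * (\<Sum>\<mu>\<in>S. c \<mu> * f \<mu> $ i)"
      using f(1) f(5)[of l] i by (simp add: sum_subtractf sum_distrib_left)
    finally show "(U *\<^sub>v x) $ i = (l \<cdot>\<^sub>v x + f l) $ i"
      unfolding x_def g_def using i w by (simp add: algebra_simps)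
  qed (use C in simp)
  have "f l = 0\<^sub>v n" by (rule unitary_generalized_eigen[OF U f(2,3) xc Ux])
  then have Ux': "U *\<^sub>v x = l \<cdot>\<^sub>v x" using Ux xc by simp
  have "eigensum n U x" unfolding eigensum_def
  proof (intro exI[of _ "{l}"] exI[of _ "\<lambda>\<mu>. if \<mu> = l then x else 0\<^sub>v n"] conjI allI)
    show "x = vsum n (\<lambda>\<mu>. if \<mu> = l then x else 0\<^sub>v n) {l}" using xc by (auto intro!: eq_vecI)
    fix \<mu> show "U *\<^sub>v (if \<mu> = l then x else 0\<^sub>v n) = \<mu> \<cdot>\<^sub>v (if \<mu> = l then x else 0\<^sub>v n)"
      using Ux' C by (auto intro!: eq_vecI)
  qed (use xc in auto)
  then have "eigensum n U (x + g)" using g by (rule eigensum_add[OF C])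
  moreover have "x + g = w" unfolding x_def using w gc by auto
  ultimately show ?thesis by simp
qed

text \<open>In the triangular form \<open>U P = P B\<close> the image of column \<open>j\<close> of
  \<open>P\<close> is a multiple of that column plus a combination of earlier ones, so
  \<open>eigensum_step\<close> climbs through the columns. Since \<open>P\<close> is invertible,
  they span the space.\<close>

lemma unitary_eigensum:
  assumes U: "unitary_op n U" and w: "w \<in> carrier_vec n"
  shows "eigensum n U w"
proof -
  note C = unitary_opD(1)[OF U]
  obtain es where es: "char_poly U = (\<Prod>a\<leftarrow>es. [:- a, 1:])"
    using char_poly_factorized[OF C] by blast
  obtain B P Q where "schur_decomposition U es = (B, P, Q)" by (cases "schur_decomposition U es")
  from schur_decomposition[OF C es this] have wit: "similar_mat_wit U B P Q" and tri: "upper_triangular B"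
    by auto
  from similar_mat_witD2[OF C wit] have PQ: "P * Q = 1\<^sub>m n" "Q * P = 1\<^sub>m n" "U = P * B * Q"
    and cs: "B \<in> carrier_mat n n" "P \<in> carrier_mat n n" "Q \<in> carrier_mat n n" by auto
  have "U * P = P * B * (Q * P)" unfolding PQ(3) using cs by (simp add: assoc_mult_mat[of _ n n _ n _ n])
  then have UP: "U * P = P * B" using PQ cs by simp
  have col: "eigensum n U (col P j)" if "j < n" for j using that
  proof (induction j rule: less_induct)
    case (less j)
    define u where "u = vsum n (\<lambda>k. B $$ (k, j) \<cdot>\<^sub>v col P k) {..<j}"
    have u: "eigensum n U u" unfolding u_def
      by (rule eigensum_vsum[OF C]) (use less cs in auto)
    have "U *\<^sub>v col P j = P *\<^sub>v col B j"
      using col_mult2[OF C cs(2) less.prems] col_mult2[OF cs(2,1) less.prems] UP by simp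
    also have "\<dots> = vsum n (\<lambda>k. col B j $ k \<cdot>\<^sub>v col P k) {..<n}"
      by (rule mult_mat_vec_cols) (use cs in auto)
    also have "\<dots> = B $$ (j, j) \<cdot>\<^sub>v col P j + u"
    proof (rule eq_vecI)
      fix i assume "i < dim_vec (B $$ (j, j) \<cdot>\<^sub>v col P j + u)"
      then have i: "i < n" by (simp add: u_def)
      have "(\<Sum>k<n. B $$ (k, j) * P $$ (i, k)) = (\<Sum>k<Suc j. B $$ (k, j) * P $$ (i, k))"
        using less.prems cs upper_triangularD[OF tri, of j]
        by (intro sum.mono_neutral_right) auto
      then show "vsum n (\<lambda>k. col B j $ k \<cdot>\<^sub>v col P k) {..<n} $ i = (B $$ (j, j) \<cdot>\<^sub>v col P j + u) $ i"
        unfolding u_def using i less.prems cs by simp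
    qed (simp add: u_def)
    finally show ?case by (intro eigensum_step[OF U _ u]) (use cs in auto)
  qed
  have "w = P *\<^sub>v (Q *\<^sub>v w)" using assoc_mult_mat_vec[OF cs(2,3) w] w unfolding PQ(1) by simp
  also have "\<dots> = vsum n (\<lambda>k. (Q *\<^sub>v w) $ k \<cdot>\<^sub>v col P k) {..<n}"
    by (rule mult_mat_vec_cols[OF cs(2) mult_mat_vec_carrier[OF cs(3) w]])
  also have "eigensum n U \<dots>" by (rule eigensum_vsum[OF C]) (use col cs in auto)
  finally show ?thesis .
qed

lemma vnorm_vsum_orthogonal:
  assumes "finite S" "\<And>k. k \<in> S \<Longrightarrow> f k \<in> carrier_vec n"
    and "\<And>k l. k \<in> S \<Longrightarrow> l \<in> S \<Longrightarrow> k \<noteq> l \<Longrightarrow> f k \<bullet>c f l = 0"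
  shows "(vnorm (vsum n f S))\<^sup>2 = (\<Sum>k\<in>S. (vnorm (f k))\<^sup>2)"
proof -
  have "complex_of_real ((vnorm (vsum n f S))\<^sup>2) = (\<Sum>k\<in>S. \<Sum>l\<in>S. f k \<bullet>c f l)"
    unfolding cscalar_prod_self[symmetric]
    by (subst sum.swap) (simp add: cscalar_prod_vsum_left cscalar_prod_vsum_right assms(2))
  also have "\<dots> = (\<Sum>k\<in>S. f k \<bullet>c f k)"
  proof (rule sum.cong[OF refl])
    fix k assume k: "k \<in> S"
    have "(\<Sum>l\<in>S. f k \<bullet>c f l) = (\<Sum>l\<in>S. if l = k then f k \<bullet>c f k else 0)"
      by (rule sum.cong) (use assms(3) k in auto)
    then show "(\<Sum>l\<in>S. f k \<bullet>c f l) = f k \<bullet>c f k" using k assms(1) by simp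
  qed
  finally have "complex_of_real ((vnorm (vsum n f S))\<^sup>2) = complex_of_real (\<Sum>k\<in>S. (vnorm (f k))\<^sup>2)"
    by (simp add: cscalar_prod_self)
  then show ?thesis unfolding of_real_eq_iff .
qed

section \<open>Polynomials in a unitary matrix\<close>

lemma pow_mat_eigen:
  assumes A: "A \<in> carrier_mat n n" and v: "v \<in> carrier_vec n" "A *\<^sub>v v = (\<mu> :: complex) \<cdot>\<^sub>v v"
  shows "(A ^\<^sub>m k) *\<^sub>v v = \<mu> ^ k \<cdot>\<^sub>v v"
proof (induction k)
  case 0
  then show ?case using A v by simp
next
  case (Suc k)
  have "(A ^\<^sub>m Suc k) *\<^sub>v v = A ^\<^sub>m k *\<^sub>v (\<mu> \<cdot>\<^sub>v v)"
    using assoc_mult_mat_vec[OF pow_carrier_mat[OF A] A v(1)] v(2) by simp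
  also have "\<dots> = \<mu> \<cdot>\<^sub>v (A ^\<^sub>m k *\<^sub>v v)" by (rule mult_mat_vec[OF pow_carrier_mat[OF A] v(1)])
  finally show ?case using Suc by (simp add: smult_smult_assoc)
qed

lemma mat_poly_carrier: "A \<in> carrier_mat n n \<Longrightarrow> mat_poly p A \<in> carrier_mat n n"
  unfolding mat_poly_def by auto

lemma mat_poly_eigen:
  assumes A: "A \<in> carrier_mat n n" and v: "v \<in> carrier_vec n" "A *\<^sub>v v = \<mu> \<cdot>\<^sub>v v"
  shows "mat_poly p A *\<^sub>v v = poly p \<mu> \<cdot>\<^sub>v v"
proof (rule eq_vecI)
  fix i assume "i < dim_vec (poly p \<mu> \<cdot>\<^sub>v v)"
  then have i: "i < n" using v by simp
  have "(mat_poly p A *\<^sub>v v) $ i = (\<Sum>j<n. (\<Sum>k\<le>degree p. coeff p k * (A ^\<^sub>m k) $$ (i, j)) * v $ j)"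
    using i A v mat_poly_carrier[OF A, of p]
    by (subst index_mult_mat_vec_sum) (auto simp: mat_poly_def)
  also have "\<dots> = (\<Sum>k\<le>degree p. \<Sum>j<n. coeff p k * (A ^\<^sub>m k) $$ (i, j) * v $ j)"
    unfolding sum_distrib_right by (rule sum.swap)
  also have "\<dots> = (\<Sum>k\<le>degree p. coeff p k * ((A ^\<^sub>m k) *\<^sub>v v) $ i)"
    using i v carrier_matD[OF pow_carrier_mat[OF A]]
    by (intro sum.cong)
      (auto simp: index_mult_mat_vec_sum sum_distrib_left mult.assoc simp del: index_mult_mat_vec)
  also have "\<dots> = (\<Sum>k\<le>degree p. coeff p k * \<mu> ^ k) * v $ i"
    unfolding pow_mat_eigen[OF assms] using i v by (simp add: sum_distrib_right mult.assoc)
  finally show "(mat_poly p A *\<^sub>v v) $ i = (poly p \<mu> \<cdot>\<^sub>v v) $ i"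
    using i v by (simp add: poly_altdef)
qed (use v mat_poly_carrier[OF A, of p] in auto)

lemma mem_spectrumI:
  assumes "A \<in> carrier_mat n n" "v \<in> carrier_vec n" "A *\<^sub>v v = \<mu> \<cdot>\<^sub>v v" "v \<noteq> 0\<^sub>v n"
  shows "\<mu> \<in> spectrum A"
  using assms unfolding spectrum_def eigenvalue_def eigenvector_def by auto

text \<open>By diagonalizability, spectrum contained in 1 means being the identity. It is used by
  contradiction, to find another eigenvalue of the walk.\<close>

lemma unitary_spectrum_one:
  assumes U: "unitary_op n U" and sp: "\<And>z. z \<in> spectrum U \<Longrightarrow> z = 1" and w: "w \<in> carrier_vec n"
  shows "U *\<^sub>v w = w"
proof -
  note C = unitary_opD(1)[OF U]
  obtain S f where f: "finite S" "\<And>\<mu>. f \<mu> \<in> carrier_vec n" "\<And>\<mu>. U *\<^sub>v f \<mu> = \<mu> \<cdot>\<^sub>v f \<mu>"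
    "w = vsum n f S" using eigensumE[OF unitary_eigensum[OF U w] C] by metis
  have "U *\<^sub>v f \<mu> = f \<mu>" for \<mu>
  proof (cases "f \<mu> = 0\<^sub>v n")
    case True
    then show ?thesis using C by (auto intro!: eq_vecI)
  next
    case False
    then have "\<mu> = 1" using sp mem_spectrumI[OF C f(2,3)] by blast
    then show ?thesis using f(3)[of \<mu>] by simp
  qed
  then show ?thesis unfolding f(4) using f by (simp add: mult_mat_vsum[OF C])
qed

text \<open>Orthogonality to all fixed vectors removes the component of \<open>w\<close> at
  eigenvalue 1. The polynomial scales every other component by at most \<open>\<eta>\<close>, and
  Pythagoras adds them up without loss.\<close>

lemma vnorm_mat_poly_le:
  assumes U: "unitary_op n U" and w: "w \<in> carrier_vec n"
    and orth: "\<And>g. g \<in> carrier_vec n \<Longrightarrow> U *\<^sub>v g = g \<Longrightarrow> w \<bullet>c g = 0"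
    and bound: "\<And>z. z \<in> spectrum U \<Longrightarrow> z \<noteq> 1 \<Longrightarrow> cmod (poly p z) \<le> \<eta>" and \<eta>: "0 \<le> \<eta>"
  shows "vnorm (mat_poly p U *\<^sub>v w) \<le> \<eta> * vnorm w"
proof -
  note C = unitary_opD(1)[OF U]
  obtain S f where f: "finite S" "\<And>\<mu>. f \<mu> \<in> carrier_vec n" "\<And>\<mu>. U *\<^sub>v f \<mu> = \<mu> \<cdot>\<^sub>v f \<mu>"
    "w = vsum n f S" "\<And>\<mu>. \<mu> \<notin> S \<Longrightarrow> f \<mu> = 0\<^sub>v n"
    using eigensumE[OF unitary_eigensum[OF U w] C] by metis
  note fd [simp] = carrier_vecD[OF f(2)]
  have orthf: "f \<mu> \<bullet>c f \<nu> = 0" if "\<mu> \<noteq> \<nu>" for \<mu> \<nu>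
    by (rule unitary_eigen_orthogonal[OF U f(2,3) f(2,3) that])
  \<comment> \<open>The component \<open>f 1\<close> is itself a fixed vector, and by mutual
    orthogonality its pairing with \<open>w\<close> is its own squared norm.\<close>
  have f1: "f 1 = 0\<^sub>v n"
  proof (cases "1 \<in> S")
    case True
    have "0 = w \<bullet>c f 1" using orth[of "f 1"] f(2,3) by simp
    also have "\<dots> = (\<Sum>\<mu>\<in>S. if \<mu> = 1 then f 1 \<bullet>c f 1 else 0)"
      unfolding f(4) cscalar_prod_vsum_left[OF f(2)] by (rule sum.cong) (use orthf in auto)
    also have "\<dots> = f 1 \<bullet>c f 1" using True f(1) by simp
    finally have "vnorm (f 1) = 0" by (simp add: cscalar_prod_self)
    then show ?thesis using vnorm_zero_iff[OF f(2)] by simp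
  qed (use f in auto)
  have le: "vnorm (poly p \<mu> \<cdot>\<^sub>v f \<mu>) \<le> \<eta> * vnorm (f \<mu>)" for \<mu>
  proof (cases "f \<mu> = 0\<^sub>v n")
    case True
    then have "vnorm (f \<mu>) = 0" using vnorm_zero_iff[OF f(2)] by blast
    then show ?thesis by (simp add: vnorm_smult)
  next
    case False
    then have "\<mu> \<in> spectrum U" "\<mu> \<noteq> 1" using mem_spectrumI[OF C f(2,3)] f1 by auto
    then show ?thesis using bound by (simp add: vnorm_smult mult_right_mono)
  qed
  have eq: "mat_poly p U *\<^sub>v w = vsum n (\<lambda>\<mu>. poly p \<mu> \<cdot>\<^sub>v f \<mu>) S"
    unfolding f(4) using f(2)
    by (subst mult_mat_vsum[OF mat_poly_carrier[OF C]])
      (auto intro!: vsum_cong mat_poly_eigen[OF C f(2,3)])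
  have "(vnorm (mat_poly p U *\<^sub>v w))\<^sup>2 = (\<Sum>\<mu>\<in>S. (vnorm (poly p \<mu> \<cdot>\<^sub>v f \<mu>))\<^sup>2)"
    unfolding eq using f orthf
    by (intro vnorm_vsum_orthogonal) (auto simp: cscalar_prod_smult_left cscalar_prod_smult_right)
  also have "\<dots> \<le> (\<Sum>\<mu>\<in>S. (\<eta> * vnorm (f \<mu>))\<^sup>2)"
    by (intro sum_mono power_mono le) simp
  also have "\<dots> = \<eta>\<^sup>2 * (vnorm w)\<^sup>2"
    unfolding f(4) using f orthf
    by (subst vnorm_vsum_orthogonal) (auto simp: power_mult_distrib sum_distrib_left)
  finally have "(vnorm (mat_poly p U *\<^sub>v w))\<^sup>2 \<le> (\<eta> * vnorm w)\<^sup>2" by (simp add: power_mult_distrib)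
  then show ?thesis by (rule power2_le_imp_le) (simp add: \<eta>)
qed


subsection \<open>The walk of a reversible chain\<close>

lemma sum_lessThan_mult:
  fixes g :: "nat \<Rightarrow> 'a :: comm_monoid_add"
  shows "(\<Sum>i<m * n. g i) = (\<Sum>x<m. \<Sum>y<n. g (x * n + y))"
proof (induction m)
  case (Suc m)
  have "(\<Sum>i<Suc m * n. g i) = (\<Sum>i<m * n. g i) + (\<Sum>i\<in>{m * n..<m * n + n}. g i)"
    by (subst sum.union_disjoint[symmetric]) (auto intro!: sum.cong simp: ivl_disj_un)
  also have "(\<Sum>i\<in>{m * n..<m * n + n}. g i) = (\<Sum>y<n. g (m * n + y))"
    by (rule sum.reindex_bij_witness[of _ "\<lambda>y. m * n + y" "\<lambda>i. i - m * n"]) auto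
  finally show ?case using Suc by simp
qed simp

lemma pair_index_less: "x < m \<Longrightarrow> y < n \<Longrightarrow> x * n + y < m * (n :: nat)"
proof -
  assume "x < m" "y < n"
  then have "x * n + y < Suc x * n" by simp
  also have "\<dots> \<le> m * n" using \<open>x < m\<close> by (intro mult_le_mono1) simp
  finally show ?thesis .
qed

lemma step_isometry_carrier [simp]: "step_isometry N P \<in> carrier_mat (N * N) N"
  by (simp add: step_isometry_def)

lemma swap_op_carrier [simp]: "swap_op N \<in> carrier_mat (N * N) (N * N)"
  by (simp add: swap_op_def)

lemma dim_step_isometry [simp]:
  "dim_row (step_isometry N P) = N * N" "dim_col (step_isometry N P) = N"
  by (simp_all add: step_isometry_def)

lemma dim_swap_op [simp]: "dim_row (swap_op N) = N * N" "dim_col (swap_op N) = N * N"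
  by (simp_all add: swap_op_def)

lemma div_mod_less_square: "i < N * N \<Longrightarrow> i div N < N" "i < N * N \<Longrightarrow> i mod N < (N :: nat)"
  by (auto simp: less_mult_imp_div_less) (metis mod_less_divisor mult_zero_left not_gr_zero not_less_zero)

text \<open>Solving the two conditions of the definition for the column \<open>j\<close> turns each
  row into a single delta, so that sums over columns collapse.\<close>

lemma swap_op_index:
  assumes "i < N * N" "j < N * N"
  shows "swap_op N $$ (i, j) = (if j = (i mod N) * N + i div N then 1 else 0)"
proof -
  have "j = (i mod N) * N + i div N \<longleftrightarrow> i div N = j mod N \<and> i mod N = j div N"
    using div_mod_less_square[OF assms(1)] div_mult_mod_eq[of j N] by auto
  then show ?thesis using assms by (simp add: swap_op_def)
qed

lemma swap_op_vec:
  assumes "v \<in> carrier_vec (N * N)" "i < N * N"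
  shows "(swap_op N *\<^sub>v v) $ i = v $ ((i mod N) * N + i div N)"
proof -
  have "(swap_op N *\<^sub>v v) $ i = (\<Sum>j<N * N. (if j = (i mod N) * N + i div N then 1 else 0) * v $ j)"
    using assms swap_op_carrier[of N]
    by (subst index_mult_mat_vec_sum) (auto simp: swap_op_index)
  also have "\<dots> = (\<Sum>j<N * N. if j = (i mod N) * N + i div N then v $ j else 0)"
    by (rule sum.cong) auto
  finally show ?thesis
    using pair_index_less[of "i mod N" N "i div N" N] div_mod_less_square[OF assms(2)] by simp
qed

lemma swap_op_adjoint: "mat_adjoint (swap_op N) = swap_op N"
  by (rule eq_matI) (auto simp: swap_op_def)

lemma swap_op_square: "swap_op N * swap_op N = 1\<^sub>m (N * N)"
proof (rule eq_matI)
  fix i j assume "i < dim_row (1\<^sub>m (N * N) :: complex mat)" "j < dim_col (1\<^sub>m (N * N) :: complex mat)"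
  then have ij: "i < N * N" "j < N * N" by auto
  have i': "(i mod N) * N + i div N < N * N"
    using pair_index_less[of "i mod N" N "i div N" N] div_mod_less_square[OF ij(1)] by simp
  have "(swap_op N * swap_op N) $$ (i, j)
      = (\<Sum>k<N * N. (if k = (i mod N) * N + i div N then 1 else 0) * swap_op N $$ (k, j))"
    using ij by (subst index_mult_sum) (auto simp: swap_op_index intro!: sum.cong)
  also have "\<dots> = (\<Sum>k<N * N. if k = (i mod N) * N + i div N then swap_op N $$ (k, j) else 0)"
    by (rule sum.cong) auto
  also have "\<dots> = swap_op N $$ ((i mod N) * N + i div N, j)" using i' by simp
  also have "\<dots> = 1\<^sub>m (N * N) $$ (i, j)"
    using div_mod_less_square[OF ij(1)] ij i' by (simp add: swap_op_index)
  finally show "(swap_op N * swap_op N) $$ (i, j) = 1\<^sub>m (N * N) $$ (i, j)" .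
qed (auto simp: swap_op_def)

lemma swap_op_unitary: "unitary_op (N * N) (swap_op N)"
  unfolding unitary_op_def by (simp add: swap_op_adjoint swap_op_square)

lemma step_isometry_vec:
  assumes "v \<in> carrier_vec N" "i < N * N"
  shows "(step_isometry N P *\<^sub>v v) $ i = v $ (i div N) * complex_of_real (sqrt (P $$ (i div N, i mod N)))"
proof -
  have "(step_isometry N P *\<^sub>v v) $ i = (\<Sum>x<N. step_isometry N P $$ (i, x) * v $ x)"
    using assms by (subst index_mult_mat_vec_sum) auto
  also have "\<dots>
      = (\<Sum>x<N. if x = i div N then v $ x * complex_of_real (sqrt (P $$ (x, i mod N))) else 0)"
    by (rule sum.cong) (use assms in \<open>auto simp: step_isometry_def\<close>)
  finally show ?thesis using div_mod_less_square[OF assms(2)] by simp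
qed

text \<open>Different columns of the step isometry have disjoint supports, and the squared norm of
  column \<open>x\<close> is the row sum of \<open>P\<close> at \<open>x\<close>.\<close>

lemma stochastic_isometry:
  assumes "stochastic N P"
  shows "mat_adjoint (step_isometry N P) * step_isometry N P = 1\<^sub>m N"
proof (rule eq_matI)
  let ?T = "step_isometry N P"
  fix x x' assume "x < dim_row (1\<^sub>m N :: complex mat)" "x' < dim_col (1\<^sub>m N :: complex mat)"
  then have x: "x < N" "x' < N" by auto
  have "(mat_adjoint ?T * ?T) $$ (x, x') = (\<Sum>i<N * N. cnj (?T $$ (i, x)) * ?T $$ (i, x'))"
    using x step_isometry_carrier[of N P] by (subst index_mult_sum) auto
  also have "\<dots> = (\<Sum>a<N. \<Sum>b<N. if a = x \<and> a = x' then complex_of_real (P $$ (x, b)) else 0)"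
    unfolding sum_lessThan_mult
  proof (intro sum.cong refl)
    fix a b assume "a \<in> {..<N}" "b \<in> {..<N}"
    then show "cnj (?T $$ (a * N + b, x)) * ?T $$ (a * N + b, x')
        = (if a = x \<and> a = x' then complex_of_real (P $$ (x, b)) else 0)"
      using x pair_index_less[of a N b N] assms
      by (auto simp: step_isometry_def stochastic_def simp flip: of_real_mult)
  qed
  also have "\<dots> = (\<Sum>a<N. if a = x then (if x = x' then (\<Sum>b<N. complex_of_real (P $$ (x, b))) else 0) else 0)"
    by (rule sum.cong) auto
  also have "\<dots> = 1\<^sub>m N $$ (x, x')"
    using x assms by (simp add: stochastic_def flip: of_real_sum)
  finally show "(mat_adjoint ?T * ?T) $$ (x, x') = 1\<^sub>m N $$ (x, x')" .
qed (use step_isometry_carrier[of N P] in auto)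

section \<open>Reflections about the range of an isometry\<close>

lemma smult_mat_mult_vec:
  fixes A :: "'a :: comm_ring_1 mat"
  assumes "A \<in> carrier_mat n m" "v \<in> carrier_vec m"
  shows "(c \<cdot>\<^sub>m A) *\<^sub>v v = c \<cdot>\<^sub>v (A *\<^sub>v v)"
  by (rule eq_vecI) (use assms in auto)

lemma reflection_vec:
  assumes A: "A \<in> carrier_mat n m" and w: "w \<in> carrier_vec n"
  shows "(2 \<cdot>\<^sub>m (A * mat_adjoint A) - 1\<^sub>m n) *\<^sub>v w = 2 \<cdot>\<^sub>v (A *\<^sub>v (mat_adjoint A *\<^sub>v w)) - w"
proof -
  have AA: "A * mat_adjoint A \<in> carrier_mat n n" using A by auto
  have "(2 \<cdot>\<^sub>m (A * mat_adjoint A) - 1\<^sub>m n) *\<^sub>v w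
      = (2 \<cdot>\<^sub>m (A * mat_adjoint A)) *\<^sub>v w - 1\<^sub>m n *\<^sub>v w"
    by (rule minus_mult_distrib_mat_vec) (use AA w in auto)
  also have "(2 \<cdot>\<^sub>m (A * mat_adjoint A)) *\<^sub>v w = 2 \<cdot>\<^sub>v (A * mat_adjoint A *\<^sub>v w)"
    by (rule smult_mat_mult_vec) (use AA w in auto)
  also have "A * mat_adjoint A *\<^sub>v w = A *\<^sub>v (mat_adjoint A *\<^sub>v w)"
    by (rule assoc_mult_mat_vec[OF A mat_adjoint_carrier[OF A] w])
  finally show ?thesis using w by simp
qed

lemma eq_mat_vecI:
  fixes A B :: "complex mat"
  assumes A: "A \<in> carrier_mat n m" and B: "B \<in> carrier_mat n m"
    and eq: "\<And>v. v \<in> carrier_vec m \<Longrightarrow> A *\<^sub>v v = B *\<^sub>v v"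
  shows "A = B"
proof (rule eq_matI)
  fix i j assume "i < dim_row B" "j < dim_col B"
  then have ij: "i < n" "j < m" using B by auto
  have "A *\<^sub>v unit_vec m j = B *\<^sub>v unit_vec m j" by (rule eq) simp
  then have "(A *\<^sub>v unit_vec m j) $ i = (B *\<^sub>v unit_vec m j) $ i" by simp
  then show "A $$ (i, j) = B $$ (i, j)" using A B ij by simp
qed (use A B in auto)

text \<open>Stated for any isometry because it serves twice: with the step isometry inside the walk,
  and with \<open>ket N 0\<close> inside the gate \<open>CRefl\<close>.\<close>

lemma reflection_unitary:
  assumes A: "A \<in> carrier_mat n m" and 1: "mat_adjoint A * A = 1\<^sub>m m"
  shows "unitary_op n (2 \<cdot>\<^sub>m (A * mat_adjoint A) - 1\<^sub>m n)"
    and "mat_adjoint (2 \<cdot>\<^sub>m (A * mat_adjoint A) - 1\<^sub>m n) = 2 \<cdot>\<^sub>m (A * mat_adjoint A) - 1\<^sub>m n"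
    and "(2 \<cdot>\<^sub>m (A * mat_adjoint A) - 1\<^sub>m n) * (2 \<cdot>\<^sub>m (A * mat_adjoint A) - 1\<^sub>m n) = 1\<^sub>m n"
proof -
  let ?R = "2 \<cdot>\<^sub>m (A * mat_adjoint A) - 1\<^sub>m n"
  have A': "mat_adjoint A \<in> carrier_mat m n" using A by simp
  have R: "?R \<in> carrier_mat n n" using A by auto
  have "mat_adjoint (A * mat_adjoint A) = A * mat_adjoint A"
    by (simp add: mat_adjoint_mult[OF A A'])
  then have "cnj ((A * mat_adjoint A) $$ (j, i)) = (A * mat_adjoint A) $$ (i, j)"
    if "i < n" "j < n" for i j using that mat_adjoint_index[of i "A * mat_adjoint A" j] A by simp
  then show adj: "mat_adjoint ?R = ?R"
    by (intro eq_matI) (use A in \<open>auto simp del: index_mult_mat(1)\<close>)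
  show sq: "?R * ?R = 1\<^sub>m n"
  proof (rule eq_mat_vecI)
    fix v :: "complex vec" assume v: "v \<in> carrier_vec n"
    define a where "a = mat_adjoint A *\<^sub>v v"
    have a: "a \<in> carrier_vec m" unfolding a_def by (rule mult_mat_vec_carrier[OF A' v])
    have Aa: "A *\<^sub>v a \<in> carrier_vec n" using A a by simp
    \<comment> \<open>Reflecting does not change the coefficient vector \<open>a\<close>, so the
      second reflection subtracts from the same \<open>2 A a\<close> and returns
      \<open>v\<close>.\<close>
    have "mat_adjoint A *\<^sub>v (2 \<cdot>\<^sub>v (A *\<^sub>v a) - v) = 2 \<cdot>\<^sub>v a - a"
      using mult_minus_distrib_mat_vec[OF A' smult_carrier_vec[of 2, THEN iffD2, OF Aa] v]
        mult_mat_vec[OF A' Aa, of 2] isometry_adjoint_mult_vec[OF A 1 a] by (simp add: a_def)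
    also have "\<dots> = a" using a by auto
    finally have 2: "mat_adjoint A *\<^sub>v (2 \<cdot>\<^sub>v (A *\<^sub>v a) - v) = a" .
    have "?R * ?R *\<^sub>v v = ?R *\<^sub>v (?R *\<^sub>v v)" by (rule assoc_mult_mat_vec[OF R R v])
    also have "?R *\<^sub>v v = 2 \<cdot>\<^sub>v (A *\<^sub>v a) - v" using reflection_vec[OF A v] by (simp add: a_def)
    also have "?R *\<^sub>v \<dots> = 2 \<cdot>\<^sub>v (A *\<^sub>v a) - (2 \<cdot>\<^sub>v (A *\<^sub>v a) - v)"
      using reflection_vec[OF A, of "2 \<cdot>\<^sub>v (A *\<^sub>v a) - v"] Aa v 2 by simp
    also have "\<dots> = v" using Aa v by auto
    finally show "?R * ?R *\<^sub>v v = 1\<^sub>m n *\<^sub>v v" using v by simp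
  qed (use R in \<open>auto intro: mult_carrier_mat[of _ n n _ n]\<close>)
  show "unitary_op n ?R" unfolding unitary_op_def adj sq using R by simp
qed

lemma walk_unitary:
  assumes "stochastic N P"
  shows "unitary_op (N * N) (walk N P)"
  unfolding walk_def
  by (intro unitary_op_mult swap_op_unitary reflection_unitary(1)[OF step_isometry_carrier]
      stochastic_isometry assms)

lemma walk_carrier [simp]: "walk N P \<in> carrier_mat (N * N) (N * N)"
  by (rule carrier_matI) (simp_all add: walk_def)

lemma walk_vec:
  assumes w: "w \<in> carrier_vec (N * N)"
  shows "walk N P *\<^sub>v w = (2 \<cdot>\<^sub>m (step_isometry N P * mat_adjoint (step_isometry N P)) - 1\<^sub>m (N * N)) *\<^sub>v (swap_op N *\<^sub>v w)"
  unfolding walk_def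
  by (rule assoc_mult_mat_vec[OF _ swap_op_carrier w]) (auto simp: mult_carrier_mat[of _ "N * N" N])

lemma dim_qsample [simp]: "dim_vec (qsample N \<mu>) = N"
  by (simp add: qsample_def)

locale reversible_chain =
  fixes N :: nat and P :: "real mat" and \<mu> :: "real vec"
  assumes chain: "reversible_ergodic_chain N P \<mu>"
begin

abbreviation "T \<equiv> step_isometry N P"
abbreviation "q \<equiv> qsample N \<mu>"

lemma stoch: "stochastic N P"
  using chain by (simp add: reversible_ergodic_chain_def)

lemma P_carrier: "P \<in> carrier_mat N N"
  using stoch by (simp add: stochastic_def)

lemma P_nonneg: "x < N \<Longrightarrow> y < N \<Longrightarrow> 0 \<le> P $$ (x, y)"
  using stoch by (simp add: stochastic_def)

lemma detailed_balance: "x < N \<Longrightarrow> y < N \<Longrightarrow> \<mu> $ x * P $$ (x, y) = \<mu> $ y * P $$ (y, x)"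
  using chain by (simp add: reversible_ergodic_chain_def)

lemma mu_nonneg: "x < N \<Longrightarrow> 0 \<le> \<mu> $ x"
  using chain by (simp add: reversible_ergodic_chain_def stationary_def)

lemma mu_sum: "(\<Sum>x<N. \<mu> $ x) = 1"
  using chain by (simp add: reversible_ergodic_chain_def stationary_def)

lemma pow_nonneg: "x < N \<Longrightarrow> y < N \<Longrightarrow> 0 \<le> (P ^\<^sub>m k) $$ (x, y)"
proof (induction k arbitrary: y)
  case 0
  then show ?case using P_carrier by simp
next
  case (Suc k)
  have "(P ^\<^sub>m Suc k) $$ (x, y) = (\<Sum>z<N. (P ^\<^sub>m k) $$ (x, z) * P $$ (z, y))"
    using Suc.prems P_carrier carrier_matD[OF pow_carrier_mat[OF P_carrier, of k]]
    unfolding pow_mat.simps by (subst index_mult_sum) auto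
  then show ?case using Suc P_nonneg by (auto intro!: sum_nonneg)
qed

text \<open>An induction principle from irreducibility: a positive entry of a power of
  \<open>P\<close> yields a path of positive transitions, along which a property propagates from
  \<open>x\<close>. It gives positivity of \<open>\<mu>\<close> and constancy of
  \<open>a / q\<close>.\<close>

lemma connected:
  assumes "x < N" "y < N" "R x x"
    and step: "\<And>z z'. z < N \<Longrightarrow> z' < N \<Longrightarrow> R x z \<Longrightarrow> 0 < P $$ (z, z') \<Longrightarrow> R x z'"
  shows "R x y"
proof -
  have "0 < (P ^\<^sub>m k) $$ (x, y) \<Longrightarrow> y < N \<Longrightarrow> R x y" for k y
  proof (induction k arbitrary: y)
    case 0
    then show ?case using assms(1,3) P_carrier by (simp split: if_splits)
  next
    case (Suc k)
    have "(P ^\<^sub>m Suc k) $$ (x, y) = (\<Sum>z<N. (P ^\<^sub>m k) $$ (x, z) * P $$ (z, y))"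
      using Suc.prems assms(1) P_carrier carrier_matD[OF pow_carrier_mat[OF P_carrier, of k]]
      unfolding pow_mat.simps by (subst index_mult_sum) auto
    then have "(\<Sum>z<N. (P ^\<^sub>m k) $$ (x, z) * P $$ (z, y)) \<noteq> 0" using Suc.prems by simp
    then obtain z where z: "z < N" "(P ^\<^sub>m k) $$ (x, z) * P $$ (z, y) \<noteq> 0"
      by (meson lessThan_iff sum.not_neutral_contains_not_neutral)
    then have "0 < (P ^\<^sub>m k) $$ (x, z)" "0 < P $$ (z, y)"
      using pow_nonneg[OF assms(1) z(1), of k] P_nonneg[OF z(1) Suc.prems(2)] by (auto simp: less_le)
    then show ?case using Suc z step by blast
  qed
  moreover obtain k where "0 < (P ^\<^sub>m k) $$ (x, y)"
    using chain assms(1,2) unfolding reversible_ergodic_chain_def irreducible_chain_def by blast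
  ultimately show ?thesis using assms(2) by blast
qed

text \<open>Detailed balance equates two products of nonnegative numbers; if one is positive, so are
  both factors of the other.\<close>

lemma P_pos_sym:
  assumes "x < N" "y < N" "0 < \<mu> $ x" "0 < P $$ (x, y)"
  shows "0 < \<mu> $ y" "0 < P $$ (y, x)"
proof -
  have "0 < \<mu> $ y * P $$ (y, x)" using detailed_balance[OF assms(1,2)] assms(3,4) by (metis mult_pos_pos)
  then show "0 < \<mu> $ y" "0 < P $$ (y, x)"
    using mu_nonneg[OF assms(2)] P_nonneg[OF assms(2,1)] by (auto simp: zero_less_mult_iff)
qed

lemma mu_pos:
  assumes "y < N"
  shows "0 < \<mu> $ y"
proof -
  have "(\<Sum>x<N. \<mu> $ x) \<noteq> 0" using mu_sum by simp
  then obtain x where "x < N" "\<mu> $ x \<noteq> 0"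
    by (meson lessThan_iff sum.not_neutral_contains_not_neutral)
  then have "x < N" "0 < \<mu> $ x" using mu_nonneg[of x] by auto
  then show ?thesis
    using connected[of x y "\<lambda>_ z. 0 < \<mu> $ z"] P_pos_sym assms by blast
qed

section \<open>The qsample and the vectors fixed by the walk\<close>

lemma q_carrier [simp]: "q \<in> carrier_vec N"
  by (simp add: qsample_def)

lemma q_index: "x < N \<Longrightarrow> q $ x = complex_of_real (sqrt (\<mu> $ x))"
  by (simp add: qsample_def)

lemma vnorm_q: "vnorm q = 1"
  unfolding vnorm_def L2_set_def
  using mu_sum mu_nonneg by (simp add: qsample_def)

lemma TT: "mat_adjoint T * T = 1\<^sub>m N"
  by (rule stochastic_isometry[OF stoch])

text \<open>The entry of \<open>T q\<close> at the pair \<open>(x, y)\<close> is the square root of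
  \<open>\<mu> x P(x, y)\<close>, and detailed balance says that this is symmetric in the
  pair.\<close>

lemma swap_Tq: "swap_op N *\<^sub>v (T *\<^sub>v q) = T *\<^sub>v q"
proof (rule eq_vecI)
  fix i assume "i < dim_vec (T *\<^sub>v q)"
  then have i: "i < N * N" by (simp add: step_isometry_def)
  note d = div_mod_less_square[OF i]
  have "sqrt (\<mu> $ (i mod N)) * sqrt (P $$ (i mod N, i div N)) = sqrt (\<mu> $ (i div N)) * sqrt (P $$ (i div N, i mod N))"
    using detailed_balance[of "i mod N" "i div N"] d by (simp flip: real_sqrt_mult)
  then show "(swap_op N *\<^sub>v (T *\<^sub>v q)) $ i = (T *\<^sub>v q) $ i"
    using i d pair_index_less[of "i mod N" N "i div N" N]
    by (simp add: swap_op_vec[OF mult_mat_vec_carrier[OF step_isometry_carrier q_carrier]]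
        step_isometry_vec[OF q_carrier] q_index del: index_mult_mat_vec flip: of_real_mult)
qed (simp add: swap_op_def step_isometry_def)

lemma walk_Tq: "walk N P *\<^sub>v (T *\<^sub>v q) = T *\<^sub>v q"
proof -
  have c: "T *\<^sub>v q \<in> carrier_vec (N * N)" by (rule mult_mat_vec_carrier[OF step_isometry_carrier q_carrier])
  show ?thesis
    unfolding walk_vec[OF c] swap_Tq reflection_vec[OF step_isometry_carrier c]
      isometry_adjoint_mult_vec[OF step_isometry_carrier TT q_carrier]
    using c by (intro eq_vecI) auto
qed

text \<open>If \<open>w\<close> is fixed by the walk and \<open>a = T\<^sup>\<dagger> w\<close>, then \<open>T\<^sup>\<dagger> S T a = a\<close>. As \<open>T\<close> and the swap \<open>S\<close> are isometries, this
  is the equality case of Cauchy-Schwarz and forces \<open>S T a = T a\<close>, which entrywise says that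
  \<open>a / q\<close> takes the same value at neighbouring states.\<close>

lemma walk_fixed_adjoint:
  assumes w: "w \<in> carrier_vec (N * N)" and fixed: "walk N P *\<^sub>v w = w"
  shows "\<exists>c. mat_adjoint T *\<^sub>v w = c \<cdot>\<^sub>v q"
proof -
  let ?S = "swap_op N" and ?T' = "mat_adjoint T"
  let ?R = "2 \<cdot>\<^sub>m (T * ?T') - 1\<^sub>m (N * N)"
  note T = step_isometry_carrier[of N P] and S = swap_op_carrier[of N]
  note T' = mat_adjoint_carrier[OF T]
  have R: "?R \<in> carrier_mat (N * N) (N * N)" by (auto simp: mult_carrier_mat[of _ "N * N" N])
  define a where "a = ?T' *\<^sub>v w"
  have a: "a \<in> carrier_vec N" unfolding a_def by (rule mult_mat_vec_carrier[OF T' w])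
  have Ta: "T *\<^sub>v a \<in> carrier_vec (N * N)" by (rule mult_mat_vec_carrier[OF T a])
  have Sw: "?S *\<^sub>v w \<in> carrier_vec (N * N)" by (rule mult_mat_vec_carrier[OF S w])
  have STa: "?S *\<^sub>v (T *\<^sub>v a) \<in> carrier_vec (N * N)" by (rule mult_mat_vec_carrier[OF S Ta])
  have SS: "?S *\<^sub>v (?S *\<^sub>v v) = v" if "v \<in> carrier_vec (N * N)" for v
    using isometry_adjoint_mult_vec[OF S _ that] by (simp add: swap_op_adjoint swap_op_square)
  have TTa: "?T' *\<^sub>v (T *\<^sub>v a) = a" by (rule isometry_adjoint_mult_vec[OF T TT a])
  have sub: "A *\<^sub>v (2 \<cdot>\<^sub>v (T *\<^sub>v a) - w) = 2 \<cdot>\<^sub>v (A *\<^sub>v (T *\<^sub>v a)) - A *\<^sub>v w"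
    if A: "A \<in> carrier_mat m (N * N)" for A m
    using mult_minus_distrib_mat_vec[OF A smult_carrier_vec[of 2, THEN iffD2, OF Ta] w]
      mult_mat_vec[OF A Ta, of 2] by simp
  \<comment> \<open>The walk is \<open>?R * ?S\<close> and \<open>?R\<close> is an involution, so a
    fixed vector satisfies \<open>S w = R w\<close>, which no longer contains a product of the two
    factors.\<close>
  have "?S *\<^sub>v w = (?R * ?R) *\<^sub>v (?S *\<^sub>v w)"
    unfolding reflection_unitary(3)[OF T TT] using Sw by simp
  also have "\<dots> = ?R *\<^sub>v (?R *\<^sub>v (?S *\<^sub>v w))" by (rule assoc_mult_mat_vec[OF R R Sw])
  also have "\<dots> = ?R *\<^sub>v w" using fixed walk_vec[OF w, of P] by simp
  also have "\<dots> = 2 \<cdot>\<^sub>v (T *\<^sub>v a) - w" unfolding reflection_vec[OF T w] a_def ..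
  finally have Sw_eq: "?S *\<^sub>v w = 2 \<cdot>\<^sub>v (T *\<^sub>v a) - w" .
  have 1: "?T' *\<^sub>v (?S *\<^sub>v w) = a"
    unfolding Sw_eq sub[OF T'] TTa using a by (auto simp: a_def[symmetric])
  \<comment> \<open>Applying the swap to the formula for \<open>S w\<close> expresses
    \<open>w\<close> through \<open>S T a\<close>; the adjoint of \<open>T\<close> then gives
    \<open>a = 2 T\<^sup>\<dagger> S T a - a\<close>.\<close>
  have "w = 2 \<cdot>\<^sub>v (?S *\<^sub>v (T *\<^sub>v a)) - ?S *\<^sub>v w"
    using SS[OF w] unfolding Sw_eq sub[OF S] by simp
  then have "a = ?T' *\<^sub>v (2 \<cdot>\<^sub>v (?S *\<^sub>v (T *\<^sub>v a)) - ?S *\<^sub>v w)" by (simp add: a_def)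
  also have "\<dots> = 2 \<cdot>\<^sub>v (?T' *\<^sub>v (?S *\<^sub>v (T *\<^sub>v a))) - a"
    using mult_minus_distrib_mat_vec[OF T' smult_carrier_vec[of 2, THEN iffD2, OF STa] Sw]
      mult_mat_vec[OF T' STa, of 2] 1 by simp
  finally have 2: "a = 2 \<cdot>\<^sub>v (?T' *\<^sub>v (?S *\<^sub>v (T *\<^sub>v a))) - a" .
  have Da: "?T' *\<^sub>v (?S *\<^sub>v (T *\<^sub>v a)) = a" (is "?D = a")
  proof (rule eq_vecI)
    fix i assume i: "i < dim_vec a"
    have "a $ i = (2 \<cdot>\<^sub>v ?D - a) $ i" using 2 by simp
    also have "\<dots> = 2 * ?D $ i - a $ i"
      using i a carrier_vecD[OF mult_mat_vec_carrier[OF T' STa]] by (simp del: index_mult_mat_vec)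
    finally show "?D $ i = a $ i" by simp
  qed (use carrier_vecD[OF mult_mat_vec_carrier[OF T' STa]] a in simp)
  let ?d = "?S *\<^sub>v (T *\<^sub>v a) - T *\<^sub>v a"
  \<comment> \<open>All four inner products in the expansion equal \<open><a, a>\<close>, so they
    cancel.\<close>
  have "?d \<bullet>c ?d = (?S *\<^sub>v (T *\<^sub>v a)) \<bullet>c (?S *\<^sub>v (T *\<^sub>v a)) - (?S *\<^sub>v (T *\<^sub>v a)) \<bullet>c (T *\<^sub>v a)
      - (T *\<^sub>v a) \<bullet>c (?S *\<^sub>v (T *\<^sub>v a)) + (T *\<^sub>v a) \<bullet>c (T *\<^sub>v a)"
    using Ta STa by (simp add: cscalar_prod_diff_left cscalar_prod_diff_right)
  also have "(?S *\<^sub>v (T *\<^sub>v a)) \<bullet>c (?S *\<^sub>v (T *\<^sub>v a)) = (T *\<^sub>v a) \<bullet>c (T *\<^sub>v a)"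
    by (rule cscalar_prod_isometry[OF S _ Ta Ta]) (simp add: swap_op_adjoint swap_op_square)
  also have "(T *\<^sub>v a) \<bullet>c (?S *\<^sub>v (T *\<^sub>v a)) = a \<bullet>c a"
    using cscalar_prod_adjoint[OF T a STa] Da by simp
  also have "(?S *\<^sub>v (T *\<^sub>v a)) \<bullet>c (T *\<^sub>v a) = cnj (a \<bullet>c a)"
    using cscalar_prod_cnj[of "T *\<^sub>v a" "?S *\<^sub>v (T *\<^sub>v a)"] Ta STa cscalar_prod_adjoint[OF T a STa] Da by simp
  also have "(T *\<^sub>v a) \<bullet>c (T *\<^sub>v a) = a \<bullet>c a" by (rule cscalar_prod_isometry[OF T TT a a])
  finally have "vnorm ?d = 0" by (simp add: cscalar_prod_self)
  then have d0: "?d = 0\<^sub>v (N * N)" using vnorm_zero_iff[OF minus_carrier_vec[OF STa Ta]] by simp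
  have sym: "a $ y * complex_of_real (sqrt (P $$ (y, x))) = a $ x * complex_of_real (sqrt (P $$ (x, y)))"
    if xy: "x < N" "y < N" for x y
  proof -
    have i: "x * N + y < N * N" by (rule pair_index_less[OF xy])
    have j: "y * N + x < N * N" by (rule pair_index_less[OF xy(2,1)])
    have "?d $ (x * N + y) = 0" unfolding d0 using i by simp
    then have "(?S *\<^sub>v (T *\<^sub>v a)) $ (x * N + y) = (T *\<^sub>v a) $ (x * N + y)"
      using i Ta carrier_vecD[OF Ta] by (simp del: index_mult_mat_vec)
    then show ?thesis
      using xy j by (simp add: swap_op_vec[OF Ta i] step_isometry_vec[OF a i] step_isometry_vec[OF a j])
  qed
  \<comment> \<open>The ratio of \<open>a\<close> to the qsample, to be shown constant; the qsample
    vanishes nowhere.\<close>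
  define b where "b x = a $ x / complex_of_real (sqrt (\<mu> $ x))" for x
  have nb: "b x = b y" if xy: "x < N" "y < N" and pos: "0 < P $$ (x, y)" for x y
  proof -
    have m: "0 < \<mu> $ x" "0 < \<mu> $ y" using mu_pos xy by auto
    have p: "0 < P $$ (y, x)" using P_pos_sym xy m pos by blast
    have "sqrt (\<mu> $ x) * sqrt (P $$ (x, y)) = sqrt (\<mu> $ y) * sqrt (P $$ (y, x))"
      using detailed_balance[OF xy] by (simp flip: real_sqrt_mult)
    then have db: "complex_of_real (sqrt (\<mu> $ x)) * complex_of_real (sqrt (P $$ (x, y)))
        = complex_of_real (sqrt (\<mu> $ y)) * complex_of_real (sqrt (P $$ (y, x)))"
      by (simp flip: of_real_mult)
    have nz: "complex_of_real (sqrt (\<mu> $ x)) \<noteq> 0" "complex_of_real (sqrt (\<mu> $ y)) \<noteq> 0"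
        "complex_of_real (sqrt (P $$ (y, x))) \<noteq> 0" "complex_of_real (sqrt (P $$ (x, y))) \<noteq> 0"
      using m p pos by auto
    \<comment> \<open>Multiplying the symmetry of \<open>T a\<close> by the square-rooted detailed
      balance leaves one common nonzero factor, which is then cancelled.\<close>
    have "a $ x * complex_of_real (sqrt (\<mu> $ y)) * complex_of_real (sqrt (P $$ (y, x)))
        = a $ y * complex_of_real (sqrt (\<mu> $ x)) * complex_of_real (sqrt (P $$ (y, x)))"
      using sym[OF xy] db by (metis mult.assoc mult.commute)
    then show ?thesis unfolding b_def using nz by (simp add: field_simps)
  qed
  have "a = b 0 \<cdot>\<^sub>v q"
  proof (rule eq_vecI)
    fix x assume "x < dim_vec (b 0 \<cdot>\<^sub>v q)"
    then have x: "x < N" by (simp add: qsample_def)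
    have "b 0 = b x"
    proof (rule connected[of 0 x "\<lambda>y z. b y = b z"])
      show "b 0 = b z'" if "z < N" "z' < N" "b 0 = b z" "0 < P $$ (z, z')" for z z'
        unfolding that(3) by (rule nb[OF that(1,2,4)])
    qed (use x in auto)
    then show "a $ x = (b 0 \<cdot>\<^sub>v q) $ x"
      using x mu_pos[OF x] by (simp add: b_def q_index)
  qed (use a in simp)
  then show ?thesis unfolding a_def by blast
qed

text \<open>If 1 were the only eigenvalue, the walk would fix \<open>T\<close> applied to the basis
  vector at 0, and that basis vector would be a multiple of \<open>q\<close>. But \<open>q\<close>
  has no zero entry, while the basis vector vanishes at index 1.\<close>

lemma walk_nontrivial:
  assumes "2 \<le> N"
  shows "\<exists>z\<in>spectrum (walk N P). z \<noteq> 1"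
proof (rule ccontr)
  assume "\<not> ?thesis"
  then have all1: "\<And>z. z \<in> spectrum (walk N P) \<Longrightarrow> z = 1" by blast
  let ?e = "unit_vec N 0 :: complex vec"
  have Te: "T *\<^sub>v ?e \<in> carrier_vec (N * N)" by (rule mult_mat_vec_carrier[OF step_isometry_carrier]) simp
  have "walk N P *\<^sub>v (T *\<^sub>v ?e) = T *\<^sub>v ?e"
    by (rule unitary_spectrum_one[OF walk_unitary[OF stoch] all1 Te])
  from walk_fixed_adjoint[OF Te this] obtain c where "mat_adjoint T *\<^sub>v (T *\<^sub>v ?e) = c \<cdot>\<^sub>v q" ..
  then have e: "?e = c \<cdot>\<^sub>v q"
    using isometry_adjoint_mult_vec[OF step_isometry_carrier TT, of ?e] by simp
  have "?e $ 1 = (c \<cdot>\<^sub>v q) $ 1" "?e $ 0 = (c \<cdot>\<^sub>v q) $ 0" using e by simp_all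
  then show False
    using assms mu_pos[of 1] by (auto simp: q_index)
qed

text \<open>For a fixed vector \<open>g\<close>, the product of \<open>T v\<close> and
  \<open>g\<close> equals that of \<open>v\<close> and \<open>T\<^sup>\<dagger> g\<close>, a
  multiple of \<open>q\<close>. So \<open>v\<close> orthogonal to \<open>q\<close> makes
  \<open>T v\<close> orthogonal to the whole fixed space.\<close>

lemma vnorm_walk_poly_le:
  assumes v: "v \<in> carrier_vec N" "v \<bullet>c q = 0"
    and bound: "\<And>z. z \<in> spectrum (walk N P) \<Longrightarrow> z \<noteq> 1 \<Longrightarrow> cmod (poly p z) \<le> \<eta>" and \<eta>: "0 \<le> \<eta>"
  shows "vnorm (mat_poly p (walk N P) *\<^sub>v (T *\<^sub>v v)) \<le> \<eta> * vnorm v"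
proof -
  have Tv: "T *\<^sub>v v \<in> carrier_vec (N * N)" by (rule mult_mat_vec_carrier[OF step_isometry_carrier v(1)])
  have "(T *\<^sub>v v) \<bullet>c g = 0" if g: "g \<in> carrier_vec (N * N)" "walk N P *\<^sub>v g = g" for g
  proof -
    obtain c where "mat_adjoint T *\<^sub>v g = c \<cdot>\<^sub>v q" using walk_fixed_adjoint[OF g] ..
    then show ?thesis
      using cscalar_prod_adjoint[OF step_isometry_carrier v(1) g(1)] v(2)
      by (simp add: cscalar_prod_smult_right)
  qed
  from vnorm_mat_poly_le[OF walk_unitary[OF stoch] Tv this bound \<eta>] show ?thesis
    using vnorm_isometry[OF step_isometry_carrier TT v(1)] by simp
qed

end


subsection \<open>Gates and circuits\<close>

lemma dim_kron [simp]:
  "dim_row (A \<otimes>\<^sub>m B) = dim_row A * dim_row B" "dim_col (A \<otimes>\<^sub>m B) = dim_col A * dim_col B"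
  by (simp_all add: kron_def)

lemma kron_carrier:
  "A \<in> carrier_mat n m \<Longrightarrow> B \<in> carrier_mat p q \<Longrightarrow> A \<otimes>\<^sub>m B \<in> carrier_mat (n * p) (m * q)"
  by (rule carrier_matI) auto

lemma kron_index:
  assumes "i < dim_row A * dim_row B" "j < dim_col A * dim_col B"
  shows "(A \<otimes>\<^sub>m B) $$ (i, j)
    = A $$ (i div dim_row B, j div dim_col B) * B $$ (i mod dim_row B, j mod dim_col B)"
  using assms by (simp add: kron_def)

lemma div_mod_less_mult:
  assumes "i < m * (n :: nat)"
  shows "i div n < m" "i mod n < n"
  using assms by (auto simp: less_mult_imp_div_less) (metis mod_less_divisor mult_0_right not_gr_zero not_less_zero)

lemma kron_mult:
  assumes A: "A \<in> carrier_mat n m" and B: "B \<in> carrier_mat p q"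
    and C: "C \<in> carrier_mat m k" and D: "D \<in> carrier_mat q l"
  shows "(A \<otimes>\<^sub>m B) * (C \<otimes>\<^sub>m D) = (A * C) \<otimes>\<^sub>m (B * D)"
proof (rule eq_matI)
  fix i j assume "i < dim_row ((A * C) \<otimes>\<^sub>m (B * D))" "j < dim_col ((A * C) \<otimes>\<^sub>m (B * D))"
  then have i: "i < n * p" and j: "j < k * l" using assms by auto
  note d = div_mod_less_mult[OF i] div_mod_less_mult[OF j]
  have "((A \<otimes>\<^sub>m B) * (C \<otimes>\<^sub>m D)) $$ (i, j) = (\<Sum>r<m * q. (A \<otimes>\<^sub>m B) $$ (i, r) * (C \<otimes>\<^sub>m D) $$ (r, j))"
    using i j assms by (subst index_mult_sum) auto
  also have "\<dots> = (\<Sum>x<m. \<Sum>y<q. (A $$ (i div p, x) * C $$ (x, j div l)) * (B $$ (i mod p, y) * D $$ (y, j mod l)))"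
    unfolding sum_lessThan_mult
  proof (intro sum.cong refl)
    fix x y assume "x \<in> {..<m}" "y \<in> {..<q}"
    then show "(A \<otimes>\<^sub>m B) $$ (i, x * q + y) * (C \<otimes>\<^sub>m D) $$ (x * q + y, j)
      = (A $$ (i div p, x) * C $$ (x, j div l)) * (B $$ (i mod p, y) * D $$ (y, j mod l))"
      using assms i j pair_index_less[of x m y q] by (simp add: kron_index mult_ac)
  qed
  also have "\<dots> = (\<Sum>x<m. A $$ (i div p, x) * C $$ (x, j div l)) * (\<Sum>y<q. B $$ (i mod p, y) * D $$ (y, j mod l))"
    by (simp add: sum_product)
  also have "\<dots> = ((A * C) \<otimes>\<^sub>m (B * D)) $$ (i, j)"
    using assms i j d by (simp add: kron_index index_mult_sum del: index_mult_mat(1))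
  finally show "((A \<otimes>\<^sub>m B) * (C \<otimes>\<^sub>m D)) $$ (i, j) = ((A * C) \<otimes>\<^sub>m (B * D)) $$ (i, j)" .
qed (use assms in auto)

lemma kron_adjoint: "mat_adjoint (A \<otimes>\<^sub>m B) = mat_adjoint A \<otimes>\<^sub>m mat_adjoint B"
  by (rule eq_matI) (auto simp: kron_index div_mod_less_mult)

lemma kron_one: "1\<^sub>m a \<otimes>\<^sub>m 1\<^sub>m b = 1\<^sub>m (a * b)"
proof (rule eq_matI)
  fix i j assume "i < dim_row (1\<^sub>m (a * b) :: complex mat)" "j < dim_col (1\<^sub>m (a * b) :: complex mat)"
  then have ij: "i < a * b" "j < a * b" by auto
  have "i = j \<longleftrightarrow> i div b = j div b \<and> i mod b = j mod b" by (metis div_mult_mod_eq)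
  then show "(1\<^sub>m a \<otimes>\<^sub>m 1\<^sub>m b) $$ (i, j) = 1\<^sub>m (a * b) $$ (i, j)"
    using ij div_mod_less_mult[OF ij(1)] div_mod_less_mult[OF ij(2)] by (auto simp: kron_index)
qed auto

lemma kron_one_left: "1\<^sub>m 1 \<otimes>\<^sub>m A = A"
proof (rule eq_matI)
  fix i j assume "i < dim_row A" "j < dim_col A"
  then show "(1\<^sub>m 1 \<otimes>\<^sub>m A) $$ (i, j) = A $$ (i, j)" by (simp add: kron_index)
qed auto

lemma kron_add_left:
  assumes "A \<in> carrier_mat n m" "B \<in> carrier_mat n m"
  shows "(A + B) \<otimes>\<^sub>m C = A \<otimes>\<^sub>m C + B \<otimes>\<^sub>m C"
  by (rule eq_matI) (use assms in \<open>auto simp: kron_index div_mod_less_mult algebra_simps\<close>)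

lemma kron_smult_left: "(c \<cdot>\<^sub>m A) \<otimes>\<^sub>m C = c \<cdot>\<^sub>m (A \<otimes>\<^sub>m C)"
  by (rule eq_matI) (auto simp: kron_index div_mod_less_mult)

lemma kron_zero_left: "0\<^sub>m n m \<otimes>\<^sub>m C = 0\<^sub>m (n * dim_row C) (m * dim_col C)"
  by (rule eq_matI) (auto simp: kron_index div_mod_less_mult)

lemma unitary_op_kron:
  assumes "unitary_op a U" "unitary_op b V"
  shows "unitary_op (a * b) (U \<otimes>\<^sub>m V)"
  using unitary_opD[OF assms(1)] unitary_opD[OF assms(2)]
  by (auto simp: unitary_op_def kron_adjoint kron_one kron_carrier
      kron_mult[OF mat_adjoint_carrier mat_adjoint_carrier] kron_mult[OF _ _ mat_adjoint_carrier mat_adjoint_carrier])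

section \<open>Basis kets and their projectors\<close>

lemma ket_carrier [simp]: "ket n i \<in> carrier_mat n 1"
  by (simp add: ket_def)

lemma dim_ket [simp]: "dim_row (ket n i) = n" "dim_col (ket n i) = 1"
  by (simp_all add: ket_def)

lemma ket_adjoint_mult:
  assumes "i < n" "j < n"
  shows "mat_adjoint (ket n i) * ket n j = (if i = j then 1\<^sub>m 1 else 0\<^sub>m 1 1)"
proof (rule eq_matI)
  fix r c assume "r < dim_row (if i = j then 1\<^sub>m 1 else 0\<^sub>m 1 1 :: complex mat)"
    "c < dim_col (if i = j then 1\<^sub>m 1 else 0\<^sub>m 1 1 :: complex mat)"
  then have [simp]: "r = 0" "c = 0" by (auto split: if_splits)
  have "(mat_adjoint (ket n i) * ket n j) $$ (0, 0) = (\<Sum>k<n. if k = i then (if i = j then 1 else 0) else 0)"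
  proof -
    have "(mat_adjoint (ket n i) * ket n j) $$ (0, 0) = (\<Sum>k<n. mat_adjoint (ket n i) $$ (0, k) * ket n j $$ (k, 0))"
      by (subst index_mult_sum) auto
    also have "\<dots> = (\<Sum>k<n. if k = i then (if i = j then 1 else 0) else 0)"
      by (rule sum.cong) (auto simp: ket_def)
    finally show ?thesis .
  qed
  then show "(mat_adjoint (ket n i) * ket n j) $$ (r, c) = (if i = j then 1\<^sub>m 1 else 0\<^sub>m 1 1) $$ (r, c)"
    using assms by simp
qed auto

lemma ketbra_eq: "ketbra n k = mat n n (\<lambda>(i, j). if i = k \<and> j = k then 1 else 0)"
  unfolding ketbra_def
  by (rule eq_matI) (auto simp: index_mult_sum ket_def simp del: index_mult_mat(1))

lemma ketbra_carrier [simp]: "ketbra n k \<in> carrier_mat n n"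
  by (simp add: ketbra_eq)

lemma ketbra_adjoint: "mat_adjoint (ketbra n k) = ketbra n k"
  unfolding ketbra_eq by (rule eq_matI) auto

lemma ketbra_mult: "k < n \<Longrightarrow> ketbra n j * ketbra n k = (if j = k then ketbra n k else 0\<^sub>m n n)"
  by (rule eq_matI)
    (auto simp: index_mult_sum ketbra_eq if_distrib[of "\<lambda>x. x * _"] simp del: index_mult_mat(1) cong: if_cong)

lemma ketbra_two_sum: "ketbra 2 0 + ketbra 2 1 = 1\<^sub>m 2"
  unfolding ketbra_eq by (rule eq_matI) auto

text \<open>The operator is block diagonal with blocks \<open>A\<close> and the identity; mixed
  products vanish because the two signal projectors are orthogonal.\<close>

lemma controlled_unitary:
  assumes A: "unitary_op n A"
  shows "unitary_op (2 * n) (ketbra 2 0 \<otimes>\<^sub>m A + ketbra 2 1 \<otimes>\<^sub>m 1\<^sub>m n)"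
    and "mat_adjoint A = A \<Longrightarrow> mat_adjoint (ketbra 2 0 \<otimes>\<^sub>m A + ketbra 2 1 \<otimes>\<^sub>m 1\<^sub>m n)
      = ketbra 2 0 \<otimes>\<^sub>m A + ketbra 2 1 \<otimes>\<^sub>m 1\<^sub>m n"
proof -
  have kc: "ketbra 2 k \<otimes>\<^sub>m B \<in> carrier_mat (2 * n) (2 * n)" if "B \<in> carrier_mat n n" for k B
    by (rule kron_carrier[OF ketbra_carrier that])
  have adj: "mat_adjoint (ketbra 2 0 \<otimes>\<^sub>m B + ketbra 2 1 \<otimes>\<^sub>m 1\<^sub>m n)
      = ketbra 2 0 \<otimes>\<^sub>m mat_adjoint B + ketbra 2 1 \<otimes>\<^sub>m 1\<^sub>m n" if "B \<in> carrier_mat n n" for B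
    using mat_adjoint_add[OF kc[OF that] kc[OF one_carrier_mat]] by (simp add: kron_adjoint ketbra_adjoint)
  \<comment> \<open>Formulated for any pair with \<open>B * C = 1\<^sub>m n\<close>, so that it
    covers the adjoint on either side.\<close>
  have mult: "(ketbra 2 0 \<otimes>\<^sub>m B + ketbra 2 1 \<otimes>\<^sub>m 1\<^sub>m n) * (ketbra 2 0 \<otimes>\<^sub>m C + ketbra 2 1 \<otimes>\<^sub>m 1\<^sub>m n)
      = 1\<^sub>m (2 * n)" if B: "B \<in> carrier_mat n n" and C: "C \<in> carrier_mat n n" and BC: "B * C = 1\<^sub>m n" for B C
  proof -
    let ?k = "ketbra 2"
    have km: "(?k i \<otimes>\<^sub>m X) * (?k j \<otimes>\<^sub>m Y) = (?k i * ?k j) \<otimes>\<^sub>m (X * Y)"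
      if "X \<in> carrier_mat n n" "Y \<in> carrier_mat n n" for X Y i j
      by (rule kron_mult[OF ketbra_carrier that(1) ketbra_carrier that(2)])
    have "(?k 0 \<otimes>\<^sub>m B + ?k 1 \<otimes>\<^sub>m 1\<^sub>m n) * (?k 0 \<otimes>\<^sub>m C + ?k 1 \<otimes>\<^sub>m 1\<^sub>m n)
        = ((?k 0 \<otimes>\<^sub>m B) * (?k 0 \<otimes>\<^sub>m C) + (?k 1 \<otimes>\<^sub>m 1\<^sub>m n) * (?k 0 \<otimes>\<^sub>m C))
          + ((?k 0 \<otimes>\<^sub>m B) * (?k 1 \<otimes>\<^sub>m 1\<^sub>m n) + (?k 1 \<otimes>\<^sub>m 1\<^sub>m n) * (?k 1 \<otimes>\<^sub>m 1\<^sub>m n))"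
      unfolding mult_add_distrib_mat[OF add_carrier_mat[OF kc[OF one_carrier_mat]] kc[OF C] kc[OF one_carrier_mat]]
      by (simp only: add_mult_distrib_mat[OF kc[OF B] kc[OF one_carrier_mat] kc[OF C]]
          add_mult_distrib_mat[OF kc[OF B] kc[OF one_carrier_mat] kc[OF one_carrier_mat]])
    also have "\<dots> = (?k 0 \<otimes>\<^sub>m 1\<^sub>m n + 0\<^sub>m (2 * n) (2 * n)) + (0\<^sub>m (2 * n) (2 * n) + ?k 1 \<otimes>\<^sub>m 1\<^sub>m n)"
      using B C by (simp add: km ketbra_mult BC kron_zero_left)
    also have "\<dots> = ?k 0 \<otimes>\<^sub>m 1\<^sub>m n + ?k 1 \<otimes>\<^sub>m 1\<^sub>m n"
      using kc[OF one_carrier_mat] by simp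
    also have "\<dots> = 1\<^sub>m (2 * n)"
      by (simp only: kron_add_left[OF ketbra_carrier ketbra_carrier, symmetric] ketbra_two_sum kron_one)
    finally show ?thesis .
  qed
  note Au = unitary_opD[OF A]
  show "unitary_op (2 * n) (ketbra 2 0 \<otimes>\<^sub>m A + ketbra 2 1 \<otimes>\<^sub>m 1\<^sub>m n)"
    unfolding unitary_op_def adj[OF Au(1)]
    using mult[OF mat_adjoint_carrier[OF Au(1)] Au(1,2)] mult[OF Au(1) mat_adjoint_carrier[OF Au(1)] Au(3)]
      kc[OF Au(1)] kc[OF one_carrier_mat] by simp
  show "mat_adjoint A = A \<Longrightarrow> mat_adjoint (ketbra 2 0 \<otimes>\<^sub>m A + ketbra 2 1 \<otimes>\<^sub>m 1\<^sub>m n)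
      = ketbra 2 0 \<otimes>\<^sub>m A + ketbra 2 1 \<otimes>\<^sub>m 1\<^sub>m n"
    using adj[OF Au(1)] by simp
qed

text \<open>Conditions that make every gate unitary of the right dimension. For \<open>CRefl\<close>
  the reference state \<open>ket N 0\<close> is a unit vector only when the state space is
  nonempty.\<close>

fun gate_ok :: "nat \<Rightarrow> (nat \<Rightarrow> complex mat) \<Rightarrow> gate \<Rightarrow> bool" where
  "gate_ok N Or (Signal V) \<longleftrightarrow> unitary_op 2 V"
| "gate_ok N Or (Oracle k) \<longleftrightarrow> unitary_op (N * N) (Or k)"
| "gate_ok N Or (OracleAdj k) \<longleftrightarrow> unitary_op (N * N) (Or k)"
| "gate_ok N Or CRefl \<longleftrightarrow> 0 < N"
| "gate_ok N Or CSwap \<longleftrightarrow> True"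

definition circuit_ok :: "nat \<Rightarrow> (nat \<Rightarrow> complex mat) \<Rightarrow> circuit \<Rightarrow> bool" where
  "circuit_ok N Or c \<longleftrightarrow> list_all (gate_ok N Or) c"

lemma ref_zero_reflection:
  assumes "0 < N"
  shows "unitary_op (N * N) (1\<^sub>m N \<otimes>\<^sub>m (2 \<cdot>\<^sub>m ketbra N 0 - 1\<^sub>m N))"
    and "mat_adjoint (1\<^sub>m N \<otimes>\<^sub>m (2 \<cdot>\<^sub>m ketbra N 0 - 1\<^sub>m N)) = 1\<^sub>m N \<otimes>\<^sub>m (2 \<cdot>\<^sub>m ketbra N 0 - 1\<^sub>m N)"
proof -
  have "mat_adjoint (ket N 0) * ket N 0 = 1\<^sub>m 1" using ket_adjoint_mult[of 0 N 0] assms by simp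
  note R = reflection_unitary[OF ket_carrier this, folded ketbra_def]
  show "unitary_op (N * N) (1\<^sub>m N \<otimes>\<^sub>m (2 \<cdot>\<^sub>m ketbra N 0 - 1\<^sub>m N))"
    by (rule unitary_op_kron[OF unitary_op_one R(1)])
  show "mat_adjoint (1\<^sub>m N \<otimes>\<^sub>m (2 \<cdot>\<^sub>m ketbra N 0 - 1\<^sub>m N)) = 1\<^sub>m N \<otimes>\<^sub>m (2 \<cdot>\<^sub>m ketbra N 0 - 1\<^sub>m N)"
    using R(2) by (simp add: kron_adjoint)
qed

lemma gate_op_unitary:
  assumes "gate_ok N Or g"
  shows "unitary_op (2 * (N * N)) (gate_op N Or g)"
  using assms
proof (cases g)
  case CRefl
  then show ?thesis using assms controlled_unitary(1)[OF ref_zero_reflection(1)] by simp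
next
  case CSwap
  then show ?thesis using controlled_unitary(1)[OF swap_op_unitary] by simp
qed (auto intro: unitary_op_kron unitary_op_one unitary_op_adjoint)

lemma gate_op_adj:
  assumes "gate_ok N Or g"
  shows "gate_op N Or (gate_adj g) = mat_adjoint (gate_op N Or g)"
  using assms
proof (cases g)
  case CRefl
  then show ?thesis
    using assms controlled_unitary(2)[OF ref_zero_reflection(1)] ref_zero_reflection(2) by simp
next
  case CSwap
  then show ?thesis using controlled_unitary(2)[OF swap_op_unitary swap_op_adjoint] by simp
qed (auto simp: kron_adjoint)

lemma gate_ok_adj: "gate_ok N Or g \<Longrightarrow> gate_ok N Or (gate_adj g)"
  by (cases g) (auto intro: unitary_op_adjoint)

section \<open>Composition and adjoints of circuits\<close>

lemma circuit_op_Nil [simp]: "circuit_op N Or [] = 1\<^sub>m (2 * (N * N))"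
  by (simp add: circuit_op_def)

text \<open>The left fold makes the last gate the leftmost factor, so inductions over circuits run
  from the end.\<close>

lemma circuit_op_snoc: "circuit_op N Or (c @ [g]) = gate_op N Or g * circuit_op N Or c"
  by (simp add: circuit_op_def)

lemma circuit_op_unitary:
  "circuit_ok N Or c \<Longrightarrow> unitary_op (2 * (N * N)) (circuit_op N Or c)"
  by (induction c rule: rev_induct)
    (auto simp: circuit_ok_def circuit_op_snoc intro: unitary_op_mult gate_op_unitary unitary_op_one)

lemma circuit_ok_append: "circuit_ok N Or (c @ d) \<longleftrightarrow> circuit_ok N Or c \<and> circuit_ok N Or d"
  by (simp add: circuit_ok_def)

lemma circuit_op_append:
  assumes "circuit_ok N Or c" "circuit_ok N Or d"
  shows "circuit_op N Or (c @ d) = circuit_op N Or d * circuit_op N Or c"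
  using assms(2)
proof (induction d rule: rev_induct)
  case Nil
  then show ?case using unitary_opD(1)[OF circuit_op_unitary[OF assms(1)]] by simp
next
  case (snoc g d)
  then have ok: "gate_ok N Or g" "circuit_ok N Or d" by (auto simp: circuit_ok_def)
  show ?case
    using snoc.IH[OF ok(2)] circuit_op_snoc[of N Or "c @ d" g] circuit_op_snoc[of N Or d g]
      assoc_mult_mat[OF unitary_opD(1)[OF gate_op_unitary[OF ok(1)]]
        unitary_opD(1)[OF circuit_op_unitary[OF ok(2)]] unitary_opD(1)[OF circuit_op_unitary[OF assms(1)]]]
    by simp
qed

lemma circuit_op_single: "gate_ok N Or g \<Longrightarrow> circuit_op N Or [g] = gate_op N Or g"
  using circuit_op_snoc[of N Or "[]" g] right_mult_one_mat[OF unitary_opD(1)[OF gate_op_unitary]] by simp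

lemma circuit_ok_adj: "circuit_ok N Or c \<Longrightarrow> circuit_ok N Or (circuit_adj c)"
  by (auto simp: circuit_ok_def circuit_adj_def list_all_iff gate_ok_adj)

lemma circuit_op_adj:
  assumes "circuit_ok N Or c"
  shows "circuit_op N Or (circuit_adj c) = mat_adjoint (circuit_op N Or c)"
  using assms
proof (induction c rule: rev_induct)
  case Nil
  then show ?case by (simp add: circuit_adj_def)
next
  case (snoc g c)
  then have ok: "gate_ok N Or g" "circuit_ok N Or c" by (auto simp: circuit_ok_def)
  have "circuit_adj (c @ [g]) = [gate_adj g] @ circuit_adj c" by (simp add: circuit_adj_def)
  moreover have "circuit_ok N Or [gate_adj g]" using ok by (simp add: circuit_ok_def gate_ok_adj)
  ultimately have "circuit_op N Or (circuit_adj (c @ [g]))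
      = mat_adjoint (circuit_op N Or c) * mat_adjoint (gate_op N Or g)"
    using circuit_op_append[of N Or "[gate_adj g]" "circuit_adj c"] snoc.IH[OF ok(2)]
      circuit_ok_adj[OF ok(2)] ok(1) by (simp add: circuit_op_single gate_ok_adj gate_op_adj)
  then show ?case
    using mat_adjoint_mult[OF unitary_opD(1)[OF gate_op_unitary[OF ok(1)]]
        unitary_opD(1)[OF circuit_op_unitary[OF ok(2)]]] by (simp add: circuit_op_snoc)
qed

lemma gqsp_circuit_ok:
  assumes "0 < N" "unitary_op (N * N) (Or k)" "\<forall>V\<in>set Vs. unitary_op 2 V"
  shows "circuit_ok N Or (gqsp_circuit k Vs)"
  using assms by (cases Vs) (auto simp: circuit_ok_def list_all_iff controlled_walk_def)


subsection \<open>Accuracy of the compiled selective phases\<close>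

text \<open>The isometry that adjoins the signal state \<open>s\<close> to a two-register vector. It
  replaces tensor equations by ordinary matrix products.\<close>

definition sig :: "nat \<Rightarrow> nat \<Rightarrow> complex mat" where
  "sig s n = ket 2 s \<otimes>\<^sub>m 1\<^sub>m n"

lemma sig_carrier [simp]: "sig s n \<in> carrier_mat (2 * n) n"
  unfolding sig_def by (rule carrier_matI) simp_all

lemma sig_adjoint_mult:
  assumes "s < 2" "t < 2"
  shows "mat_adjoint (sig s n) * sig t n = (if s = t then 1\<^sub>m n else 0\<^sub>m n n)"
proof -
  have "mat_adjoint (sig s n) * sig t n = (mat_adjoint (ket 2 s) * ket 2 t) \<otimes>\<^sub>m (1\<^sub>m n * 1\<^sub>m n)"
    unfolding sig_def kron_adjoint mat_adjoint_one
    by (rule kron_mult[OF mat_adjoint_carrier[OF ket_carrier] one_carrier_mat ket_carrier one_carrier_mat])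
  then show ?thesis
    using kron_zero_left[of 1 1 "1\<^sub>m n"] kron_one_left[of "1\<^sub>m n"] ket_adjoint_mult[OF assms]
    by (cases "s = t") simp_all
qed

lemma ketbra_kron_one: "ketbra 2 s \<otimes>\<^sub>m 1\<^sub>m n = sig s n * mat_adjoint (sig s n)"
  unfolding sig_def kron_adjoint mat_adjoint_one ketbra_def
  using kron_mult[OF ket_carrier one_carrier_mat mat_adjoint_carrier[OF ket_carrier] one_carrier_mat, of 2 s n 2 s]
  by simp

text \<open>Regard \<open>X\<close> as \<open>1\<^sub>m 1 \<otimes>\<^sub>m X\<close> and apply the
  mixed product rule.\<close>

lemma ket_kron:
  assumes "X \<in> carrier_mat n m"
  shows "ket 2 s \<otimes>\<^sub>m X = sig s n * X"
  unfolding sig_def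
  using kron_mult[OF ket_carrier one_carrier_mat one_carrier_mat assms, of 2 s] assms
  by (simp only: kron_one_left right_mult_one_mat[OF ket_carrier] left_mult_one_mat[OF assms])

section \<open>The initial embedding and the phase gate\<close>

lemma init_embed_carrier [simp]: "init_embed N \<in> carrier_mat (2 * (N * N)) N"
  unfolding init_embed_def by (rule carrier_matI) simp_all

lemma init_embed_isometry:
  assumes "0 < N"
  shows "mat_adjoint (init_embed N) * init_embed N = 1\<^sub>m N"
proof -
  have 1: "1\<^sub>m N \<otimes>\<^sub>m ket N 0 \<in> carrier_mat (N * N) N" by (rule carrier_matI) simp_all
  have "mat_adjoint (1\<^sub>m N \<otimes>\<^sub>m ket N 0) * (1\<^sub>m N \<otimes>\<^sub>m ket N 0)
      = (1\<^sub>m N * 1\<^sub>m N) \<otimes>\<^sub>m (mat_adjoint (ket N 0) * ket N 0)"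
    unfolding kron_adjoint mat_adjoint_one
    by (rule kron_mult[OF one_carrier_mat mat_adjoint_carrier[OF ket_carrier] one_carrier_mat ket_carrier])
  then have 2: "mat_adjoint (1\<^sub>m N \<otimes>\<^sub>m ket N 0) * (1\<^sub>m N \<otimes>\<^sub>m ket N 0) = 1\<^sub>m N"
    by (simp only: ket_adjoint_mult[OF assms assms] simp_thms if_True left_mult_one_mat[OF one_carrier_mat] kron_one mult_1_right)
  have "mat_adjoint (init_embed N) * init_embed N
      = (mat_adjoint (ket 2 0) * ket 2 0) \<otimes>\<^sub>m (mat_adjoint (1\<^sub>m N \<otimes>\<^sub>m ket N 0) * (1\<^sub>m N \<otimes>\<^sub>m ket N 0))"
    unfolding init_embed_def kron_adjoint[of "ket 2 0"]
    by (rule kron_mult[OF mat_adjoint_carrier[OF ket_carrier] mat_adjoint_carrier[OF 1] ket_carrier 1])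
  then show ?thesis
    unfolding 2 using ket_adjoint_mult[of 0 2 0] by (simp only: kron_one_left zero_less_numeral simp_thms if_True)
qed

lemma vnorm_init_embed: "0 < N \<Longrightarrow> v \<in> carrier_vec N \<Longrightarrow> vnorm (init_embed N *\<^sub>v v) = vnorm v"
  by (rule vnorm_isometry[OF init_embed_carrier init_embed_isometry])

lemma phase_gate_eq: "cis \<phi> \<cdot>\<^sub>m ketbra 2 0 + ketbra 2 1 = 1\<^sub>m 2 + (cis \<phi> - 1) \<cdot>\<^sub>m ketbra 2 0"
  unfolding ketbra_eq by (rule eq_matI) auto

lemma phase_gate_unitary: "unitary_op 2 (cis \<phi> \<cdot>\<^sub>m ketbra 2 0 + ketbra 2 1)"
proof -
  have D: "cis \<phi> \<cdot>\<^sub>m ketbra 2 0 + ketbra 2 1 = mat 2 2 (\<lambda>(i, j). if i = j then (if i = 0 then cis \<phi> else 1) else 0)"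
    unfolding ketbra_eq by (rule eq_matI) auto
  have "cis \<phi> * cnj (cis \<phi>) = 1" by (simp add: complex_norm_square[symmetric])
  then show ?thesis
    unfolding unitary_op_def D
    by (auto intro!: eq_matI simp: index_mult_sum numeral_2_eq_2 less_Suc_eq mult.commute simp del: index_mult_mat(1))
qed

text \<open>The phase gate is the identity plus \<open>cis \<phi> - 1\<close> times the projector on
  signal 0. This is the shape of an ideal selective phase, so the two can be compared term by
  term.\<close>

lemma phase_gate_vec:
  assumes z: "z \<in> carrier_vec (2 * n)"
  shows "((cis \<phi> \<cdot>\<^sub>m ketbra 2 0 + ketbra 2 1) \<otimes>\<^sub>m 1\<^sub>m n) *\<^sub>v z
    = z + (cis \<phi> - 1) \<cdot>\<^sub>v (sig 0 n *\<^sub>v (mat_adjoint (sig 0 n) *\<^sub>v z))"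
proof -
  have E: "sig 0 n * mat_adjoint (sig 0 n) \<in> carrier_mat (2 * n) (2 * n)"
    by (rule mult_carrier_mat[OF sig_carrier mat_adjoint_carrier[OF sig_carrier]])
  have "((cis \<phi> \<cdot>\<^sub>m ketbra 2 0 + ketbra 2 1) \<otimes>\<^sub>m 1\<^sub>m n)
      = 1\<^sub>m (2 * n) + (cis \<phi> - 1) \<cdot>\<^sub>m (sig 0 n * mat_adjoint (sig 0 n))"
    unfolding phase_gate_eq ketbra_kron_one[symmetric] kron_smult_left[symmetric] kron_one[symmetric]
    by (rule kron_add_left) auto
  also have "\<dots> *\<^sub>v z = z + (cis \<phi> - 1) \<cdot>\<^sub>v (sig 0 n * mat_adjoint (sig 0 n) *\<^sub>v z)"
    using z E by (simp add: add_mult_distrib_mat_vec[of _ "2 * n" "2 * n"] smult_mat_mult_vec[OF E z])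
  finally show ?thesis
    using assoc_mult_mat_vec[OF sig_carrier mat_adjoint_carrier[OF sig_carrier] z] by simp
qed

section \<open>Ideal selective phases\<close>

lemma selective_phase_vproj:
  assumes u: "u \<in> carrier_vec n" and v: "v \<in> carrier_vec n"
  shows "selective_phase \<phi> (vproj u) *\<^sub>v v = v + ((cis \<phi> - 1) * (v \<bullet>c u)) \<cdot>\<^sub>v u"
proof -
  have V: "vproj u \<in> carrier_mat n n" using u by (auto simp: vproj_def)
  have "vproj u *\<^sub>v v = (v \<bullet>c u) \<cdot>\<^sub>v u"
  proof (rule eq_vecI)
    fix i assume "i < dim_vec ((v \<bullet>c u) \<cdot>\<^sub>v u)"
    then show "(vproj u *\<^sub>v v) $ i = ((v \<bullet>c u) \<cdot>\<^sub>v u) $ i"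
      using u v by (subst index_mult_mat_vec_sum)
        (auto simp: vproj_def cscalar_prod_sum sum_distrib_left sum_distrib_right mult_ac)
  qed (use u V in auto)
  then show ?thesis
    unfolding selective_phase_def using V v
    by (simp add: add_mult_distrib_mat_vec[of _ n n] smult_mat_mult_vec[OF V v] smult_smult_assoc)
qed

lemma selective_phase_carrier:
  "u \<in> carrier_vec n \<Longrightarrow> selective_phase \<phi> (vproj u) \<in> carrier_mat n n"
  by (auto simp: selective_phase_def vproj_def)

lemma vnorm_selective_phase:
  assumes u: "u \<in> carrier_vec n" "vnorm u = 1" and v: "v \<in> carrier_vec n"
  shows "vnorm (selective_phase \<phi> (vproj u) *\<^sub>v v) = vnorm v"
proof -
  define s where "s = v \<bullet>c u"
  \<comment> \<open>In this form \<open>vnorm_diff_smult_sq\<close> applies: the coefficient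
    \<open>s\<close> is replaced by \<open>cis \<phi> * s\<close>, which has the same
    modulus.\<close>
  have "selective_phase \<phi> (vproj u) *\<^sub>v v = v - (s - cis \<phi> * s) \<cdot>\<^sub>v u"
    unfolding selective_phase_vproj[OF u(1) v] s_def[symmetric]
    using u v by (intro eq_vecI) (auto simp: algebra_simps)
  then have "(vnorm (selective_phase \<phi> (vproj u) *\<^sub>v v))\<^sup>2 = (vnorm v)\<^sup>2"
    using vnorm_diff_smult_sq[of v u "s - cis \<phi> * s"] u v by (simp add: s_def norm_mult)
  then show ?thesis by simp
qed

lemma circuit_vec_append:
  assumes "circuit_ok N Or c" "circuit_ok N Or d" "x \<in> carrier_vec (2 * (N * N))"
  shows "circuit_op N Or (c @ d) *\<^sub>v x = circuit_op N Or d *\<^sub>v (circuit_op N Or c *\<^sub>v x)"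
  using assoc_mult_mat_vec[OF unitary_opD(1)[OF circuit_op_unitary] unitary_opD(1)[OF circuit_op_unitary]]
    circuit_op_append assms by metis

lemma compiled_phase_ok:
  assumes "0 < N" "unitary_op (N * N) (Or k)" "\<forall>V\<in>set Vs. unitary_op 2 V"
  shows "circuit_ok N Or (compiled_phase k Vs \<phi>)"
proof -
  have "circuit_ok N Or [Signal (cis \<phi> \<cdot>\<^sub>m ketbra 2 0 + ketbra 2 1)]"
    unfolding circuit_ok_def using phase_gate_unitary by simp
  moreover have "circuit_ok N Or [Oracle k]" "circuit_ok N Or [OracleAdj k]"
    using assms by (simp_all add: circuit_ok_def)
  ultimately show ?thesis
    using gqsp_circuit_ok[of N Or k Vs, OF assms] circuit_ok_adj[OF gqsp_circuit_ok[of N Or k Vs, OF assms]]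
    unfolding compiled_phase_def circuit_ok_def by simp
qed

lemma compiled_phase_vec:
  assumes "0 < N" "unitary_op (N * N) (Or k)" "\<forall>V\<in>set Vs. unitary_op 2 V"
    and x: "x \<in> carrier_vec (2 * (N * N))"
  defines "W \<equiv> 1\<^sub>m 2 \<otimes>\<^sub>m Or k" and "C \<equiv> circuit_op N Or (gqsp_circuit k Vs)"
  shows "circuit_op N Or (compiled_phase k Vs \<phi>) *\<^sub>v x
    = mat_adjoint W *\<^sub>v (mat_adjoint C *\<^sub>v
        (((cis \<phi> \<cdot>\<^sub>m ketbra 2 0 + ketbra 2 1) \<otimes>\<^sub>m 1\<^sub>m (N * N)) *\<^sub>v (C *\<^sub>v (W *\<^sub>v x))))"
proof -
  let ?g = "gqsp_circuit k Vs" and ?S = "Signal (cis \<phi> \<cdot>\<^sub>m ketbra 2 0 + ketbra 2 1)"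
  have ok: "circuit_ok N Or ?g" by (rule gqsp_circuit_ok[of N Or k Vs, OF assms(1-3)])
  note ok' = circuit_ok_adj[OF ok]
  have S: "gate_ok N Or ?S" "circuit_ok N Or [?S]"
    unfolding circuit_ok_def using phase_gate_unitary by simp_all
  have O: "gate_ok N Or (Oracle k)" "gate_ok N Or (OracleAdj k)" "circuit_ok N Or [Oracle k]" "circuit_ok N Or [OracleAdj k]"
    using assms by (simp_all add: circuit_ok_def)
  have car: "circuit_op N Or c *\<^sub>v y \<in> carrier_vec (2 * (N * N))"
    if "circuit_ok N Or c" "y \<in> carrier_vec (2 * (N * N))" for c y
    by (rule mult_mat_vec_carrier[OF unitary_opD(1)[OF circuit_op_unitary[OF that(1)]] that(2)])
  have eq: "compiled_phase k Vs \<phi> = [Oracle k] @ ?g @ [?S] @ circuit_adj ?g @ [OracleAdj k]"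
    by (simp add: compiled_phase_def)
  have adjW: "mat_adjoint W = 1\<^sub>m 2 \<otimes>\<^sub>m mat_adjoint (Or k)" by (simp add: W_def kron_adjoint)
  have "circuit_op N Or (compiled_phase k Vs \<phi>) *\<^sub>v x
    = circuit_op N Or [OracleAdj k] *\<^sub>v (circuit_op N Or (circuit_adj ?g) *\<^sub>v
        (circuit_op N Or [?S] *\<^sub>v (circuit_op N Or ?g *\<^sub>v (circuit_op N Or [Oracle k] *\<^sub>v x))))"
    unfolding eq using S O ok ok' x
    by (simp only: circuit_vec_append circuit_ok_append car simp_thms)
  then show ?thesis
    by (simp only: circuit_op_single[OF S(1)] circuit_op_single[OF O(1)] circuit_op_single[OF O(2)]
        circuit_op_adj[OF ok] gate_op.simps W_def[symmetric] C_def[symmetric] adjW[symmetric])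
qed

lemma cmod_cis_minus_one_le: "cmod (cis \<phi> - 1) \<le> 2"
  using norm_triangle_ineq4[of "cis \<phi>" 1] by simp

text \<open>Both phases send the embedded \<open>v\<close> to \<open>J v\<close> plus a correction,
  \<open>c L v\<close> for the compiled one and \<open>c s J q\<close> for the ideal one, with
  \<open>c = cis \<phi> - 1\<close> and \<open>s\<close> the overlap of \<open>v\<close> with
  \<open>q\<close>. Since \<open>L q = J q\<close>, the error is \<open>c\<close> times
  \<open>L\<close> on the part of \<open>v\<close> orthogonal to \<open>q\<close>, where the
  polynomial has size \<open>\<eta>\<close>.\<close>

lemma compiled_phase_error:
  assumes chain: "reversible_ergodic_chain N (P k) \<mu>" and orc: "is_oracle N (P k) (Or k)"
    and pc: "projector_circuit N P Or k \<eta> Vs" and \<eta>: "0 \<le> \<eta>" and v: "v \<in> carrier_vec N"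
  shows "vnorm (circuit_op N Or (compiled_phase k Vs \<phi>) *\<^sub>v (init_embed N *\<^sub>v v)
    - init_embed N *\<^sub>v (selective_phase \<phi> (vproj (qsample N \<mu>)) *\<^sub>v v)) \<le> 2 * \<eta> * vnorm v"
proof -
  interpret reversible_chain N "P k" \<mu> by standard (rule chain)
  define n where "n = N * N"
  define E where "E = sig 0 n"
  define E1 where "E1 = sig 1 n"
  define C where "C = circuit_op N Or (gqsp_circuit k Vs)"
  define W where "W = 1\<^sub>m 2 \<otimes>\<^sub>m Or k"
  define J where "J = init_embed N"
  define c where "c = cis \<phi> - 1"
  define s where "s = v \<bullet>c q"
  have N: "0 < N" using mu_sum by (cases N) auto
  have U: "unitary_op n (Or k)" and OT: "Or k * (1\<^sub>m N \<otimes>\<^sub>m ket N 0) = T"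
    using orc by (auto simp: is_oracle_def n_def)
  obtain Y F where Vs: "\<forall>V\<in>set Vs. unitary_op 2 V"
    and CE': "C * (ket 2 0 \<otimes>\<^sub>m 1\<^sub>m n) = ket 2 0 \<otimes>\<^sub>m mat_poly Y (walk N (P k)) + ket 2 1 \<otimes>\<^sub>m mat_poly F (walk N (P k))"
    and Y1: "poly Y 1 = 1" and Yb: "\<And>z. z \<in> spectrum (walk N (P k)) \<Longrightarrow> z \<noteq> 1 \<Longrightarrow> cmod (poly Y z) \<le> \<eta>"
    and YF: "mat_adjoint (mat_poly Y (walk N (P k))) * mat_poly Y (walk N (P k))
      + mat_adjoint (mat_poly F (walk N (P k))) * mat_poly F (walk N (P k)) = 1\<^sub>m n"
    using pc unfolding projector_circuit_def C_def n_def by blast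
  define A where "A = mat_poly Y (walk N (P k))"
  define B where "B = mat_poly F (walk N (P k))"
  have Ac: "A \<in> carrier_mat n n" and Bc: "B \<in> carrier_mat n n"
    unfolding A_def B_def n_def by (rule mat_poly_carrier[OF walk_carrier])+
  have Tc: "T \<in> carrier_mat n N" by (simp add: n_def)
  have Ec: "E \<in> carrier_mat (2 * n) n" and E1c: "E1 \<in> carrier_mat (2 * n) n" by (simp_all add: E_def E1_def)
  have Jc: "J \<in> carrier_mat (2 * n) N" by (simp add: J_def n_def)
  have Wu: "unitary_op (2 * n) W" unfolding W_def by (rule unitary_op_kron[OF unitary_op_one U])
  have Cu: "unitary_op (2 * n) C"
    unfolding C_def n_def using U Vs N by (intro circuit_op_unitary gqsp_circuit_ok) (auto simp: n_def)
  note Wc = unitary_opD(1)[OF Wu] and Cc = unitary_opD(1)[OF Cu]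
  note Wc' = mat_adjoint_carrier[OF Wc] and Cc' = mat_adjoint_carrier[OF Cc] and Ec' = mat_adjoint_carrier[OF Ec]
  have EE: "mat_adjoint E * E = 1\<^sub>m n" and EE1: "mat_adjoint E * E1 = 0\<^sub>m n n"
    unfolding E_def E1_def by (simp_all add: sig_adjoint_mult del: One_nat_def)
  have CE: "C * E = E * A + E1 * B"
    using CE' unfolding A_def[symmetric] B_def[symmetric] ket_kron[OF Ac] ket_kron[OF Bc]
    by (simp add: E_def E1_def sig_def)
  \<comment> \<open>On the reference state of \<open>B\<close> the oracle acts as the step isometry,
    so it carries embedded states into signal 0 tensor the range of \<open>T\<close>.\<close>
  have "W * J = (1\<^sub>m 2 * ket 2 0) \<otimes>\<^sub>m (Or k * (1\<^sub>m N \<otimes>\<^sub>m ket N 0))"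
    unfolding W_def J_def init_embed_def
  proof (rule kron_mult[OF one_carrier_mat unitary_opD(1)[OF U] ket_carrier])
    show "1\<^sub>m N \<otimes>\<^sub>m ket N 0 \<in> carrier_mat n N" by (rule carrier_matI) (simp_all add: n_def)
  qed
  then have WJ: "W * J = E * T"
    unfolding OT by (simp only: left_mult_one_mat[OF ket_carrier] ket_kron[OF Tc] E_def)
  have vc: "M *\<^sub>v x \<in> carrier_vec a" if "M \<in> carrier_mat a b" "x \<in> carrier_vec b" for M :: "complex mat" and a b x
    using that by (rule mult_mat_vec_carrier)
  have WJv: "W *\<^sub>v (J *\<^sub>v x) = E *\<^sub>v (T *\<^sub>v x)" if "x \<in> carrier_vec N" for x
    using assoc_mult_mat_vec[OF Wc Jc that] assoc_mult_mat_vec[OF Ec Tc that] WJ by simp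
  have WEJ: "mat_adjoint W *\<^sub>v (E *\<^sub>v (T *\<^sub>v x)) = J *\<^sub>v x" if "x \<in> carrier_vec N" for x
    using isometry_adjoint_mult_vec[OF Wc unitary_opD(2)[OF Wu] vc[OF Jc that]] WJv[OF that] by simp
  have CEv: "C *\<^sub>v (E *\<^sub>v w) = E *\<^sub>v (A *\<^sub>v w) + E1 *\<^sub>v (B *\<^sub>v w)" if w: "w \<in> carrier_vec n" for w
  proof -
    have "C *\<^sub>v (E *\<^sub>v w) = (E * A + E1 * B) *\<^sub>v w"
      unfolding CE[symmetric] by (rule assoc_mult_mat_vec[OF Cc Ec w, symmetric])
    also have "\<dots> = (E * A) *\<^sub>v w + (E1 * B) *\<^sub>v w"
      by (rule add_mult_distrib_mat_vec[OF mult_carrier_mat[OF Ec Ac] mult_carrier_mat[OF E1c Bc] w])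
    finally show ?thesis
      unfolding assoc_mult_mat_vec[OF Ec Ac w] assoc_mult_mat_vec[OF E1c Bc w] .
  qed
  have ECEv: "mat_adjoint E *\<^sub>v (C *\<^sub>v (E *\<^sub>v w)) = A *\<^sub>v w" if w: "w \<in> carrier_vec n" for w
  proof -
    have Aw: "A *\<^sub>v w \<in> carrier_vec n" and Bw: "B *\<^sub>v w \<in> carrier_vec n" using vc[OF Ac w] vc[OF Bc w] .
    have "mat_adjoint E *\<^sub>v (C *\<^sub>v (E *\<^sub>v w))
        = mat_adjoint E *\<^sub>v (E *\<^sub>v (A *\<^sub>v w)) + mat_adjoint E *\<^sub>v (E1 *\<^sub>v (B *\<^sub>v w))"
      unfolding CEv[OF w] by (rule mult_add_distrib_mat_vec[OF Ec' vc[OF Ec Aw] vc[OF E1c Bw]])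
    also have "mat_adjoint E *\<^sub>v (E *\<^sub>v (A *\<^sub>v w)) = A *\<^sub>v w"
      by (rule isometry_adjoint_mult_vec[OF Ec EE Aw])
    also have "mat_adjoint E *\<^sub>v (E1 *\<^sub>v (B *\<^sub>v w)) = 0\<^sub>m n n *\<^sub>v (B *\<^sub>v w)"
      unfolding EE1[symmetric] by (rule assoc_mult_mat_vec[OF Ec' E1c Bw, symmetric])
    also have "\<dots> = 0\<^sub>v n" using Bw by (intro eq_vecI) auto
    finally show ?thesis using Aw by simp
  qed
  \<comment> \<open>The operator left over between the oracles once
    \<open>C\<^sup>\<dagger> C\<close> has cancelled in the identity part of the phase gate.\<close>
  define L where "L = mat_adjoint W * (mat_adjoint C * (E * (A * T)))"
  have AT: "A * T \<in> carrier_mat n N" using Ac Tc by simp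
  have EAT: "E * (A * T) \<in> carrier_mat (2 * n) N" by (rule mult_carrier_mat[OF Ec AT])
  have CEAT: "mat_adjoint C * (E * (A * T)) \<in> carrier_mat (2 * n) N" by (rule mult_carrier_mat[OF Cc' EAT])
  have Lc: "L \<in> carrier_mat (2 * n) N" unfolding L_def by (rule mult_carrier_mat[OF Wc' CEAT])
  have Lv: "L *\<^sub>v x = mat_adjoint W *\<^sub>v (mat_adjoint C *\<^sub>v (E *\<^sub>v (A *\<^sub>v (T *\<^sub>v x))))"
    if x: "x \<in> carrier_vec N" for x
    unfolding L_def assoc_mult_mat_vec[OF Wc' CEAT x] assoc_mult_mat_vec[OF Cc' EAT x]
      assoc_mult_mat_vec[OF Ec AT x] assoc_mult_mat_vec[OF Ac Tc x] ..
  have Lnorm: "vnorm (L *\<^sub>v x) = vnorm (A *\<^sub>v (T *\<^sub>v x))" if x: "x \<in> carrier_vec N" for x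
  proof -
    have ATx: "A *\<^sub>v (T *\<^sub>v x) \<in> carrier_vec n" by (rule vc[OF Ac vc[OF Tc x]])
    show ?thesis unfolding Lv[OF x]
      using vnorm_unitary[OF unitary_op_adjoint[OF Wu] vc[OF Cc' vc[OF Ec ATx]]]
        vnorm_unitary[OF unitary_op_adjoint[OF Cu] vc[OF Ec ATx]] vnorm_isometry[OF Ec EE ATx] by simp
  qed
  have Tq: "T *\<^sub>v q \<in> carrier_vec n" by (rule vc[OF Tc q_carrier])
  \<comment> \<open>\<open>T q\<close> is a fixed vector of the walk, so \<open>Y\<close> acts on it
    as its value at 1.\<close>
  have ATq: "A *\<^sub>v (T *\<^sub>v q) = T *\<^sub>v q"
    using mat_poly_eigen[OF walk_carrier _, of "T *\<^sub>v q" N "P k" 1 Y] walk_Tq Tq Y1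
    by (simp add: A_def n_def)
  \<comment> \<open>The normalization of \<open>Y\<close> and \<open>F\<close> splits the squared
    norm of \<open>T q\<close>. As \<open>A\<close> already accounts for all of it, \<open>B\<close>
    annihilates \<open>T q\<close>; hence \<open>C\<close> fixes \<open>E T q\<close>, and its
    adjoint does too.\<close>
  have "complex_of_real ((vnorm (A *\<^sub>v (T *\<^sub>v q)))\<^sup>2 + (vnorm (B *\<^sub>v (T *\<^sub>v q)))\<^sup>2)
      = complex_of_real ((vnorm (T *\<^sub>v q))\<^sup>2)"
  proof -
    let ?w = "T *\<^sub>v q"
    note Ac' = mat_adjoint_carrier[OF Ac] and Bc' = mat_adjoint_carrier[OF Bc]
    note wA = vc[OF Ac Tq] and wB = vc[OF Bc Tq]
    have "mat_adjoint A *\<^sub>v (A *\<^sub>v ?w) + mat_adjoint B *\<^sub>v (B *\<^sub>v ?w) = (mat_adjoint A * A + mat_adjoint B * B) *\<^sub>v ?w"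
      using add_mult_distrib_mat_vec[OF mult_carrier_mat[OF Ac' Ac] mult_carrier_mat[OF Bc' Bc] Tq]
        assoc_mult_mat_vec[OF Ac' Ac Tq] assoc_mult_mat_vec[OF Bc' Bc Tq] by simp
    also have "\<dots> = ?w" using YF Tq unfolding A_def B_def by simp
    finally have eq: "mat_adjoint A *\<^sub>v (A *\<^sub>v ?w) + mat_adjoint B *\<^sub>v (B *\<^sub>v ?w) = ?w" .
    have "?w \<bullet>c ?w = (mat_adjoint A *\<^sub>v (A *\<^sub>v ?w)) \<bullet>c ?w + (mat_adjoint B *\<^sub>v (B *\<^sub>v ?w)) \<bullet>c ?w"
      using add_scalar_prod_distrib[OF vc[OF Ac' wA] vc[OF Bc' wB] carrier_vec_conjugate[OF Tq]]
      unfolding eq .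
    then show ?thesis
      unfolding cscalar_prod_adjoint[OF Ac' wA Tq] cscalar_prod_adjoint[OF Bc' wB Tq]
      by (simp add: cscalar_prod_self)
  qed
  then have "(vnorm (B *\<^sub>v (T *\<^sub>v q)))\<^sup>2 = 0" unfolding of_real_eq_iff ATq by simp
  then have BTq: "B *\<^sub>v (T *\<^sub>v q) = 0\<^sub>v n" using vnorm_zero_iff[OF vc[OF Bc Tq]] by simp
  have "E1 *\<^sub>v 0\<^sub>v n = 0\<^sub>v (2 * n)" using E1c by (intro eq_vecI) auto
  then have CETq: "C *\<^sub>v (E *\<^sub>v (T *\<^sub>v q)) = E *\<^sub>v (T *\<^sub>v q)"
    unfolding CEv[OF Tq] ATq BTq using vc[OF Ec Tq] by simp
  have Lq: "L *\<^sub>v q = J *\<^sub>v q"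
  proof -
    have "L *\<^sub>v q = mat_adjoint W *\<^sub>v (mat_adjoint C *\<^sub>v (C *\<^sub>v (E *\<^sub>v (T *\<^sub>v q))))"
      unfolding Lv[OF q_carrier] ATq CETq ..
    also have "\<dots> = J *\<^sub>v q"
      unfolding isometry_adjoint_mult_vec[OF Cc unitary_opD(2)[OF Cu] vc[OF Ec Tq]]
      by (rule WEJ[OF q_carrier])
    finally show ?thesis .
  qed
  have Jv: "J *\<^sub>v v \<in> carrier_vec (2 * n)" and Lvc: "L *\<^sub>v v \<in> carrier_vec (2 * n)"
    and Jq: "J *\<^sub>v q \<in> carrier_vec (2 * n)" using vc[OF Jc v] vc[OF Lc v] vc[OF Jc q_carrier] .
  have Tv: "T *\<^sub>v v \<in> carrier_vec n" by (rule vc[OF Tc v])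
  have ATv: "A *\<^sub>v (T *\<^sub>v v) \<in> carrier_vec n" by (rule vc[OF Ac Tv])
  have ETv: "E *\<^sub>v (T *\<^sub>v v) \<in> carrier_vec (2 * n)" by (rule vc[OF Ec Tv])
  have EATv: "E *\<^sub>v (A *\<^sub>v (T *\<^sub>v v)) \<in> carrier_vec (2 * n)" by (rule vc[OF Ec ATv])
  have cEATv: "c \<cdot>\<^sub>v (E *\<^sub>v (A *\<^sub>v (T *\<^sub>v v))) \<in> carrier_vec (2 * n)" using EATv by simp
  note CEATv = vc[OF Cc' EATv]
  have cCEATv: "c \<cdot>\<^sub>v (mat_adjoint C *\<^sub>v (E *\<^sub>v (A *\<^sub>v (T *\<^sub>v v)))) \<in> carrier_vec (2 * n)" using CEATv by simp
  have "circuit_op N Or (compiled_phase k Vs \<phi>) *\<^sub>v (J *\<^sub>v v)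
      = mat_adjoint W *\<^sub>v (mat_adjoint C *\<^sub>v
        (((cis \<phi> \<cdot>\<^sub>m ketbra 2 0 + ketbra 2 1) \<otimes>\<^sub>m 1\<^sub>m n) *\<^sub>v (C *\<^sub>v (W *\<^sub>v (J *\<^sub>v v)))))"
    using compiled_phase_vec[of N Or k Vs _ \<phi>, OF N U[unfolded n_def] Vs Jv[unfolded n_def]]
    by (simp only: n_def W_def C_def)
  \<comment> \<open>After the projection on signal 0 only \<open>A\<close> survives from the
    circuit, so the correction contains a single factor \<open>A\<close> and the error is linear in
    \<open>\<eta>\<close>.\<close>
  also have "\<dots> = mat_adjoint W *\<^sub>v (mat_adjoint C *\<^sub>v
      (C *\<^sub>v (E *\<^sub>v (T *\<^sub>v v)) + c \<cdot>\<^sub>v (E *\<^sub>v (A *\<^sub>v (T *\<^sub>v v)))))"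
    unfolding WJv[OF v] phase_gate_vec[OF vc[OF Cc ETv]] c_def[symmetric] E_def[symmetric] ECEv[OF Tv] ..
  also have "\<dots> = mat_adjoint W *\<^sub>v (E *\<^sub>v (T *\<^sub>v v) + c \<cdot>\<^sub>v (mat_adjoint C *\<^sub>v (E *\<^sub>v (A *\<^sub>v (T *\<^sub>v v)))))"
    unfolding mult_add_distrib_mat_vec[OF Cc' vc[OF Cc ETv] cEATv]
      isometry_adjoint_mult_vec[OF Cc unitary_opD(2)[OF Cu] ETv] mult_mat_vec[OF Cc' EATv] ..
  also have "\<dots> = J *\<^sub>v v + c \<cdot>\<^sub>v (L *\<^sub>v v)"
    unfolding mult_add_distrib_mat_vec[OF Wc' ETv cCEATv] mult_mat_vec[OF Wc' CEATv] WEJ[OF v] Lv[OF v] ..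
  finally have lhs: "circuit_op N Or (compiled_phase k Vs \<phi>) *\<^sub>v (J *\<^sub>v v) = J *\<^sub>v v + c \<cdot>\<^sub>v (L *\<^sub>v v)" .
  have csq: "(c * s) \<cdot>\<^sub>v q \<in> carrier_vec N" by simp
  have rhs: "J *\<^sub>v (selective_phase \<phi> (vproj q) *\<^sub>v v) = J *\<^sub>v v + (c * s) \<cdot>\<^sub>v (J *\<^sub>v q)"
    unfolding selective_phase_vproj[OF q_carrier v] c_def[symmetric] s_def[symmetric]
      mult_add_distrib_mat_vec[OF Jc v csq] mult_mat_vec[OF Jc q_carrier] ..
  \<comment> \<open>The component of \<open>v\<close> orthogonal to \<open>q\<close>, on which the
    ideal phase acts trivially.\<close>
  define v1 where "v1 = v - s \<cdot>\<^sub>v q"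
  have sq: "s \<cdot>\<^sub>v q \<in> carrier_vec N" by simp
  have v1: "v1 \<in> carrier_vec N" using v by (simp add: v1_def)
  have Lv1: "L *\<^sub>v v1 = L *\<^sub>v v - s \<cdot>\<^sub>v (J *\<^sub>v q)"
    unfolding v1_def mult_minus_distrib_mat_vec[OF Lc v sq] mult_mat_vec[OF Lc q_carrier] Lq ..
  have diff: "(J *\<^sub>v v + c \<cdot>\<^sub>v (L *\<^sub>v v)) - (J *\<^sub>v v + (c * s) \<cdot>\<^sub>v (J *\<^sub>v q)) = c \<cdot>\<^sub>v (L *\<^sub>v v1)"
  proof -
    have "(a + c \<cdot>\<^sub>v b) - (a + (c * s) \<cdot>\<^sub>v d) = c \<cdot>\<^sub>v (b - s \<cdot>\<^sub>v d)"
      if "a \<in> carrier_vec m" "b \<in> carrier_vec m" "d \<in> carrier_vec m" for a b d :: "complex vec" and m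
      using that by (intro eq_vecI) (auto simp: algebra_simps)
    from this[OF Jv Lvc Jq] show ?thesis unfolding Lv1 .
  qed
  have v1q: "v1 \<bullet>c q = 0"
    unfolding v1_def using v carrier_vecD[OF q_carrier]
    by (simp add: cscalar_prod_diff_left cscalar_prod_smult_left cscalar_prod_self vnorm_q s_def)
  have v1n: "vnorm v1 \<le> vnorm v"
  proof (rule power2_le_imp_le)
    show "(vnorm v1)\<^sup>2 \<le> (vnorm v)\<^sup>2"
      unfolding v1_def using vnorm_diff_smult_sq[of v q s] v vnorm_q by (simp add: s_def)
  qed simp
  have "vnorm (L *\<^sub>v v1) \<le> \<eta> * vnorm v1"
    unfolding Lnorm[OF v1] A_def by (rule vnorm_walk_poly_le[OF v1 v1q Yb \<eta>])
  also have "\<dots> \<le> \<eta> * vnorm v" using v1n \<eta> by (rule mult_left_mono)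
  finally have "cmod c * vnorm (L *\<^sub>v v1) \<le> 2 * (\<eta> * vnorm v)"
    unfolding c_def by (intro mult_mono cmod_cis_minus_one_le) auto
  then show ?thesis
    unfolding J_def[symmetric] lhs rhs diff by (simp add: vnorm_smult mult_ac)
qed


subsection \<open>Accuracy of the algorithm\<close>

lemma fpaa_op_Nil [simp]: "fpaa_op u v [] = 1\<^sub>m (dim_vec u)"
  by (simp add: fpaa_op_def)

section \<open>Ideal fixed-point amplification\<close>

lemma fpaa_op_Cons: "fpaa_op u v ((\<alpha>, \<beta>) # s)
    = selective_phase \<beta> (vproj v) * selective_phase \<alpha> (vproj u) * fpaa_op u v s"
  by (simp add: fpaa_op_def)

lemma fpaa_op_carrier:
  assumes "u \<in> carrier_vec n" "v \<in> carrier_vec n"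
  shows "fpaa_op u v s \<in> carrier_mat n n"
proof (induction s)
  case (Cons x s)
  then show ?case
    by (cases x) (simp only: fpaa_op_Cons, intro mult_carrier_mat[of _ n n _ n] selective_phase_carrier assms)
qed (use assms in simp)

lemma fpaa_op_Cons_vec:
  assumes "u \<in> carrier_vec n" "v \<in> carrier_vec n" "x \<in> carrier_vec n"
  shows "fpaa_op u v ((\<alpha>, \<beta>) # s) *\<^sub>v x
    = selective_phase \<beta> (vproj v) *\<^sub>v (selective_phase \<alpha> (vproj u) *\<^sub>v (fpaa_op u v s *\<^sub>v x))"
proof -
  note S = selective_phase_carrier[OF assms(2), of \<beta>] selective_phase_carrier[OF assms(1), of \<alpha>]
  note F = fpaa_op_carrier[OF assms(1,2), of s]
  show ?thesis
    unfolding fpaa_op_Cons assoc_mult_mat_vec[OF mult_carrier_mat[OF S] F assms(3)]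
      assoc_mult_mat_vec[OF S mult_mat_vec_carrier[OF F assms(3)]] ..
qed

lemma vnorm_fpaa_op:
  assumes "u \<in> carrier_vec n" "vnorm u = 1" "v \<in> carrier_vec n" "vnorm v = 1" "x \<in> carrier_vec n"
  shows "vnorm (fpaa_op u v s *\<^sub>v x) = vnorm x"
proof (induction s)
  case (Cons a s)
  note F = mult_mat_vec_carrier[OF fpaa_op_carrier[OF assms(1,3), of s] assms(5)]
  obtain \<alpha> \<beta> where a: "a = (\<alpha>, \<beta>)" by (cases a)
  show ?case
    unfolding a fpaa_op_Cons_vec[OF assms(1,3,5)]
    using vnorm_selective_phase[OF assms(3,4) mult_mat_vec_carrier[OF selective_phase_carrier[OF assms(1)] F]]
      vnorm_selective_phase[OF assms(1,2) F] Cons by simp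
qed (use assms in simp)

section \<open>Circuits acting on vectors\<close>

lemma circuit_vec_carrier:
  "circuit_ok N Or c \<Longrightarrow> y \<in> carrier_vec (2 * (N * N)) \<Longrightarrow> circuit_op N Or c *\<^sub>v y \<in> carrier_vec (2 * (N * N))"
  by (rule mult_mat_vec_carrier[OF unitary_opD(1)[OF circuit_op_unitary]])

lemma vnorm_circuit:
  "circuit_ok N Or c \<Longrightarrow> y \<in> carrier_vec (2 * (N * N)) \<Longrightarrow> vnorm (circuit_op N Or c *\<^sub>v y) = vnorm y"
  by (rule vnorm_unitary[OF circuit_op_unitary])

lemma vnorm_circuit_diff:
  assumes c: "circuit_ok N Or c" and x: "x \<in> carrier_vec (2 * (N * N))" and y: "y \<in> carrier_vec (2 * (N * N))"
  shows "vnorm (circuit_op N Or c *\<^sub>v x - circuit_op N Or c *\<^sub>v y) = vnorm (x - y)"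
  using mult_minus_distrib_mat_vec[OF unitary_opD(1)[OF circuit_op_unitary[OF c]] x y]
    vnorm_circuit[OF c minus_carrier_vec[OF x y]] by simp

text \<open>The head of a schedule is applied last, as in \<open>fpaa_op_Cons\<close>; this lets
  circuit and ideal operator be compared by induction on the schedule.\<close>

lemma stage_circuit_Cons:
  "stage_circuit i Vs Vs' ((\<alpha>, \<beta>) # s)
    = stage_circuit i Vs Vs' s @ compiled_phase i Vs \<alpha> @ compiled_phase (Suc i) Vs' \<beta>"
  by (simp add: stage_circuit_def)

lemma stage_circuit_Nil [simp]: "stage_circuit i Vs Vs' [] = []"
  by (simp add: stage_circuit_def)

lemma stage_circuit_ok:
  assumes "0 < N" "unitary_op (N * N) (Or i)" "unitary_op (N * N) (Or (Suc i))"
    "\<forall>V\<in>set Vs. unitary_op 2 V" "\<forall>V\<in>set Vs'. unitary_op 2 V"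
  shows "circuit_ok N Or (stage_circuit i Vs Vs' s)"
proof (induction s)
  case Nil
  then show ?case by (simp add: circuit_ok_def)
next
  case (Cons a s)
  then show ?case
    using compiled_phase_ok[of N Or i Vs] compiled_phase_ok[of N Or "Suc i" Vs'] assms
    by (cases a) (simp add: stage_circuit_Cons circuit_ok_append)
qed

text \<open>The comparison follows the ideal trajectory. It stays in the range of the embedding and
  keeps its norm, so \<open>compiled_phase_error\<close> applies at every phase, and later unitaries
  do not enlarge earlier errors.\<close>

lemma stage_circuit_error:
  assumes chain: "reversible_ergodic_chain N (P i) \<mu>" "reversible_ergodic_chain N (P (Suc i)) \<mu>'"
    and orc: "is_oracle N (P i) (Or i)" "is_oracle N (P (Suc i)) (Or (Suc i))"
    and pc: "projector_circuit N P Or i \<eta> Vs" "projector_circuit N P Or (Suc i) \<eta> Vs'"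
    and \<eta>: "0 \<le> \<eta>" and v: "v \<in> carrier_vec N" and N: "0 < N"
  shows "vnorm (circuit_op N Or (stage_circuit i Vs Vs' s) *\<^sub>v (init_embed N *\<^sub>v v)
      - init_embed N *\<^sub>v (fpaa_op (qsample N \<mu>) (qsample N \<mu>') s *\<^sub>v v)) \<le> 4 * \<eta> * real (length s) * vnorm v"
proof (induction s)
  case Nil
  have "init_embed N *\<^sub>v v \<in> carrier_vec (2 * (N * N))" by (rule mult_mat_vec_carrier[OF init_embed_carrier v])
  then show ?case using v by (simp add: vnorm_zero_iff[of _ "2 * (N * N)", THEN iffD2])
next
  case (Cons a s)
  obtain \<alpha> \<beta> where a: "a = (\<alpha>, \<beta>)" by (cases a)
  let ?n = "2 * (N * N)" and ?J = "init_embed N" and ?q = "qsample N \<mu>" and ?q' = "qsample N \<mu>'"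
  interpret c1: reversible_chain N "P i" \<mu> by standard (rule chain)
  interpret c2: reversible_chain N "P (Suc i)" \<mu>' by standard (rule chain)
  have U: "unitary_op (N * N) (Or i)" "unitary_op (N * N) (Or (Suc i))" using orc by (auto simp: is_oracle_def)
  have Vs: "\<forall>V\<in>set Vs. unitary_op 2 V" "\<forall>V\<in>set Vs'. unitary_op 2 V"
    using pc by (auto simp: projector_circuit_def)
  let ?c1 = "compiled_phase i Vs \<alpha>" and ?c2 = "compiled_phase (Suc i) Vs' \<beta>"
  let ?M1 = "circuit_op N Or ?c1" and ?M2 = "circuit_op N Or ?c2"
  let ?S1 = "selective_phase \<alpha> (vproj ?q)" and ?S2 = "selective_phase \<beta> (vproj ?q')"
  have ok: "circuit_ok N Or (stage_circuit i Vs Vs' s)" by (rule stage_circuit_ok[of N Or i, OF N U Vs])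
  have ok1: "circuit_ok N Or ?c1" by (rule compiled_phase_ok[of N Or i, OF N U(1) Vs(1)])
  have ok2: "circuit_ok N Or ?c2" by (rule compiled_phase_ok[of N Or "Suc i", OF N U(2) Vs(2)])
  have J: "?J *\<^sub>v x \<in> carrier_vec ?n" if "x \<in> carrier_vec N" for x
    by (rule mult_mat_vec_carrier[OF init_embed_carrier that])
  define y where "y = circuit_op N Or (stage_circuit i Vs Vs' s) *\<^sub>v (?J *\<^sub>v v)"
  define w where "w = fpaa_op ?q ?q' s *\<^sub>v v"
  have y: "y \<in> carrier_vec ?n" unfolding y_def by (rule circuit_vec_carrier[OF ok J[OF v]])
  have w: "w \<in> carrier_vec N" unfolding w_def
    by (rule mult_mat_vec_carrier[OF fpaa_op_carrier[OF c1.q_carrier c2.q_carrier] v])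
  have wn: "vnorm w = vnorm v" unfolding w_def
    by (rule vnorm_fpaa_op[OF c1.q_carrier c1.vnorm_q c2.q_carrier c2.vnorm_q v])
  have S1w: "?S1 *\<^sub>v w \<in> carrier_vec N"
    by (rule mult_mat_vec_carrier[OF selective_phase_carrier[OF c1.q_carrier] w])
  have S2w: "?S2 *\<^sub>v (?S1 *\<^sub>v w) \<in> carrier_vec N"
    by (rule mult_mat_vec_carrier[OF selective_phase_carrier[OF c2.q_carrier] S1w])
  have S1n: "vnorm (?S1 *\<^sub>v w) = vnorm v"
    using vnorm_selective_phase[OF c1.q_carrier c1.vnorm_q w] wn by simp
  note M1 = circuit_vec_carrier[OF ok1] and M2 = circuit_vec_carrier[OF ok2]
  have okc: "circuit_ok N Or (?c1 @ ?c2)" using ok1 ok2 by (simp add: circuit_ok_append)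
  have "circuit_op N Or (stage_circuit i Vs Vs' (a # s)) *\<^sub>v (?J *\<^sub>v v) = ?M2 *\<^sub>v (?M1 *\<^sub>v y)"
    unfolding a stage_circuit_Cons circuit_vec_append[OF ok okc J[OF v]] y_def[symmetric]
    by (rule circuit_vec_append[OF ok1 ok2 y])
  moreover have "fpaa_op ?q ?q' (a # s) *\<^sub>v v = ?S2 *\<^sub>v (?S1 *\<^sub>v w)"
    unfolding a w_def by (rule fpaa_op_Cons_vec[OF c1.q_carrier c2.q_carrier v])
  \<comment> \<open>Two hybrid states separate three errors: that of the preceding circuit, that of
    the phase on the source state, and that of the phase on the target state.\<close>
  moreover have "vnorm (?M2 *\<^sub>v (?M1 *\<^sub>v y) - ?J *\<^sub>v (?S2 *\<^sub>v (?S1 *\<^sub>v w)))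
      \<le> vnorm (?M2 *\<^sub>v (?M1 *\<^sub>v y) - ?M2 *\<^sub>v (?M1 *\<^sub>v (?J *\<^sub>v w)))
       + (vnorm (?M2 *\<^sub>v (?M1 *\<^sub>v (?J *\<^sub>v w)) - ?M2 *\<^sub>v (?J *\<^sub>v (?S1 *\<^sub>v w)))
       + vnorm (?M2 *\<^sub>v (?J *\<^sub>v (?S1 *\<^sub>v w)) - ?J *\<^sub>v (?S2 *\<^sub>v (?S1 *\<^sub>v w))))"
    by (rule order.trans[OF vnorm_diff_triangle[of _ ?n] add_left_mono[OF vnorm_diff_triangle[of _ ?n]]])
      (intro M1 M2 J y w S1w S2w)+
  moreover have "vnorm (?M2 *\<^sub>v (?M1 *\<^sub>v y) - ?M2 *\<^sub>v (?M1 *\<^sub>v (?J *\<^sub>v w))) \<le> 4 * \<eta> * real (length s) * vnorm v"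
    unfolding vnorm_circuit_diff[OF ok2 M1[OF y] M1[OF J[OF w]]] vnorm_circuit_diff[OF ok1 y J[OF w]]
    using Cons.IH by (simp add: y_def w_def)
  moreover have "vnorm (?M2 *\<^sub>v (?M1 *\<^sub>v (?J *\<^sub>v w)) - ?M2 *\<^sub>v (?J *\<^sub>v (?S1 *\<^sub>v w))) \<le> 2 * \<eta> * vnorm v"
    unfolding vnorm_circuit_diff[OF ok2 M1[OF J[OF w]] J[OF S1w]]
    using compiled_phase_error[of N P i \<mu> Or \<eta> Vs, OF chain(1) orc(1) pc(1) \<eta> w, of \<alpha>] wn by simp
  moreover have "vnorm (?M2 *\<^sub>v (?J *\<^sub>v (?S1 *\<^sub>v w)) - ?J *\<^sub>v (?S2 *\<^sub>v (?S1 *\<^sub>v w))) \<le> 2 * \<eta> * vnorm v"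
    using compiled_phase_error[of N P "Suc i" \<mu>' Or \<eta> Vs', OF chain(2) orc(2) pc(2) \<eta> S1w, of \<beta>] S1n by simp
  ultimately show ?case by (simp add: algebra_simps)
qed

lemma qsample_circuit_Suc:
  "qsample_circuit (Suc j) G fp \<epsilon>F \<epsilon>W = qsample_circuit j G fp \<epsilon>F \<epsilon>W
    @ stage_circuit j (G j (\<epsilon>W j)) (G (Suc j) (\<epsilon>W j)) (fp j (\<epsilon>F j))"
  by (simp add: qsample_circuit_def)

text \<open>Admissibility of the circuit is part of the induction claim because composing it with
  the next stage requires it. The accumulated error passes through the next stage unchanged, since
  trace distance is invariant under unitaries.\<close>

lemma qsample_circuit_error:
  assumes chain: "\<And>k. k \<le> l \<Longrightarrow> reversible_ergodic_chain N (P k) (\<mu> k)"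
    and orc: "\<And>k. k \<le> l \<Longrightarrow> is_oracle N (P k) (Or k)"
    and pc: "\<And>i. i < l \<Longrightarrow> projector_circuit N P Or i (\<epsilon>W i) (G i (\<epsilon>W i))
        \<and> projector_circuit N P Or (Suc i) (\<epsilon>W i) (G (Suc i) (\<epsilon>W i))"
    and fp: "\<And>i. i < l \<Longrightarrow> trace_dist (fpaa_op (qsample N (\<mu> i)) (qsample N (\<mu> (Suc i))) (fp i (\<epsilon>F i))
        *\<^sub>v qsample N (\<mu> i)) (qsample N (\<mu> (Suc i))) \<le> \<epsilon>F i"
    and \<epsilon>W: "\<And>i. i < l \<Longrightarrow> 0 \<le> \<epsilon>W i" and N: "0 < N" and j: "j \<le> l"
  shows "circuit_ok N Or (qsample_circuit j G fp \<epsilon>F \<epsilon>W)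
    \<and> trace_dist (qsample_output N Or \<mu> (qsample_circuit j G fp \<epsilon>F \<epsilon>W)) (init_embed N *\<^sub>v qsample N (\<mu> j))
      \<le> (\<Sum>i<j. \<epsilon>F i + 2 * (real (schedule_len (fp i (\<epsilon>F i))) - 1) * \<epsilon>W i)"
  using j
proof (induction j)
  case 0
  interpret reversible_chain N "P 0" "\<mu> 0" by standard (rule chain[OF 0])
  have J: "init_embed N *\<^sub>v q \<in> carrier_vec (2 * (N * N))"
    by (rule mult_mat_vec_carrier[OF init_embed_carrier q_carrier])
  have "trace_dist (init_embed N *\<^sub>v q) (init_embed N *\<^sub>v q) = 0"
    unfolding trace_dist_isometry[OF init_embed_carrier init_embed_isometry[OF N] q_carrier q_carrier]
    by (simp add: trace_dist_def cscalar_prod_self vnorm_q)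
  then show ?case using J by (simp add: qsample_circuit_def qsample_output_def circuit_ok_def)
next
  case (Suc j)
  then have j: "j < l" "j \<le> l" "Suc j \<le> l" by auto
  interpret c0: reversible_chain N "P 0" "\<mu> 0" by standard (rule chain[OF le0])
  interpret c1: reversible_chain N "P j" "\<mu> j" by standard (rule chain[OF j(2)])
  interpret c2: reversible_chain N "P (Suc j)" "\<mu> (Suc j)" by standard (rule chain[OF j(3)])
  let ?n = "2 * (N * N)" and ?J = "init_embed N"
  let ?c = "qsample_circuit j G fp \<epsilon>F \<epsilon>W"
  define s where "s = fp j (\<epsilon>F j)"
  define d where "d = stage_circuit j (G j (\<epsilon>W j)) (G (Suc j) (\<epsilon>W j)) s"
  define F where "F = fpaa_op (qsample N (\<mu> j)) (qsample N (\<mu> (Suc j))) s"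
  note pcj = pc[OF j(1)]
  have okc: "circuit_ok N Or ?c" using Suc.IH[OF j(2)] by blast
  have okd: "circuit_ok N Or d" unfolding d_def
    by (rule stage_circuit_ok) (use orc[OF j(2)] orc[OF j(3)] pcj N in \<open>auto simp: is_oracle_def projector_circuit_def\<close>)
  have J: "?J *\<^sub>v x \<in> carrier_vec ?n" if "x \<in> carrier_vec N" for x
    by (rule mult_mat_vec_carrier[OF init_embed_carrier that])
  note Jn = vnorm_init_embed[OF N]
  define \<Psi> where "\<Psi> = qsample_output N Or \<mu> ?c"
  have \<Psi>: "\<Psi> \<in> carrier_vec ?n" "vnorm \<Psi> = 1"
    unfolding \<Psi>_def qsample_output_def
    using circuit_vec_carrier[OF okc J[OF c0.q_carrier]] vnorm_circuit[OF okc J[OF c0.q_carrier]]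
      Jn[OF c0.q_carrier] c0.vnorm_q by auto
  let ?U = "circuit_op N Or d"
  have out: "qsample_output N Or \<mu> (qsample_circuit (Suc j) G fp \<epsilon>F \<epsilon>W) = ?U *\<^sub>v \<Psi>"
    unfolding qsample_output_def qsample_circuit_Suc s_def[symmetric] d_def[symmetric] \<Psi>_def
    by (rule circuit_vec_append[OF okc okd J[OF c0.q_carrier]])
  have Fq: "F *\<^sub>v c1.q \<in> carrier_vec N" unfolding F_def
    by (rule mult_mat_vec_carrier[OF fpaa_op_carrier[OF c1.q_carrier c2.q_carrier] c1.q_carrier])
  have Fqn: "vnorm (F *\<^sub>v c1.q) = 1" unfolding F_def
    using vnorm_fpaa_op[OF c1.q_carrier c1.vnorm_q c2.q_carrier c2.vnorm_q c1.q_carrier] c1.vnorm_q by simp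
  have a: "?U *\<^sub>v \<Psi> \<in> carrier_vec ?n" "vnorm (?U *\<^sub>v \<Psi>) = 1"
    using circuit_vec_carrier[OF okd \<Psi>(1)] vnorm_circuit[OF okd \<Psi>(1)] \<Psi>(2) by auto
  have b: "?U *\<^sub>v (?J *\<^sub>v c1.q) \<in> carrier_vec ?n" "vnorm (?U *\<^sub>v (?J *\<^sub>v c1.q)) = 1"
    using circuit_vec_carrier[OF okd J[OF c1.q_carrier]] vnorm_circuit[OF okd J[OF c1.q_carrier]]
      Jn[OF c1.q_carrier] c1.vnorm_q by auto
  have c: "?J *\<^sub>v (F *\<^sub>v c1.q) \<in> carrier_vec ?n" "vnorm (?J *\<^sub>v (F *\<^sub>v c1.q)) = 1"
    using J[OF Fq] Jn[OF Fq] Fqn by auto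
  have e: "?J *\<^sub>v c2.q \<in> carrier_vec ?n" "vnorm (?J *\<^sub>v c2.q) = 1"
    using J[OF c2.q_carrier] Jn[OF c2.q_carrier] c2.vnorm_q by auto
  \<comment> \<open>The intermediate states are the compiled stage on the exact input and the
    embedded output of the ideal stage; the three terms are inherited error, compilation error and
    amplification error.\<close>
  have "trace_dist (?U *\<^sub>v \<Psi>) (?J *\<^sub>v c2.q) \<le> trace_dist (?U *\<^sub>v \<Psi>) (?U *\<^sub>v (?J *\<^sub>v c1.q))
      + (trace_dist (?U *\<^sub>v (?J *\<^sub>v c1.q)) (?J *\<^sub>v (F *\<^sub>v c1.q)) + trace_dist (?J *\<^sub>v (F *\<^sub>v c1.q)) (?J *\<^sub>v c2.q))"
    by (rule order.trans[OF trace_dist_triangle[OF a b e] add_left_mono[OF trace_dist_triangle[OF b c e]]])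
  also have "trace_dist (?U *\<^sub>v \<Psi>) (?U *\<^sub>v (?J *\<^sub>v c1.q)) = trace_dist \<Psi> (?J *\<^sub>v c1.q)"
    using circuit_op_unitary[OF okd]
    by (intro trace_dist_isometry[of _ ?n ?n] \<Psi>(1) J c1.q_carrier) (auto dest: unitary_opD)
  also have "trace_dist (?J *\<^sub>v (F *\<^sub>v c1.q)) (?J *\<^sub>v c2.q) = trace_dist (F *\<^sub>v c1.q) c2.q"
    by (rule trace_dist_isometry[OF init_embed_carrier init_embed_isometry[OF N] Fq c2.q_carrier])
  also have "trace_dist (F *\<^sub>v c1.q) c2.q \<le> \<epsilon>F j" using fp[OF j(1)] by (simp add: F_def s_def)
  also have "trace_dist (?U *\<^sub>v (?J *\<^sub>v c1.q)) (?J *\<^sub>v (F *\<^sub>v c1.q)) \<le> vnorm (?U *\<^sub>v (?J *\<^sub>v c1.q) - ?J *\<^sub>v (F *\<^sub>v c1.q))"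
    by (rule trace_dist_le_vnorm_diff) (simp_all only: carrier_vecD[OF b(1)] carrier_vecD[OF c(1)] b(2) c(2))
  also have "\<dots> \<le> 4 * \<epsilon>W j * real (length s) * vnorm c1.q"
    unfolding d_def F_def
    by (rule stage_circuit_error[OF chain[OF j(2)] chain[OF j(3)] orc[OF j(2)] orc[OF j(3)]
      conjunct1[OF pcj] conjunct2[OF pcj] \<epsilon>W[OF j(1)] c1.q_carrier N])
  \<comment> \<open>Here \<open>4 * length s\<close> is \<open>2 (L - 1)\<close>, since
    \<open>L\<close> is twice the length plus one.\<close>
  also have "\<dots> = 2 * (real (schedule_len s) - 1) * \<epsilon>W j"
    by (simp add: c1.vnorm_q schedule_len_def)
  also have "trace_dist \<Psi> (?J *\<^sub>v c1.q) \<le> (\<Sum>i<j. \<epsilon>F i + 2 * (real (schedule_len (fp i (\<epsilon>F i))) - 1) * \<epsilon>W i)"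
    using Suc.IH[OF j(2)] by (simp add: \<Psi>_def)
  finally have "trace_dist (?U *\<^sub>v \<Psi>) (?J *\<^sub>v c2.q)
      \<le> (\<Sum>i<Suc j. \<epsilon>F i + 2 * (real (schedule_len (fp i (\<epsilon>F i))) - 1) * \<epsilon>W i)"
    by (simp add: s_def)
  moreover have "circuit_ok N Or (qsample_circuit (Suc j) G fp \<epsilon>F \<epsilon>W)"
    using okc okd by (simp add: qsample_circuit_Suc circuit_ok_append d_def s_def)
  ultimately show ?case unfolding out by blast
qed


subsection \<open>Query count\<close>

lemma queries_append [simp]: "queries (c @ d) = queries c + queries d"
  by (simp add: queries_def)

lemma queries_Nil [simp]: "queries [] = 0"
  by (simp add: queries_def)

lemma queries_Cons: "queries (g # c) = (if is_query g then 1 else 0) + queries c"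
  by (simp add: queries_def)

lemma is_query_adj [simp]: "is_query (gate_adj g) = is_query g"
  by (cases g) auto

lemma queries_circuit_adj [simp]: "queries (circuit_adj c) = queries c"
  by (simp add: queries_def circuit_adj_def rev_filter[symmetric] filter_map comp_def)

lemma queries_gqsp_circuit: "Vs \<noteq> [] \<Longrightarrow> queries (gqsp_circuit k Vs) = 2 * gqsp_degree Vs"
proof -
  have "queries (concat (map (\<lambda>V. controlled_walk k @ [Signal V]) Us)) = 2 * length Us" for Us
    by (induction Us) (auto simp: queries_Cons controlled_walk_def)
  then show "Vs \<noteq> [] \<Longrightarrow> ?thesis" by (cases Vs) (auto simp: queries_Cons gqsp_degree_def)
qed

text \<open>The 2 counts the outer oracle pair; circuit and adjoint each contain
  \<open>gqsp_degree Vs\<close> walks with two queries per walk.\<close>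

lemma queries_compiled_phase:
  "Vs \<noteq> [] \<Longrightarrow> queries (compiled_phase k Vs \<phi>) = 2 + 4 * gqsp_degree Vs"
  by (simp add: compiled_phase_def queries_Cons queries_gqsp_circuit)

lemma queries_stage_circuit:
  assumes "Vs \<noteq> []" "Vs' \<noteq> []"
  shows "queries (stage_circuit i Vs Vs' s) = length s * (4 + 4 * gqsp_degree Vs + 4 * gqsp_degree Vs')"
proof (induction s)
  case (Cons a s)
  then show ?case using assms by (cases a) (simp add: stage_circuit_Cons queries_compiled_phase)
qed simp

lemma circuit_qubits_le: "circuit_qubits N c \<le> 2 * state_qubits N + 1"
proof -
  have "(\<Union>(gate_registers ` set c)) \<subseteq> {SigReg, RegA, RegB}" (is "?R \<subseteq> _")
    using register.exhaust by blast
  then have "circuit_qubits N c \<le> (\<Sum>r\<in>{SigReg, RegA, RegB}. register_qubits N r)"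
    unfolding circuit_qubits_def by (intro sum_mono2) auto
  then show ?thesis by simp
qed

text \<open>The walk has an eigenvalue other than 1, where a constant polynomial with value 1 at 1 is not small.\<close>

lemma gqsp_degree_pos:
  assumes "reversible_ergodic_chain N (P k) \<mu>" "2 \<le> N" "projector_circuit N P Or k \<eta> Vs" "\<eta> < 1"
  shows "1 \<le> gqsp_degree Vs"
proof (rule ccontr)
  assume d: "\<not> 1 \<le> gqsp_degree Vs"
  interpret reversible_chain N "P k" \<mu> by standard (rule assms(1))
  obtain Y where Y: "degree Y \<le> gqsp_degree Vs" "poly Y 1 = 1"
    "\<forall>z\<in>spectrum (walk N (P k)). z \<noteq> 1 \<longrightarrow> cmod (poly Y z) \<le> \<eta>"
    using assms(3) unfolding projector_circuit_def by blast
  obtain a where "Y = [:a:]" using Y(1) d by (metis degree_eq_zeroE le_zero_eq less_one not_le)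
  with Y assms(4) walk_nontrivial[OF assms(2)] show False by auto
qed

text \<open>A degree is at least 1, and at small accuracy it is bounded by
  \<open>K / phase_gap\<close> times a nonnegative logarithm. This is impossible for a gap that is
  not positive.\<close>

lemma phase_gap_pos:
  assumes fam: "projector_family K e\<^sub>0 N l P Or G" and K: "0 < K" "0 < e\<^sub>0" and k: "k \<le> l"
    and chain: "reversible_ergodic_chain N (P k) \<mu>" and N: "2 \<le> N"
  shows "0 < phase_gap N (P k)"
proof -
  \<comment> \<open>Any accuracy below 1 and within the threshold would do.\<close>
  define \<eta> where "\<eta> = min e\<^sub>0 (1 / 2)"
  have \<eta>: "0 < \<eta>" "\<eta> < 1" "\<eta> \<le> e\<^sub>0" using K by (auto simp: \<eta>_def)
  have pc: "projector_circuit N P Or k \<eta> (G k \<eta>)"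
    and d: "real (gqsp_degree (G k \<eta>)) \<le> K / phase_gap N (P k) * ln (1 / \<eta>)"
    using fam k \<eta> unfolding projector_family_def by auto
  have ge1: "1 \<le> K / phase_gap N (P k) * ln (1 / \<eta>)"
    using d gqsp_degree_pos[of N P, OF chain N pc \<eta>(2)] by linarith
  have "0 \<le> ln (1 / \<eta>)" using \<eta> by (intro ln_ge_zero) simp
  show ?thesis
  proof (rule ccontr)
    assume "\<not> ?thesis"
    \<comment> \<open>A zero gap is covered as well, because division by zero yields 0.\<close>
    then have "K / phase_gap N (P k) \<le> 0" using K by (intro divide_nonneg_nonpos) auto
    then have "K / phase_gap N (P k) * ln (1 / \<eta>) \<le> 0"
      using \<open>0 \<le> ln (1 / \<eta>)\<close> by (rule mult_nonpos_nonneg)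
    with ge1 show False by linarith
  qed
qed

text \<open>Cauchy-Schwarz for unit vectors; it bounds \<open>p_min\<close> by 1, so that the factor
  \<open>1 / sqrt p_min\<close> can only enlarge the second logarithm.\<close>

lemma overlap_le_one:
  assumes "reversible_ergodic_chain N P \<mu>" "reversible_ergodic_chain N P' \<mu>'"
  shows "(cmod (qsample N \<mu> \<bullet>c qsample N \<mu>'))\<^sup>2 \<le> 1"
proof -
  interpret c1: reversible_chain N P \<mu> by standard (rule assms)
  interpret c2: reversible_chain N P' \<mu>' by standard (rule assms)
  show ?thesis
    using cmod_cscalar_prod_le[of c1.q c2.q] c1.vnorm_q c2.vnorm_q by (simp add: power_le_one)
qed

text \<open>Constants inside a logarithm are absorbed by squaring its argument. From
  \<open>\<epsilon> \<le> 1 / 3\<close> follow \<open>2 \<le> l / \<epsilon>\<close> and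
  \<open>1 \<le> ln (l / \<epsilon>)\<close>; from \<open>\<epsilon> \<le> 1 / (8 * K)\<close>
  follows that the factor \<open>8 * K\<close> is at most the argument \<open>X\<close> of the
  second logarithm.\<close>

lemma log_factor_bounds:
  fixes K L \<epsilon> p :: real
  assumes K: "0 < K" and l: "1 \<le> l" and \<epsilon>: "0 < \<epsilon>" "\<epsilon> \<le> 1 / 3" "\<epsilon> \<le> 1 / (8 * K)" and p: "0 < p" "p \<le> 1"
    and L: "1 \<le> L" "L \<le> K / sqrt p * ln (1 / (\<epsilon> / (2 * l)))"
  shows "L \<le> K / sqrt p * (2 * ln (l / \<epsilon>))"
    and "ln (1 / (\<epsilon> / (4 * l * L))) \<le> 2 * ln (l / (\<epsilon> * sqrt p) * ln (l / \<epsilon>))"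
    and "0 < ln (l / \<epsilon>)"
proof -
  define a where "a = ln (l / \<epsilon>)"
  define X where "X = l / (\<epsilon> * sqrt p) * a"
  have x3: "3 \<le> l / \<epsilon>" using l \<epsilon> by (simp add: field_simps)
  then have "exp 1 \<le> l / \<epsilon>" using exp_le by linarith
  then have a1: "1 \<le> a" unfolding a_def using x3 by (subst ln_ge_iff) auto
  then show "0 < ln (l / \<epsilon>)" by (simp add: a_def)
  have "ln (1 / (\<epsilon> / (2 * l))) = ln (2 * (l / \<epsilon>))" using l \<epsilon> by (simp add: field_simps)
  \<comment> \<open>Doubling is dominated by squaring, as \<open>l / \<epsilon>\<close> is at least
    3.\<close>
  also have "\<dots> \<le> ln ((l / \<epsilon>) * (l / \<epsilon>))"
  proof -
    have "2 * y \<le> y * y" "0 < y * y" if "3 \<le> y" for y :: real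
      using that by (auto intro: mult_right_mono)
    from this[OF x3] show ?thesis using x3 by (subst ln_le_cancel_iff) linarith+
  qed
  also have "\<dots> = 2 * a"
  proof -
    have "ln (y * y) = 2 * ln y" if "3 \<le> y" for y :: real using that by (simp add: ln_mult)
    from this[OF x3] show ?thesis unfolding a_def .
  qed
  finally have "ln (1 / (\<epsilon> / (2 * l))) \<le> 2 * a" .
  then have "K / sqrt p * ln (1 / (\<epsilon> / (2 * l))) \<le> K / sqrt p * (2 * a)"
    using K p by (intro mult_left_mono) auto
  with L(2) have L': "L \<le> K / sqrt p * (2 * a)" by linarith
  then show "L \<le> K / sqrt p * (2 * ln (l / \<epsilon>))" by (simp add: a_def)
  have sp: "0 < sqrt p" "sqrt p \<le> 1" using p by auto
  \<comment> \<open>Dropping \<open>l\<close>, \<open>a\<close> and \<open>sqrt p\<close> shows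
    \<open>X\<close> to be at least \<open>1 / \<epsilon>\<close>, hence at least
    \<open>8 * K\<close>.\<close>
  have "1 \<le> l * a" using l a1 mult_mono[of 1 l 1 a] by simp
  moreover have "\<epsilon> * sqrt p \<le> \<epsilon>" using sp \<epsilon> by (simp add: mult_left_le)
  ultimately have "1 / \<epsilon> \<le> l * a / (\<epsilon> * sqrt p)"
    using \<epsilon> sp by (intro frac_le) auto
  moreover have "8 * K \<le> 1 / \<epsilon>" using \<epsilon> K by (simp add: field_simps)
  ultimately have X8: "8 * K \<le> X" by (simp add: X_def)
  then have X0: "0 < X" using K by linarith
  have "1 / (\<epsilon> / (4 * l * L)) = (4 * l / \<epsilon>) * L" using l \<epsilon> by (simp add: field_simps)
  also have "\<dots> \<le> (4 * l / \<epsilon>) * (K / sqrt p * (2 * a))" using L' l \<epsilon> by (intro mult_left_mono) auto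
  also have "\<dots> = 8 * K * X" using \<epsilon> sp by (simp add: X_def field_simps)
  also have "\<dots> \<le> X * X" using X8 X0 by (intro mult_right_mono) auto
  finally have "1 / (\<epsilon> / (4 * l * L)) \<le> X * X" .
  moreover have "0 < 1 / (\<epsilon> / (4 * l * L))" using l \<epsilon> L by simp
  ultimately have "ln (1 / (\<epsilon> / (4 * l * L))) \<le> ln (X * X)" using X0 by (subst ln_le_cancel_iff) auto
  also have "\<dots> = 2 * ln X" using X0 by (simp add: ln_mult)
  finally show "ln (1 / (\<epsilon> / (4 * l * L))) \<le> 2 * ln (l / (\<epsilon> * sqrt p) * ln (l / \<epsilon>))"
    by (simp add: X_def a_def)
qed

lemma queries_qsample_circuit:
  assumes "\<And>i. i < l \<Longrightarrow> G i (\<epsilon>W i) \<noteq> [] \<and> G (Suc i) (\<epsilon>W i) \<noteq> []"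
  shows "queries (qsample_circuit l G fp \<epsilon>F \<epsilon>W) = (\<Sum>i<l. length (fp i (\<epsilon>F i))
    * (4 + 4 * gqsp_degree (G i (\<epsilon>W i)) + 4 * gqsp_degree (G (Suc i) (\<epsilon>W i))))"
  using assms
proof (induction l)
  case 0
  then show ?case by (simp add: qsample_circuit_def)
next
  case (Suc l)
  then show ?case by (simp add: qsample_circuit_Suc queries_stage_circuit)
qed

text \<open>\<open>K\<close> and \<open>e\<^sub>0\<close> witness the hidden constants of the two
  given constructions, and the new constants depend on nothing else. The threshold on
  \<open>\<epsilon>\<close> restricts only the query bound; accuracy and qubit count hold for every
  \<open>\<epsilon>\<close> below 1. With a single state the walk would have 1 as its only
  eigenvalue and the phase gap would be the minimum of an empty set.\<close>

theorem theoremV1: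
  fixes K e\<^sub>0 :: real
  assumes "0 < K" and "0 < e\<^sub>0"
  shows "\<exists>C>0. \<exists>\<epsilon>\<^sub>0>0. \<forall>N l P \<mu> Or p G fp \<epsilon>.
    2 \<le> N \<and> 1 \<le> l
    \<and> (\<forall>k\<le>l. reversible_ergodic_chain N (P k) (\<mu> k) \<and> is_oracle N (P k) (Or k))
    \<and> (\<forall>i<l. 0 < p i \<and> p i \<le> (cmod (qsample N (\<mu> i) \<bullet>c qsample N (\<mu> (Suc i))))\<^sup>2)
    \<and> projector_family K e\<^sub>0 N l P Or G
    \<and> fpaa_family K e\<^sub>0 N l \<mu> p fp
    \<and> 0 < \<epsilon> \<and> \<epsilon> < 1
    \<longrightarrow> (let p_min = Min (p ` {..<l}); \<Delta>_min = Min ((\<lambda>k. phase_gap N (P k)) ` {..l}) in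
      \<exists>\<epsilon>F \<epsilon>W. admissible_accuracies l fp \<epsilon> \<epsilon>F \<epsilon>W
        \<and> (let c = qsample_circuit l G fp \<epsilon>F \<epsilon>W in
            trace_dist (qsample_output N Or \<mu> c) (init_embed N *\<^sub>v qsample N (\<mu> l)) \<le> \<epsilon>
            \<and> circuit_qubits N c \<le> 2 * state_qubits N + 1
            \<and> (\<epsilon> \<le> \<epsilon>\<^sub>0 \<longrightarrow> real (queries c) \<le>
                 C * (real l / (sqrt p_min * \<Delta>_min) * ln (real l / \<epsilon>)
                      * ln (real l / (\<epsilon> * sqrt p_min) * ln (real l / \<epsilon>))))))"
proof -
  \<comment> \<open>The first bound brings all stage accuracies, which are at most
    \<open>\<epsilon>\<close>, within the range of the given degree and length bounds; the other two
    serve \<open>log_factor_bounds\<close>.\<close>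
  define \<epsilon>\<^sub>0 where "\<epsilon>\<^sub>0 = min e\<^sub>0 (min (1 / 3) (1 / (8 * K)))"
  have \<epsilon>\<^sub>0: "0 < \<epsilon>\<^sub>0" using assms by (simp add: \<epsilon>\<^sub>0_def)
  have C: "0 < 24 * K\<^sup>2" using assms by simp
  show ?thesis
  \<comment> \<open>The constant comes from one stage: \<open>L / 2\<close> contributes
    \<open>K\<close>, and the queries per pair of phases contribute 12 times a degree bound with
    factor \<open>2 K\<close>.\<close>
  proof (rule exI[of _ "24 * K\<^sup>2"], rule conjI[OF C], rule exI[of _ \<epsilon>\<^sub>0], rule conjI[OF \<epsilon>\<^sub>0], intro allI impI)
    fix N l :: nat and P :: "nat \<Rightarrow> real mat" and \<mu> :: "nat \<Rightarrow> real vec" and Or :: "nat \<Rightarrow> complex mat"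
      and p :: "nat \<Rightarrow> real" and G :: "nat \<Rightarrow> real \<Rightarrow> complex mat list" and fp :: "nat \<Rightarrow> real \<Rightarrow> schedule"
      and \<epsilon> :: real
    assume H: "2 \<le> N \<and> 1 \<le> l
      \<and> (\<forall>k\<le>l. reversible_ergodic_chain N (P k) (\<mu> k) \<and> is_oracle N (P k) (Or k))
      \<and> (\<forall>i<l. 0 < p i \<and> p i \<le> (cmod (qsample N (\<mu> i) \<bullet>c qsample N (\<mu> (Suc i))))\<^sup>2)
      \<and> projector_family K e\<^sub>0 N l P Or G
      \<and> fpaa_family K e\<^sub>0 N l \<mu> p fp
      \<and> 0 < \<epsilon> \<and> \<epsilon> < 1"
    then have N: "2 \<le> N" "0 < N" and l: "1 \<le> l"
      and chain: "\<And>k. k \<le> l \<Longrightarrow> reversible_ergodic_chain N (P k) (\<mu> k)"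
      and orc: "\<And>k. k \<le> l \<Longrightarrow> is_oracle N (P k) (Or k)"
      and p: "\<And>i. i < l \<Longrightarrow> 0 < p i" "\<And>i. i < l \<Longrightarrow> p i \<le> (cmod (qsample N (\<mu> i) \<bullet>c qsample N (\<mu> (Suc i))))\<^sup>2"
      and G: "projector_family K e\<^sub>0 N l P Or G" and fp: "fpaa_family K e\<^sub>0 N l \<mu> p fp"
      and \<epsilon>: "0 < \<epsilon>" "\<epsilon> < 1" by auto
    define p_min where "p_min = Min (p ` {..<l})"
    define \<Delta>_min where "\<Delta>_min = Min ((\<lambda>k. phase_gap N (P k)) ` {..l})"
    \<comment> \<open>Half of the budget \<open>\<epsilon> / l\<close> of a stage; it determines
      \<open>L\<close>, so that the walk accuracy may depend on \<open>L\<close> without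
      circularity.\<close>
    define \<epsilon>F :: "nat \<Rightarrow> real" where "\<epsilon>F i = \<epsilon> / (2 * real l)" for i
    define L where "L i = real (schedule_len (fp i (\<epsilon>F i)))" for i
    \<comment> \<open>Chosen so that \<open>2 L\<close> times it is the other half of the
      budget.\<close>
    define \<epsilon>W where "\<epsilon>W i = \<epsilon> / (4 * real l * L i)" for i
    have L1: "1 \<le> L i" for i by (simp add: L_def schedule_len_def)
    have rl: "1 \<le> real l" using l by simp
    have F: "0 < \<epsilon>F i" "\<epsilon>F i < 1" "\<epsilon>F i \<le> \<epsilon>" for i
      using \<epsilon> rl by (auto simp: \<epsilon>F_def field_simps intro: less_le_trans[of \<epsilon> 1])
    have lL: "1 \<le> real l * L i" for i using mult_mono[OF rl L1[of i]] by simp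
    have W: "0 < \<epsilon>W i" "\<epsilon>W i < 1" "\<epsilon>W i \<le> \<epsilon>" for i
    proof -
      have "1 < 4 * real l * L i" using lL[of i] by linarith
      then show "0 < \<epsilon>W i" "\<epsilon>W i \<le> \<epsilon>" using \<epsilon> by (auto simp: \<epsilon>W_def field_simps)
      then show "\<epsilon>W i < 1" using \<epsilon> by linarith
    qed
    have budget: "\<epsilon>F i + 2 * (L i - 1) * \<epsilon>W i \<le> \<epsilon> / real l" for i
    proof -
      have "2 * (L i - 1) * \<epsilon>W i \<le> 2 * L i * \<epsilon>W i" using W[of i] by (simp add: algebra_simps)
      also have "2 * L i * \<epsilon>W i = \<epsilon> / (2 * real l)" using rl L1[of i] by (simp add: \<epsilon>W_def field_simps)
      finally have "2 * (L i - 1) * \<epsilon>W i \<le> \<epsilon> / (2 * real l)" .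
      moreover have "\<epsilon> / (2 * real l) + \<epsilon> / (2 * real l) = \<epsilon> / real l" using rl by (simp add: field_simps)
      ultimately show ?thesis unfolding \<epsilon>F_def by linarith
    qed
    have adm: "admissible_accuracies l fp \<epsilon> \<epsilon>F \<epsilon>W"
      unfolding admissible_accuracies_def using F W budget by (simp add: L_def)
    have pc: "projector_circuit N P Or i (\<epsilon>W i) (G i (\<epsilon>W i))"
      "projector_circuit N P Or (Suc i) (\<epsilon>W i) (G (Suc i) (\<epsilon>W i))" if "i < l" for i
      using G W[of i] that unfolding projector_family_def by auto
    have td: "trace_dist (qsample_output N Or \<mu> (qsample_circuit l G fp \<epsilon>F \<epsilon>W)) (init_embed N *\<^sub>v qsample N (\<mu> l)) \<le> \<epsilon>"
    proof -
      have "trace_dist (qsample_output N Or \<mu> (qsample_circuit l G fp \<epsilon>F \<epsilon>W)) (init_embed N *\<^sub>v qsample N (\<mu> l))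
          \<le> (\<Sum>i<l. \<epsilon>F i + 2 * (L i - 1) * \<epsilon>W i)"
        unfolding L_def
      proof (rule conjunct2[OF qsample_circuit_error[OF chain orc _ _ _ N(2) order.refl]])
        show "trace_dist (fpaa_op (qsample N (\<mu> i)) (qsample N (\<mu> (Suc i))) (fp i (\<epsilon>F i)) *\<^sub>v qsample N (\<mu> i))
            (qsample N (\<mu> (Suc i))) \<le> \<epsilon>F i" if "i < l" for i
          using fp F[of i] that unfolding fpaa_family_def by blast
      qed (use pc W in \<open>auto intro: less_imp_le\<close>)
      also have "\<dots> \<le> (\<Sum>i<l. \<epsilon> / real l)" by (intro sum_mono budget)
      also have "\<dots> = \<epsilon>" using rl by simp
      finally show ?thesis .
    qed
    have query: "real (queries (qsample_circuit l G fp \<epsilon>F \<epsilon>W)) \<le> 24 * K\<^sup>2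
        * (real l / (sqrt p_min * \<Delta>_min) * ln (real l / \<epsilon>) * ln (real l / (\<epsilon> * sqrt p_min) * ln (real l / \<epsilon>)))"
      if small: "\<epsilon> \<le> \<epsilon>\<^sub>0"
    proof -
      have e: "\<epsilon> \<le> e\<^sub>0" "\<epsilon> \<le> 1 / 3" "\<epsilon> \<le> 1 / (8 * K)" using small by (auto simp: \<epsilon>\<^sub>0_def)
      have "p 0 \<in> p ` {..<l}" using l by auto
      then have fin: "finite (p ` {..<l})" "p ` {..<l} \<noteq> {}" by auto
      have pmin: "p_min \<le> p i" if "i < l" for i unfolding p_min_def using fin that by auto
      have "p_min \<in> p ` {..<l}" unfolding p_min_def by (rule Min_in[OF fin])
      then have p0: "0 < p_min" using p(1) by auto
      have "p 0 \<le> 1" using p(2)[of 0] overlap_le_one[OF chain[of 0] chain[of 1]] l by simp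
      then have p1: "p_min \<le> 1" using pmin[of 0] l by simp
      have gap: "0 < phase_gap N (P k)" if "k \<le> l" for k
        by (rule phase_gap_pos[OF G assms that chain[OF that] N(1)])
      have "\<Delta>_min \<in> (\<lambda>k. phase_gap N (P k)) ` {..l}" unfolding \<Delta>_min_def by (rule Min_in) auto
      then have \<Delta>0: "0 < \<Delta>_min" using gap by auto
      have \<Delta>: "\<Delta>_min \<le> phase_gap N (P k)" if "k \<le> l" for k unfolding \<Delta>_min_def using that by auto
      define a where "a = ln (real l / \<epsilon>)"
      define B where "B = ln (real l / (\<epsilon> * sqrt p_min) * a)"
      have stage: "real (length (fp i (\<epsilon>F i))
            * (4 + 4 * gqsp_degree (G i (\<epsilon>W i)) + 4 * gqsp_degree (G (Suc i) (\<epsilon>W i))))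
          \<le> 24 * K\<^sup>2 / (sqrt p_min * \<Delta>_min) * a * B" if i: "i < l" for i
      proof -
        have "L i \<le> K / sqrt (p i) * ln (1 / \<epsilon>F i)"
          unfolding L_def using fp F[of i] e(1) i unfolding fpaa_family_def by auto
        also have "\<dots> \<le> K / sqrt p_min * ln (1 / \<epsilon>F i)"
          using assms(1) p0 pmin[OF i] F[of i] by (intro mult_right_mono divide_left_mono) (auto simp: less_imp_le ln_ge_zero)
        finally have LK: "L i \<le> K / sqrt p_min * ln (1 / (\<epsilon> / (2 * real l)))" by (simp add: \<epsilon>F_def)
        note bounds = log_factor_bounds[OF assms(1) rl \<epsilon>(1) e(2,3) p0 p1 L1 LK, folded \<epsilon>W_def a_def, folded B_def]
        \<comment> \<open>A common bound for the degrees at both chains of the stage, with the gap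
          replaced by its minimum and the logarithm by twice the second logarithm.\<close>
        define D where "D = K / \<Delta>_min * (2 * B)"
        have deg: "1 \<le> real (gqsp_degree (G k (\<epsilon>W i)))" "real (gqsp_degree (G k (\<epsilon>W i))) \<le> D" if k: "k \<le> l" for k
        proof -
          have pck: "projector_circuit N P Or k (\<epsilon>W i) (G k (\<epsilon>W i))"
            and d: "real (gqsp_degree (G k (\<epsilon>W i))) \<le> K / phase_gap N (P k) * ln (1 / \<epsilon>W i)"
            using G W[of i] e(1) k unfolding projector_family_def by auto
          show "1 \<le> real (gqsp_degree (G k (\<epsilon>W i)))"
            using gqsp_degree_pos[of N P, OF chain[OF k] N(1) pck] W[of i] by simp
          note d
          also have "K / phase_gap N (P k) * ln (1 / \<epsilon>W i) \<le> K / \<Delta>_min * ln (1 / \<epsilon>W i)"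
            using assms(1) gap[OF k] \<Delta>[OF k] \<Delta>0 W[of i]
            by (intro mult_right_mono divide_left_mono) (auto simp: less_imp_le ln_ge_zero)
          also have "\<dots> \<le> D" unfolding D_def using bounds(2) assms(1) \<Delta>0 by (intro mult_left_mono) auto
          finally show "real (gqsp_degree (G k (\<epsilon>W i))) \<le> D" .
        qed
        have k: "i \<le> l" "Suc i \<le> l" using i by auto
        have len: "real (length (fp i (\<epsilon>F i))) \<le> L i / 2" by (simp add: L_def schedule_len_def)
        \<comment> \<open>Since \<open>1 \<le> D\<close>, the 4 queries of the outer oracles are at
          most \<open>4 * D\<close>, and each degree contributes another
          \<open>4 * D\<close>.\<close>
        have D: "4 + 4 * real (gqsp_degree (G i (\<epsilon>W i))) + 4 * real (gqsp_degree (G (Suc i) (\<epsilon>W i))) \<le> 12 * D"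
          using deg[OF k(1)] deg[OF k(2)] by linarith
        have "real (length (fp i (\<epsilon>F i))
            * (4 + 4 * gqsp_degree (G i (\<epsilon>W i)) + 4 * gqsp_degree (G (Suc i) (\<epsilon>W i)))) \<le> (L i / 2) * (12 * D)"
          using mult_mono[OF len D] L1[of i] by simp
        also have "\<dots> \<le> (K / sqrt p_min * (2 * a)) / 2 * (12 * D)"
          using deg[OF k(1)] by (intro mult_right_mono divide_right_mono bounds(1)) auto
        also have "\<dots> = 24 * K\<^sup>2 / (sqrt p_min * \<Delta>_min) * a * B"
          by (simp add: D_def power2_eq_square)
        finally show ?thesis .
      qed
      have "queries (qsample_circuit l G fp \<epsilon>F \<epsilon>W) = (\<Sum>i<l. length (fp i (\<epsilon>F i))
          * (4 + 4 * gqsp_degree (G i (\<epsilon>W i)) + 4 * gqsp_degree (G (Suc i) (\<epsilon>W i))))"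
        by (rule queries_qsample_circuit) (use pc in \<open>auto simp: projector_circuit_def\<close>)
      then have "real (queries (qsample_circuit l G fp \<epsilon>F \<epsilon>W)) = (\<Sum>i<l. real (length (fp i (\<epsilon>F i))
          * (4 + 4 * gqsp_degree (G i (\<epsilon>W i)) + 4 * gqsp_degree (G (Suc i) (\<epsilon>W i)))))"
        by (simp only: of_nat_sum)
      also have "\<dots> \<le> (\<Sum>i<l. 24 * K\<^sup>2 / (sqrt p_min * \<Delta>_min) * a * B)"
        using stage by (intro sum_mono) simp
      also have "\<dots> = 24 * K\<^sup>2 * (real l / (sqrt p_min * \<Delta>_min) * a * B)" by simp
      finally show ?thesis by (simp only: a_def B_def)
    qed
    show "let p_min = Min (p ` {..<l}); \<Delta>_min = Min ((\<lambda>k. phase_gap N (P k)) ` {..l}) in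
      \<exists>\<epsilon>F \<epsilon>W. admissible_accuracies l fp \<epsilon> \<epsilon>F \<epsilon>W
        \<and> (let c = qsample_circuit l G fp \<epsilon>F \<epsilon>W in
            trace_dist (qsample_output N Or \<mu> c) (init_embed N *\<^sub>v qsample N (\<mu> l)) \<le> \<epsilon>
            \<and> circuit_qubits N c \<le> 2 * state_qubits N + 1
            \<and> (\<epsilon> \<le> \<epsilon>\<^sub>0 \<longrightarrow> real (queries c) \<le>
                 24 * K\<^sup>2 * (real l / (sqrt p_min * \<Delta>_min) * ln (real l / \<epsilon>)
                      * ln (real l / (\<epsilon> * sqrt p_min) * ln (real l / \<epsilon>)))))"
      unfolding Let_def p_min_def[symmetric] \<Delta>_min_def[symmetric]
      using adm td query circuit_qubits_le by blast
  qed
qed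

end
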